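(* Let $E\subset\mathbb{C}$ be a connected compact set with $\operatorname{cap}(E)>0$. (i) If the center of mass $c := \int z\,d\mu_E(z)$ of $\mu_E$ belongs to $E$, then $M_E < 2 + 4.02/\pi$. (ii) If $E$ is convex, then $M_E < 2 + 4/\pi$.
   Context: For a compact set $K\subset\mathbb{C}$, $\operatorname{cap}(K)$ denotes its logarithmic capacity, and if $\operatorname{cap}(K)>0$, $\mu_K$ denotes its equilibrium measure. Define $d_K(z) := \max_{t\in K}|z-t|$ for $z\in\mathbb{C}$, and for compact $K$ with $\operatorname{cap}(K)>0$ define $$M_K := \frac{\exp\left(\int \log d_K(z)\,d\mu_K(z)\right)}{\operatorname{cap}(K)}.$$ *)

theory Defs
  imports "HOL-Probability.Probability"
begin

definition prob_measures_on :: "complex set \<Rightarrow> complex measure set" where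
  "prob_measures_on K = {\<mu>. sets \<mu> = sets borel \<and> prob_space \<mu> \<and> emeasure \<mu> (UNIV - K) = 0}"

definition log_kernel_pos :: "complex \<times> complex \<Rightarrow> ennreal" where
  "log_kernel_pos p = (if fst p = snd p then \<infinity>
      else ennreal (max 0 (- ln (cmod (fst p - snd p)))))"

definition log_kernel_neg :: "complex \<times> complex \<Rightarrow> ennreal" where
  "log_kernel_neg p = ennreal (max 0 (ln (cmod (fst p - snd p))))"

definition log_energy :: "complex measure \<Rightarrow> ereal" where
  "log_energy \<mu> = enn2ereal (\<integral>\<^sup>+ p. log_kernel_pos p \<partial>(\<mu> \<Otimes>\<^sub>M \<mu>))
                 - enn2ereal (\<integral>\<^sup>+ p. log_kernel_neg p \<partial>(\<mu> \<Otimes>\<^sub>M \<mu>))"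

definition robin_const :: "complex set \<Rightarrow> ereal" where
  "robin_const K = (INF \<mu>\<in>prob_measures_on K. log_energy \<mu>)"

definition log_cap :: "complex set \<Rightarrow> real" where
  "log_cap K = (if robin_const K = \<infinity> then 0 else exp (- real_of_ereal (robin_const K)))"

text \<open>Equilibrium measure: the (unique, when cap K > 0) energy minimiser.\<close>
definition equilibrium_measure :: "complex set \<Rightarrow> complex measure" where
  "equilibrium_measure K =
     (THE \<mu>. \<mu> \<in> prob_measures_on K \<and> log_energy \<mu> = robin_const K)"

definition d_fun :: "complex set \<Rightarrow> complex \<Rightarrow> real" where
  "d_fun K z = (SUP t\<in>K. cmod (z - t))"

definition M_const :: "complex set \<Rightarrow> real" where
  "M_const K = exp (\<integral>z. ln (d_fun K z) \<partial>(equilibrium_measure K)) / log_cap K"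

end

theory Submission
  imports Defs "HOL-Complex_Analysis.Complex_Analysis"
begin

text \<open>
  Let \<open>F u = C (1 / u + h u)\<close>, \<open>0 < |u| < 1\<close>, map the punctured disc conformally onto the unbounded
  component of the complement of \<open>E\<close>. Then \<open>cap E = C\<close>, the equilibrium measure is the image of the
  uniform measure on the circle under the radial limits of \<open>F\<close>, and its center of mass is
  \<open>c = C h 0\<close>. The area theorem, applied to square-root transforms of \<open>F\<close>, gives
  \<open>|w - c| \<le> 2 C\<close> on \<open>E\<close>, so that \<open>d z \<le> |z - c| + 2 C\<close>. When \<open>c\<close> lies in \<open>E\<close>, put
  \<open>X z = |z - c| / C\<close> and let \<open>\<tau> \<in> [0, 1]\<close> be the square of \<open>|h' 0|\<close>. The area theorem and Parseval give
  \<open>m\<^sub>1 \<le> 6 / 5 + \<tau> / 10\<close> and \<open>m\<^sub>2 \<ge> 1 + \<tau>\<close> for the moments of \<open>X\<close>: a large mean forces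
  a large variance.
  Replacing Jensen's inequality for \<open>ln (2 + X)\<close> by a quadratic majorant exploits the variance and
  yields \<open>M < 3.2617\<close>, which is below both bounds. For convex \<open>E\<close> the center of mass is in \<open>E\<close>.
\<close>

section \<open>Positive definiteness of the logarithmic energy\<close>

text \<open>One positivity statement drives both halves of the proof: the logarithmic energy of a
  difference of two probability measures dominates the square of an L2 distance. Applied to
  densities on the image of a circle it yields the area theorem; applied to a competitor and the
  measures on level curves it yields the capacity and, since \<open>equilibrium_measure\<close> is a
  definite description, the uniqueness of the minimiser. Energies may be infinite, so they are kept
  in \<open>ennreal\<close>, inequalities are written additively, and a diameter bound
  \<open>R\<close> makes the kernel nonnegative. The boundary of \<open>E\<close> is arbitrary and
  \<open>F\<close> need not extend continuously to the circle; the area theorem replaces boundary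
  regularity, because it makes \<open>F\<close> converge almost everywhere along radii that tend to
  1 geometrically. The variance matters since Jensen's inequality alone gives only M <= 2 + 13/10
  when \<tau> = 1, above 2 + 4/pi = 3.273... In the quadratic majorant \<tau> enters with weight
  0.0404 through the mean and -0.039 through the second moment, so the bound hardly depends on
  it.\<close>

lemma nn_integral_gaussian_real:
  fixes s a :: real
  assumes "s > 0"
  shows "(\<integral>\<^sup>+ x. ennreal (exp (- s * (a - x)\<^sup>2)) \<partial>lborel) = ennreal (sqrt (pi / s))"
proof -
  define \<sigma> where "\<sigma> = sqrt (1 / (2 * s))"
  have \<sigma>: "\<sigma> > 0" "\<sigma>\<^sup>2 = 1 / (2 * s)" using assms by (auto simp: \<sigma>_def)
  have eq: "exp (- s * (a - x)\<^sup>2) = sqrt (pi / s) * normal_density a \<sigma> x" for x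
  proof -
    have "2 * pi * \<sigma>\<^sup>2 = pi / s" using assms by (simp add: \<sigma> field_simps)
    moreover have "(x - a)\<^sup>2 / (2 * \<sigma>\<^sup>2) = s * (a - x)\<^sup>2"
      using assms by (simp add: \<sigma> field_simps power2_commute)
    ultimately show ?thesis using assms by (simp add: normal_density_def)
  qed
  have "(\<integral>\<^sup>+ x. ennreal (exp (- s * (a - x)\<^sup>2)) \<partial>lborel)
      = ennreal (sqrt (pi / s)) * (\<integral>\<^sup>+ x. ennreal (normal_density a \<sigma> x) \<partial>lborel)"
    unfolding eq using assms by (simp add: ennreal_mult nn_integral_cmult)
  also have "(\<integral>\<^sup>+ x. ennreal (normal_density a \<sigma> x) \<partial>lborel) = 1"
    using integral_normal_density[OF \<sigma>(1), of a] integrable_normal_density[OF \<sigma>(1), of a]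
    by (subst nn_integral_eq_integral) auto
  finally show ?thesis by simp
qed

lemma nn_integral_gaussian_complex:
  fixes s :: real and z :: complex
  assumes "s > 0"
  shows "(\<integral>\<^sup>+ u. ennreal (exp (- s * (cmod (z - u))\<^sup>2)) \<partial>lborel) = ennreal (pi / s)"
proof -
  define f where "f = (\<lambda>b x. exp (- s * (z \<bullet> b - x)\<^sup>2))"
  have "exp (- s * (cmod (z - u))\<^sup>2) = (\<Prod>b\<in>Basis. f b (u \<bullet> b))" for u
    by (simp add: f_def Basis_complex_def cmod_power2 complex_i_not_one[symmetric] flip: exp_add)
       (simp add: algebra_simps)
  hence "(\<integral>\<^sup>+ u. ennreal (exp (- s * (cmod (z - u))\<^sup>2)) \<partial>lborel)
      = (\<Prod>b\<in>Basis. (\<integral>\<^sup>+x. ennreal (f b x) \<partial>lborel))"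
    using nn_integral_lborel_prod[of "\<lambda>b x. ennreal (f b x)"] by (simp add: f_def prod_ennreal)
  also have "\<dots> = (\<Prod>b\<in>(Basis::complex set). ennreal (sqrt (pi / s)))"
    using assms by (intro prod.cong refl) (simp only: f_def nn_integral_gaussian_real)
  also have "\<dots> = ennreal (pi / s)"
    using assms by (simp add: power2_eq_square flip: ennreal_mult)
  finally show ?thesis .
qed

text \<open>Completes the square in the exponent: a product of two Gaussians in \<open>u\<close> is
  a Gaussian around the midpoint times a factor depending on \<open>z - w\<close> only.\<close>

lemma parallelogram_midpoint:
  fixes z w u :: complex
  shows "(cmod (z - u))\<^sup>2 + (cmod (w - u))\<^sup>2
       = 2 * (cmod ((z + w) / 2 - u))\<^sup>2 + (cmod (z - w))\<^sup>2 / 2"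
  unfolding cmod_power2 by (simp add: power2_eq_square field_simps)

text \<open>Up to scale the Gaussian is a convolution square, so exp(-s |z-w|^2) is an L2 inner
  product of Gaussians centred at \<open>z\<close> and \<open>w\<close>. This is its positive
  definiteness in explicit form.\<close>

lemma nn_integral_gaussian_mult:
  fixes s :: real and z w :: complex
  assumes "s > 0"
  shows "(\<integral>\<^sup>+ u. ennreal (exp (- 2 * s * (cmod (z - u))\<^sup>2) * exp (- 2 * s * (cmod (w - u))\<^sup>2)) \<partial>lborel)
       = ennreal (exp (- s * (cmod (z - w))\<^sup>2) * (pi / (4 * s)))"
proof -
  have "exp (- 2 * s * (cmod (z - u))\<^sup>2) * exp (- 2 * s * (cmod (w - u))\<^sup>2)
     = exp (- s * (cmod (z - w))\<^sup>2) * exp (- (4 * s) * (cmod ((z + w) / 2 - u))\<^sup>2)" for u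
  proof -
    have "- 2 * s * (cmod (z - u))\<^sup>2 + - 2 * s * (cmod (w - u))\<^sup>2
        = - (2 * s) * ((cmod (z - u))\<^sup>2 + (cmod (w - u))\<^sup>2)"
      by (simp add: algebra_simps)
    also have "\<dots> = - s * (cmod (z - w))\<^sup>2 + - (4 * s) * (cmod ((z + w) / 2 - u))\<^sup>2"
      unfolding parallelogram_midpoint by (simp add: algebra_simps)
    finally show ?thesis unfolding exp_add[symmetric] by simp
  qed
  thus ?thesis using assms nn_integral_gaussian_complex[of "4 * s" "(z + w) / 2"]
    by (simp add: ennreal_mult nn_integral_cmult del: mult_minus_left times_divide_eq_right)
qed

lemma nn_integral_exp_Ioi:
  fixes a :: real
  assumes "a > 0"
  shows "(\<integral>\<^sup>+ s. ennreal (exp (- s * a)) * indicator {0<..} s \<partial>lborel) = ennreal (1 / a)"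
proof -
  have "(\<integral>\<^sup>+ s. ennreal (exp (- s * a)) * indicator {0<..} s \<partial>lborel)
     = (\<integral>\<^sup>+ s. ennreal (exp (- s * a)) * indicator {0..} s \<partial>lborel)"
    by (rule nn_integral_cong_AE, rule AE_mp[OF AE_lborel_singleton[of 0]])
       (auto simp: indicator_def)
  also have "\<dots> = ennreal (0 - (- exp (- 0 * a) / a))"
  proof (rule nn_integral_FTC_atLeast)
    have "((\<lambda>x. exp (- (a * x)) / a) \<longlongrightarrow> 0) at_top"
      using assms by real_asymp
    from tendsto_minus[OF this] show "((\<lambda>x. - exp (- x * a) / a) \<longlongrightarrow> 0) at_top"
      by (simp add: mult.commute)
    show "((\<lambda>x. - exp (- x * a) / a) has_real_derivative exp (- x * a)) (at x)" for x
      using assms by (auto intro!: derivative_eq_intros simp: field_simps)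
  qed auto
  finally show ?thesis by simp
qed

lemma nn_integral_inverse_shift:
  fixes x T :: real
  assumes "T > 0" "x > 0"
  shows "(\<integral>\<^sup>+ t. ennreal (1 / (x + t)) * indicator {0<..<T} t \<partial>lborel) = ennreal (ln ((x + T) / x))"
proof -
  have "(\<integral>\<^sup>+ t. ennreal (1 / (x + t)) * indicator {0<..<T} t \<partial>lborel)
     = (\<integral>\<^sup>+ t. ennreal (1 / (x + t)) * indicator {0..T} t \<partial>lborel)"
    by (rule nn_integral_cong_AE, rule AE_mp[OF AE_lborel_singleton[of 0] AE_mp[OF AE_lborel_singleton[of T]]])
       (auto simp: indicator_def)
  also have "\<dots> = ennreal (ln (x + T) - ln (x + 0))"
    using assms by (intro nn_integral_FTC_Icc[where F = "\<lambda>t. ln (x + t)"])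
      (auto intro!: derivative_eq_intros simp: field_simps has_real_derivative_iff_has_vector_derivative[symmetric])
  finally show ?thesis using assms by (simp add: ln_div)
qed

text \<open>Provides the value on the diagonal. Shifting \<open>t\<close> by \<open>x\<close> only
  lowers the integrand, and the shifted integral is an explicit logarithm, unbounded as
  \<open>x\<close> tends to 0.\<close>

lemma nn_integral_inverse_0:
  fixes T :: real
  assumes "T > 0"
  shows "(\<integral>\<^sup>+ t. ennreal (1 / t) * indicator {0<..<T} t \<partial>lborel) = \<infinity>"
proof -
  have *: "ennreal (ln ((x + T) / x)) \<le> (\<integral>\<^sup>+ t. ennreal (1 / t) * indicator {0<..<T} t \<partial>lborel)" if "x > 0" for x
    unfolding nn_integral_inverse_shift[OF assms that, symmetric]
    using that by (intro nn_integral_mono) (auto simp: indicator_def frac_le intro!: ennreal_leI)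
  have le: "ennreal n \<le> (\<integral>\<^sup>+ t. ennreal (1 / t) * indicator {0<..<T} t \<partial>lborel)" (is "_ \<le> ?I") for n
  proof -
    have "(T / exp n + T) / (T / exp n) = 1 + exp n" using assms by (simp add: field_simps)
    hence "n \<le> ln ((T / exp n + T) / (T / exp n))"
      by (simp add: ln_ge_iff add_pos_pos)
    thus ?thesis using * [of "T / exp n"] assms
      by (metis divide_pos_pos ennreal_leI exp_gt_zero order_trans)
  qed
  show ?thesis
  proof (rule ccontr)
    assume "?I \<noteq> \<infinity>"
    then obtain r where "?I = ennreal r" "r \<ge> 0" by (metis ennreal_cases infinity_ennreal_def)
    with le[of "r + 1"] show False by (simp add: ennreal_le_iff)
  qed
qed

text \<open>The kernel \<open>ln ((|z - w|\<^sup>2 + T) / |z - w|\<^sup>2)\<close> is the integral of \<open>1 / (|z - w|\<^sup>2 + t)\<close> over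
  \<open>0 < t < T\<close>, hence a superposition of the positive definite kernels \<open>exp (- s |z - w|\<^sup>2)\<close>. As
  \<open>T\<close> tends to infinity it differs from the logarithmic kernel by a constant in the limit.\<close>

definition gauss_feature :: "real \<Rightarrow> real \<times> real \<times> complex \<Rightarrow> complex \<Rightarrow> real" where
  "gauss_feature T p z = (case p of (t, s, u) \<Rightarrow> indicator {0<..<T} t * indicator {0<..} s *
     sqrt (exp (- s * t) * (4 * s / pi)) * exp (- 2 * s * (cmod (z - u))\<^sup>2))"

lemma gauss_feature_measurable [measurable]:
  "(\<lambda>x. gauss_feature T (fst x) (snd x)) \<in> borel_measurable borel"
  unfolding gauss_feature_def case_prod_beta by (simp add: borel_prod[symmetric])

lemma gauss_feature_measurable' [measurable (raw)]:
  assumes [measurable]: "f \<in> borel_measurable M" "g \<in> borel_measurable M"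
  shows "(\<lambda>x. gauss_feature T (f x) (g x)) \<in> borel_measurable M"
proof -
  have "(\<lambda>x. (f x, g x)) \<in> borel_measurable M" by measurable
  from measurable_compose[OF this gauss_feature_measurable] show ?thesis by simp
qed

lemma gauss_feature_nonneg: "gauss_feature T p z \<ge> 0"
  by (auto simp: gauss_feature_def indicator_def split: prod.splits)

lemma gauss_feature_le: "gauss_feature T p z \<le> sqrt (4 * \<bar>fst (snd p)\<bar> / pi)"
proof (cases p)
  case (fields t s u)
  show ?thesis
  proof (cases "t \<in> {0<..<T} \<and> s > 0")
    case True
    have "sqrt (exp (- s * t) * (4 * s / pi)) \<le> sqrt (4 * s / pi)"
      using True by (intro real_sqrt_le_mono mult_left_le_one_le) auto
    moreover have "exp (- 2 * s * (cmod (z - u))\<^sup>2) \<le> 1" using True by auto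
    ultimately have "sqrt (exp (- s * t) * (4 * s / pi)) * exp (- 2 * s * (cmod (z - u))\<^sup>2) \<le> sqrt (4 * s / pi) * 1"
      using True by (intro mult_mono) auto
    thus ?thesis using True by (simp add: fields gauss_feature_def)
  next
    case False
    hence "gauss_feature T p z = 0" by (auto simp: fields gauss_feature_def)
    thus ?thesis by (simp del: real_sqrt_divide)
  qed
qed

lemma nn_integral_lborel_pair:
  fixes f :: "'a::euclidean_space \<times> 'b::euclidean_space \<Rightarrow> ennreal"
  assumes [measurable]: "f \<in> borel_measurable borel"
  shows "(\<integral>\<^sup>+ p. f p \<partial>lborel) = (\<integral>\<^sup>+ x. \<integral>\<^sup>+ y. f (x, y) \<partial>lborel \<partial>lborel)"
proof -
  have "f \<in> borel_measurable (lborel \<Otimes>\<^sub>M lborel)" by (simp add: lborel_prod)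
  from sigma_finite_measure.nn_integral_fst[OF sigma_finite_lborel this] show ?thesis
    by (simp add: lborel_prod)
qed

text \<open>The factor \<open>4 * s / pi\<close> from the two features cancels the mass
  \<open>pi / (4 * s)\<close> of the product of Gaussians. What remains is exp(-s (x + t)) with x =
  |z-w|^2; integrating over \<open>s\<close> gives 1 / (x + t), and over \<open>t\<close> the
  logarithm.\<close>

lemma nn_integral_gauss_feature:
  assumes "T > 0"
  shows "(\<integral>\<^sup>+ p. ennreal (gauss_feature T p z * gauss_feature T p w) \<partial>lborel)
       = (if z = w then \<infinity> else ennreal (ln (((cmod (z - w))\<^sup>2 + T) / (cmod (z - w))\<^sup>2)))"
proof -
  define x where "x = (cmod (z - w))\<^sup>2"
  have "(\<integral>\<^sup>+ p. ennreal (gauss_feature T p z * gauss_feature T p w) \<partial>lborel)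
     = (\<integral>\<^sup>+ t. \<integral>\<^sup>+ s. \<integral>\<^sup>+ u. ennreal (gauss_feature T (t, s, u) z * gauss_feature T (t, s, u) w) \<partial>lborel \<partial>lborel \<partial>lborel)"
    by (simp add: nn_integral_lborel_pair)
  also have "\<dots> = (\<integral>\<^sup>+ t. \<integral>\<^sup>+ s. ennreal (exp (- s * (x + t))) * indicator {0<..} s * indicator {0<..<T} t \<partial>lborel \<partial>lborel)"
  proof (intro nn_integral_cong)
    fix t s :: real
    show "(\<integral>\<^sup>+ u. ennreal (gauss_feature T (t, s, u) z * gauss_feature T (t, s, u) w) \<partial>lborel)
       = ennreal (exp (- s * (x + t))) * indicator {0<..} s * indicator {0<..<T} t"
    proof (cases "t \<in> {0<..<T} \<and> s > 0")
      case True
      have prod: "gauss_feature T (t, s, u) z * gauss_feature T (t, s, u) w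
          = (exp (- s * t) * (4 * s / pi)) * (exp (- 2 * s * (cmod (z - u))\<^sup>2) * exp (- 2 * s * (cmod (w - u))\<^sup>2))" for u
      proof -
        have *: "(sqrt a * b) * (sqrt a * c) = a * (b * c)" if "a \<ge> 0" for a b c :: real
          using that by (simp add: mult.left_commute mult.assoc[symmetric])
        show ?thesis using True *[of "exp (- s * t) * (4 * s / pi)"]
          by (simp add: gauss_feature_def)
      qed
      have "(\<integral>\<^sup>+ u. ennreal (gauss_feature T (t, s, u) z * gauss_feature T (t, s, u) w) \<partial>lborel)
         = (\<integral>\<^sup>+ u. ennreal (exp (- s * t) * (4 * s / pi)) *
             ennreal (exp (- 2 * s * (cmod (z - u))\<^sup>2) * exp (- 2 * s * (cmod (w - u))\<^sup>2)) \<partial>lborel)"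
        unfolding prod using True by (intro nn_integral_cong ennreal_mult') auto
      also have "\<dots> = ennreal (exp (- s * t) * (4 * s / pi)) * ennreal (exp (- s * x) * (pi / (4 * s)))"
        using True by (subst nn_integral_cmult) (measurable, simp only: nn_integral_gaussian_mult x_def)
      also have "\<dots> = ennreal (exp (- s * (x + t)))"
        using True by (simp add: ring_distribs exp_add exp_diff exp_minus field_simps flip: ennreal_mult)
      finally show ?thesis using True by simp
    next
      case False
      hence zero: "gauss_feature T (t, s, u) z * gauss_feature T (t, s, u) w = 0" for u
        by (auto simp: gauss_feature_def)
      show ?thesis using False unfolding zero by (auto simp: indicator_def)
    qed
  qed
  also have "\<dots> = (\<integral>\<^sup>+ t. ennreal (1 / (x + t)) * indicator {0<..<T} t \<partial>lborel)"
  proof (intro nn_integral_cong)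
    fix t :: real
    show "(\<integral>\<^sup>+ s. ennreal (exp (- s * (x + t))) * indicator {0<..} s * indicator {0<..<T} t \<partial>lborel)
      = ennreal (1 / (x + t)) * indicator {0<..<T} t"
    proof (cases "t \<in> {0<..<T}")
      case True
      hence "x + t > 0" by (auto simp: x_def intro: add_nonneg_pos)
      thus ?thesis using nn_integral_exp_Ioi[of "x + t"] True by simp
    qed auto
  qed
  also have "\<dots> = (if z = w then \<infinity> else ennreal (ln ((x + T) / x)))"
    using nn_integral_inverse_0[OF assms] nn_integral_inverse_shift[OF assms, of x]
    by (auto simp: x_def)
  finally show ?thesis by (simp add: x_def)
qed

section \<open>Measures as elements of an L2 space\<close>

definition gauss_mean :: "real \<Rightarrow> complex measure \<Rightarrow> real \<times> real \<times> complex \<Rightarrow> real" where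
  "gauss_mean T \<mu> p = (\<integral>z. gauss_feature T p z \<partial>\<mu>)"

lemma gauss_feature_integrable:
  assumes "finite_measure \<mu>" and [measurable_cong]: "sets \<mu> = sets borel"
  shows "integrable \<mu> (gauss_feature T p)"
proof -
  interpret finite_measure \<mu> by fact
  show ?thesis
    by (rule integrable_const_bound[where B = "sqrt (4 * \<bar>fst (snd p)\<bar> / pi)"])
       (auto simp: gauss_feature_nonneg gauss_feature_le)
qed

lemma gauss_mean_nonneg: "gauss_mean T \<mu> p \<ge> 0"
  unfolding gauss_mean_def by (intro Bochner_Integration.integral_nonneg gauss_feature_nonneg)

lemma gauss_mean_measurable [measurable]:
  assumes "finite_measure \<mu>" and [measurable_cong]: "sets \<mu> = sets borel"
  shows "gauss_mean T \<mu> \<in> borel_measurable borel"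
proof -
  interpret finite_measure \<mu> by fact
  have "(\<lambda>x. gauss_feature T (fst x) (snd x)) \<in> borel_measurable (borel \<Otimes>\<^sub>M \<mu>)"
    by measurable
  thus ?thesis unfolding gauss_mean_def
    by (intro borel_measurable_lebesgue_integral) (simp add: case_prod_beta)
qed

definition reg_energy :: "real \<Rightarrow> complex measure \<Rightarrow> complex measure \<Rightarrow> ennreal" where
  "reg_energy T \<mu> \<nu> = (\<integral>\<^sup>+ z. \<integral>\<^sup>+ w. (\<integral>\<^sup>+ p. ennreal (gauss_feature T p z * gauss_feature T p w) \<partial>lborel) \<partial>\<nu> \<partial>\<mu>)"

text \<open>The squared L2 distance between the mean features of two measures, known as the squared
  maximum mean discrepancy of the kernel.\<close>

definition gauss_dist :: "real \<Rightarrow> complex measure \<Rightarrow> complex measure \<Rightarrow> ennreal" where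
  "gauss_dist T \<mu> \<nu> = (\<integral>\<^sup>+ p. ennreal ((gauss_mean T \<mu> p - gauss_mean T \<nu> p)\<^sup>2) \<partial>lborel)"

text \<open>Tonelli moves the integrals over \<open>z\<close> and \<open>w\<close> inside, where the
  product of features splits: the energy is an L2 inner product of mean features.\<close>

lemma reg_energy_eq:
  assumes \<mu>: "finite_measure \<mu>" "sets \<mu> = sets borel" and \<nu>: "finite_measure \<nu>" "sets \<nu> = sets borel"
  shows "reg_energy T \<mu> \<nu> = (\<integral>\<^sup>+ p. ennreal (gauss_mean T \<mu> p * gauss_mean T \<nu> p) \<partial>lborel)"
proof -
  note [measurable_cong] = \<mu>(2) \<nu>(2)
  interpret M: finite_measure \<mu> by fact
  interpret N: finite_measure \<nu> by fact
  interpret P: pair_sigma_finite \<nu> "lborel :: (real \<times> real \<times> complex) measure" ..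
  interpret Q: pair_sigma_finite \<mu> "lborel :: (real \<times> real \<times> complex) measure" ..
  have nn: "(\<integral>\<^sup>+ z. ennreal (gauss_feature T p z) \<partial>M) = ennreal (gauss_mean T M p)"
    if "finite_measure M" "sets M = sets borel" for M p
    unfolding gauss_mean_def
    by (intro nn_integral_eq_integral gauss_feature_integrable that AE_I2 gauss_feature_nonneg)
  have "reg_energy T \<mu> \<nu> = (\<integral>\<^sup>+ z. \<integral>\<^sup>+ p. \<integral>\<^sup>+ w. ennreal (gauss_feature T p z * gauss_feature T p w) \<partial>\<nu> \<partial>lborel \<partial>\<mu>)"
    unfolding reg_energy_def by (intro nn_integral_cong P.Fubini'[symmetric]) simp
  also have "\<dots> = (\<integral>\<^sup>+ z. \<integral>\<^sup>+ p. ennreal (gauss_feature T p z) * ennreal (gauss_mean T \<nu> p) \<partial>lborel \<partial>\<mu>)"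
    by (intro nn_integral_cong)
       (simp add: ennreal_mult gauss_feature_nonneg nn_integral_cmult nn[OF \<nu>])
  also have "\<dots> = (\<integral>\<^sup>+ p. \<integral>\<^sup>+ z. ennreal (gauss_feature T p z) * ennreal (gauss_mean T \<nu> p) \<partial>\<mu> \<partial>lborel)"
    using gauss_mean_measurable[OF \<nu>, measurable] by (intro Q.Fubini'[symmetric]) simp
  also have "\<dots> = (\<integral>\<^sup>+ p. ennreal (gauss_mean T \<mu> p * gauss_mean T \<nu> p) \<partial>lborel)"
    by (intro nn_integral_cong)
       (simp add: ennreal_mult gauss_mean_nonneg nn_integral_multc nn[OF \<mu>])
  finally show ?thesis .
qed

text \<open>The expansion of (a - b)^2 under the integral. Subtraction is avoided because each
  energy may be infinite.\<close>

lemma reg_energy_gauss_dist: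
  assumes \<mu>: "finite_measure \<mu>" "sets \<mu> = sets borel" and \<nu>: "finite_measure \<nu>" "sets \<nu> = sets borel"
  shows "2 * reg_energy T \<mu> \<nu> + gauss_dist T \<mu> \<nu> = reg_energy T \<mu> \<mu> + reg_energy T \<nu> \<nu>"
proof -
  note [measurable] = gauss_mean_measurable[OF \<mu>] gauss_mean_measurable[OF \<nu>]
  have *: "2 * ennreal (a * b) + ennreal ((a - b)\<^sup>2) = ennreal (a * a) + ennreal (b * b)"
    if "a \<ge> 0" "b \<ge> 0" for a b :: real
  proof -
    have "2 * ennreal (a * b) + ennreal ((a - b)\<^sup>2) = ennreal (2 * (a * b) + (a - b)\<^sup>2)"
      using that by (simp add: ennreal_plus ennreal_mult'')
    thus ?thesis using that by (simp add: power2_eq_square algebra_simps flip: ennreal_plus)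
  qed
  show ?thesis
    unfolding reg_energy_eq[OF \<mu> \<nu>] reg_energy_eq[OF \<mu> \<mu>] reg_energy_eq[OF \<nu> \<nu>] gauss_dist_def
    by (simp add: nn_integral_cmult[symmetric] nn_integral_add[symmetric] * gauss_mean_nonneg)
qed

section \<open>Comparison of the logarithmic kernel with its regularisation\<close>

definition log_kernel :: "real \<Rightarrow> complex \<Rightarrow> complex \<Rightarrow> ennreal" where
  "log_kernel R z w = (if z = w then \<infinity> else ennreal (2 * ln (R / cmod (z - w))))"

lemma log_kernel_measurable [measurable (raw)]:
  assumes [measurable]: "f \<in> borel_measurable M" "g \<in> borel_measurable M"
  shows "(\<lambda>x. log_kernel R (f x) (g x)) \<in> borel_measurable M"
  unfolding log_kernel_def by measurable

text \<open>\<open>R\<close> is meant to bound the distances between points of the supports, so that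
  the kernel is nonnegative and the energy lives in \<open>ennreal\<close>. The factor 2 in the
  kernel matches the squared distance in the Gaussian kernels.\<close>

definition mutual_energy :: "real \<Rightarrow> complex measure \<Rightarrow> complex measure \<Rightarrow> ennreal" where
  "mutual_energy R \<mu> \<nu> = (\<integral>\<^sup>+ z. \<integral>\<^sup>+ w. log_kernel R z w \<partial>\<nu> \<partial>\<mu>)"

text \<open>With x = |z-w| one has (x^2 + T) / x^2 = (R/x)^2 (T/R^2) (1 + x^2/T), and the logarithm
  of the last factor lies between 0 and R^2/T. The condition \<open>T \<ge> R\<^sup>2\<close> makes
  the constant nonnegative, hence faithful in \<open>ennreal\<close>.\<close>

lemma log_kernel_bounds:
  assumes "R > 0" "T \<ge> R\<^sup>2" "cmod (z - w) \<le> R"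
  defines "K \<equiv> (\<integral>\<^sup>+ p. ennreal (gauss_feature T p z * gauss_feature T p w) \<partial>lborel)"
  shows "log_kernel R z w + ennreal (ln (T / R\<^sup>2)) \<le> K"
    and "K \<le> log_kernel R z w + ennreal (ln (T / R\<^sup>2) + R\<^sup>2 / T)"
proof -
  have T: "T > 0" using assms by (smt (verit) zero_less_power)
  have c: "ln (T / R\<^sup>2) \<ge> 0" using assms by (intro ln_ge_zero) (auto simp: field_simps)
  have "log_kernel R z w + ennreal (ln (T / R\<^sup>2)) \<le> K \<and>
        K \<le> log_kernel R z w + ennreal (ln (T / R\<^sup>2) + R\<^sup>2 / T)"
  proof (cases "z = w")
    case True
    thus ?thesis using nn_integral_gauss_feature[OF T, of z w] by (simp add: K_def log_kernel_def)
  next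
    case False
    define x where "x = cmod (z - w)"
    have x: "x > 0" "x \<le> R" using False assms by (auto simp: x_def)
    have K: "K = ennreal (ln ((x\<^sup>2 + T) / x\<^sup>2))"
      using nn_integral_gauss_feature[OF T, of z w] False by (simp add: K_def x_def)
    have l: "log_kernel R z w = ennreal (2 * ln (R / x))" using False by (simp add: log_kernel_def x_def)
    have l0: "ln (R / x) \<ge> 0" using x by (intro ln_ge_zero) auto
    have "ln ((x\<^sup>2 + T) / x\<^sup>2) = ln ((R / x)\<^sup>2 * (T / R\<^sup>2) * (1 + x\<^sup>2 / T))"
      using x T assms(1) by (intro arg_cong[where f = ln]) (simp add: field_simps)
    also have "\<dots> = 2 * ln (R / x) + ln (T / R\<^sup>2) + ln (1 + x\<^sup>2 / T)"
    proof -
      have "1 + x\<^sup>2 / T > 0" "T / R\<^sup>2 > 0" "(R / x)\<^sup>2 > 0" using x T assms(1) by (auto simp: add_pos_nonneg)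
      moreover have "ln (a * b * c) = ln a + ln b + ln c" if "a > 0" "b > 0" "c > 0" for a b c :: real
        using that by (simp add: ln_mult)
      moreover have "ln ((R / x)\<^sup>2) = 2 * ln (R / x)"
        using x assms(1) by (subst ln_realpow) auto
      ultimately show ?thesis by presburger
    qed
    finally have eq: "ln ((x\<^sup>2 + T) / x\<^sup>2) = 2 * ln (R / x) + ln (T / R\<^sup>2) + ln (1 + x\<^sup>2 / T)" .
    have "ln (1 + x\<^sup>2 / T) \<le> x\<^sup>2 / T" using T by (intro ln_add_one_self_le_self) auto
    also have "\<dots> \<le> R\<^sup>2 / T" using x T by (intro divide_right_mono power_mono) auto
    finally have "ln (1 + x\<^sup>2 / T) \<le> R\<^sup>2 / T" .
    moreover have "ln (1 + x\<^sup>2 / T) \<ge> 0" using T by (intro ln_ge_zero) auto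
    moreover have "R\<^sup>2 / T \<ge> 0" using T by simp
    ultimately show ?thesis unfolding K l eq using c l0
      by (auto simp flip: ennreal_plus intro!: ennreal_leI)
  qed
  thus "log_kernel R z w + ennreal (ln (T / R\<^sup>2)) \<le> K"
    "K \<le> log_kernel R z w + ennreal (ln (T / R\<^sup>2) + R\<^sup>2 / T)" by auto
qed

lemma mutual_energy_bounds:
  assumes \<mu>: "prob_space \<mu>" "sets \<mu> = sets borel" "AE z in \<mu>. z \<in> S"
    and \<nu>: "prob_space \<nu>" "sets \<nu> = sets borel" "AE z in \<nu>. z \<in> S"
    and S: "\<And>z w. z \<in> S \<Longrightarrow> w \<in> S \<Longrightarrow> cmod (z - w) \<le> R" and R: "R > 0" "T \<ge> R\<^sup>2"
  shows "mutual_energy R \<mu> \<nu> + ennreal (ln (T / R\<^sup>2)) \<le> reg_energy T \<mu> \<nu>"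
    and "reg_energy T \<mu> \<nu> \<le> mutual_energy R \<mu> \<nu> + ennreal (ln (T / R\<^sup>2) + R\<^sup>2 / T)"
proof -
  note [measurable_cong] = \<mu>(2) \<nu>(2)
  interpret M: prob_space \<mu> by fact
  interpret N: prob_space \<nu> by fact
  have add: "mutual_energy R \<mu> \<nu> + ennreal c = (\<integral>\<^sup>+ z. \<integral>\<^sup>+ w. log_kernel R z w + ennreal c \<partial>\<nu> \<partial>\<mu>)" for c
    unfolding mutual_energy_def by (simp add: nn_integral_add M.emeasure_space_1 N.emeasure_space_1)
  show "mutual_energy R \<mu> \<nu> + ennreal (ln (T / R\<^sup>2)) \<le> reg_energy T \<mu> \<nu>"
    unfolding add reg_energy_def
  proof (rule nn_integral_mono_AE, rule AE_mp[OF \<mu>(3)], rule AE_I2, rule impI)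
    fix z assume "z \<in> S"
    show "(\<integral>\<^sup>+ w. log_kernel R z w + ennreal (ln (T / R\<^sup>2)) \<partial>\<nu>)
       \<le> (\<integral>\<^sup>+ w. (\<integral>\<^sup>+ p. ennreal (gauss_feature T p z * gauss_feature T p w) \<partial>lborel) \<partial>\<nu>)"
      by (rule nn_integral_mono_AE, rule AE_mp[OF \<nu>(3)], rule AE_I2, rule impI)
         (use R S \<open>z \<in> S\<close> in \<open>intro log_kernel_bounds(1); auto\<close>)
  qed
  show "reg_energy T \<mu> \<nu> \<le> mutual_energy R \<mu> \<nu> + ennreal (ln (T / R\<^sup>2) + R\<^sup>2 / T)"
    unfolding add reg_energy_def
  proof (rule nn_integral_mono_AE, rule AE_mp[OF \<mu>(3)], rule AE_I2, rule impI)
    fix z assume "z \<in> S"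
    show "(\<integral>\<^sup>+ w. (\<integral>\<^sup>+ p. ennreal (gauss_feature T p z * gauss_feature T p w) \<partial>lborel) \<partial>\<nu>)
       \<le> (\<integral>\<^sup>+ w. log_kernel R z w + ennreal (ln (T / R\<^sup>2) + R\<^sup>2 / T) \<partial>\<nu>)"
      by (rule nn_integral_mono_AE, rule AE_mp[OF \<nu>(3)], rule AE_I2, rule impI)
         (use R S \<open>z \<in> S\<close> in \<open>intro log_kernel_bounds(2); auto\<close>)
  qed
qed

text \<open>The feature at level \<open>T\<close> is the one at level \<open>T'\<close> cut off at
  \<open>t < T\<close>, so the same square is integrated over a smaller set.\<close>

lemma gauss_dist_mono:
  assumes "T \<le> T'"
  shows "gauss_dist T \<mu> \<nu> \<le> gauss_dist T' \<mu> \<nu>"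
proof -
  have "gauss_feature T p = (if fst p < T then gauss_feature T' p else (\<lambda>_. 0))" for p
    using assms by (auto simp: gauss_feature_def fun_eq_iff indicator_def split: prod.splits)
  hence "gauss_mean T M p = (if fst p < T then gauss_mean T' M p else 0)" for M p
    by (simp add: gauss_mean_def)
  thus ?thesis unfolding gauss_dist_def by (intro nn_integral_mono ennreal_leI) auto
qed

text \<open>In the exact identity at level \<open>T\<close> the divergent constant
  \<open>ln (T / R\<^sup>2)\<close> occurs twice on each side and cancels, while the errors vanish
  as \<open>T\<close> grows. Monotonicity in the level lets the distance at the fixed level 1
  survive the limit.\<close>

lemma mutual_energy_le:
  assumes \<mu>: "prob_space \<mu>" "sets \<mu> = sets borel" "AE z in \<mu>. z \<in> S"
    and \<nu>: "prob_space \<nu>" "sets \<nu> = sets borel" "AE z in \<nu>. z \<in> S"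
    and S: "\<And>z w. z \<in> S \<Longrightarrow> w \<in> S \<Longrightarrow> cmod (z - w) \<le> R" and R: "R > 0"
  shows "2 * mutual_energy R \<mu> \<nu> + gauss_dist 1 \<mu> \<nu> \<le> mutual_energy R \<mu> \<mu> + mutual_energy R \<nu> \<nu>"
proof (rule ennreal_le_epsilon)
  fix e :: real assume e: "e > 0"
  \<comment> \<open>The three bounds serve the comparison with level 1, the nonnegativity of
    \<open>c\<close> and a total error of at most \<open>e\<close>.\<close>
  define T where "T = Max {1, R\<^sup>2, 2 * R\<^sup>2 / e}"
  have T: "T \<ge> 1" "T \<ge> R\<^sup>2" "T \<ge> 2 * R\<^sup>2 / e" by (auto simp: T_def)
  define c where "c = ln (T / R\<^sup>2)"
  have c: "c \<ge> 0" unfolding c_def using T R by (intro ln_ge_zero) (auto simp: field_simps)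
  have eps: "R\<^sup>2 / T \<ge> 0" "2 * (R\<^sup>2 / T) \<le> e" using T e by (auto simp: field_simps)
  have fin: "finite_measure \<mu>" "finite_measure \<nu>"
    using \<mu> \<nu> by (simp_all add: prob_space.finite_measure)
  have "(2 * mutual_energy R \<mu> \<nu> + gauss_dist 1 \<mu> \<nu>) + 2 * ennreal c
     = 2 * (mutual_energy R \<mu> \<nu> + ennreal c) + gauss_dist 1 \<mu> \<nu>"
    by (simp add: distrib_left add_ac)
  also have "\<dots> \<le> 2 * reg_energy T \<mu> \<nu> + gauss_dist T \<mu> \<nu>"
    unfolding c_def using T
    by (intro add_mono mult_left_mono mutual_energy_bounds[OF \<mu> \<nu> S R] gauss_dist_mono) auto
  also have "\<dots> = reg_energy T \<mu> \<mu> + reg_energy T \<nu> \<nu>"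
    by (intro reg_energy_gauss_dist fin \<mu> \<nu>)
  also have "\<dots> \<le> (mutual_energy R \<mu> \<mu> + ennreal (c + R\<^sup>2 / T)) + (mutual_energy R \<nu> \<nu> + ennreal (c + R\<^sup>2 / T))"
    unfolding c_def using T
    by (intro add_mono mutual_energy_bounds[OF \<mu> \<mu> S R] mutual_energy_bounds[OF \<nu> \<nu> S R]) auto
  also have "\<dots> = (mutual_energy R \<mu> \<mu> + mutual_energy R \<nu> \<nu> + ennreal (2 * (R\<^sup>2 / T))) + 2 * ennreal c"
  proof -
    have "ennreal (2 * (R\<^sup>2 / T)) = ennreal (R\<^sup>2 / T) + ennreal (R\<^sup>2 / T)"
      "ennreal (c + R\<^sup>2 / T) = ennreal c + ennreal (R\<^sup>2 / T)"
      using c eps(1) by (simp_all only: mult_2 ennreal_plus)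
    thus ?thesis by (simp only: mult_2 add_ac)
  qed
  \<comment> \<open>\<open>2 * ennreal c\<close> is finite, so it cancels even if the energies are
    infinite.\<close>
  finally have "2 * mutual_energy R \<mu> \<nu> + gauss_dist 1 \<mu> \<nu>
     \<le> mutual_energy R \<mu> \<mu> + mutual_energy R \<nu> \<nu> + ennreal (2 * (R\<^sup>2 / T))"
    using ennreal_add_left_cancel_le[of "2 * ennreal c"] by (simp add: add.commute ennreal_mult_eq_top_iff)
  also have "\<dots> \<le> mutual_energy R \<mu> \<mu> + mutual_energy R \<nu> \<nu> + ennreal e"
    using eps by (intro add_left_mono ennreal_leI)
  finally show "2 * mutual_energy R \<mu> \<nu> + gauss_dist 1 \<mu> \<nu> \<le> mutual_energy R \<mu> \<mu> + mutual_energy R \<nu> \<nu> + ennreal e" .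
qed


section \<open>Distance zero forces equality of measures\<close>

lemma AE_lborel_exists_Ioo:
  fixes a b :: real
  assumes "AE x in lborel. P x" "a < b"
  shows "\<exists>x. a < x \<and> x < b \<and> P x"
proof (rule ccontr)
  assume "\<not> ?thesis"
  with assms(1) have "AE x in lborel. x \<notin> {a<..<b}" by (auto elim!: eventually_mono)
  hence "emeasure lborel {a<..<b} = 0" by (subst (asm) AE_iff_measurable[OF _ refl]) (auto simp: greaterThanLessThan_def greaterThan_def lessThan_def Int_def)
  thus False using assms(2) by simp
qed

text \<open>An approximate identity with a rate: Gaussian smoothing moves an
  \<open>m\<close>-Lipschitz function by O(m / sqrt s), uniformly in \<open>z\<close>. Two one-sided
  bounds stand for an absolute difference in \<open>ennreal\<close>.\<close>

lemma nn_integral_gaussian_Lipschitz: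
  fixes f :: "complex \<Rightarrow> real" and s m :: real
  assumes f: "\<And>z. f z \<ge> 0" "\<And>u v. \<bar>f u - f v\<bar> \<le> m * cmod (u - v)" and s: "s > 0" and m: "m \<ge> 0"
  defines "P \<equiv> \<lambda>z. (\<integral>\<^sup>+ u. ennreal (f u * (2 * s / pi * exp (- 2 * s * (cmod (z - u))\<^sup>2))) \<partial>lborel)"
  shows "P z \<le> ennreal (f z) + ennreal (3 * m / sqrt s)"
    and "ennreal (f z) \<le> P z + ennreal (3 * m / sqrt s)"
proof -
  define g where "g u = 2 * s / pi * exp (- 2 * s * (cmod (z - u))\<^sup>2)" for u
  \<comment> \<open>By the arithmetic-geometric mean inequality this dominates m |z-u|. Being
    quadratic in the distance, it reduces to plain Gaussian integrals through x exp(-x) <=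
    1.\<close>
  define e where "e u = m * (1 / sqrt s + sqrt s * (cmod (z - u))\<^sup>2)" for u
  have f_meas [measurable]: "f \<in> borel_measurable borel"
  proof (intro borel_measurable_continuous_onI)
    have "m-lipschitz_on UNIV f" using f(2) m by (auto simp: lipschitz_on_def dist_norm)
    thus "continuous_on UNIV f" by (rule lipschitz_on_continuous_on)
  qed
  have g: "g u \<ge> 0" for u using s by (simp add: g_def)
  have gm [measurable]: "g \<in> borel_measurable borel" unfolding g_def by measurable
  have em [measurable]: "e \<in> borel_measurable borel" unfolding e_def by measurable
  have e0: "e u \<ge> 0" for u using s m by (simp add: e_def)
  have G: "(\<integral>\<^sup>+ u. ennreal (g u) \<partial>lborel) = 1"
  proof -
    have "(\<integral>\<^sup>+ u. ennreal (g u) \<partial>lborel) = ennreal (2 * s / pi) * (\<integral>\<^sup>+ u. ennreal (exp (- (2 * s) * (cmod (z - u))\<^sup>2)) \<partial>lborel)"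
      unfolding g_def using s
      by (subst nn_integral_cmult[symmetric]) (measurable, intro nn_integral_cong, simp flip: ennreal_mult)
    thus ?thesis using s nn_integral_gaussian_complex[of "2 * s" z]
      by (simp del: mult_minus_left flip: ennreal_mult)
  qed
  have close: "\<bar>f u - f z\<bar> \<le> e u" for u
  proof -
    have "0 \<le> (1 - sqrt s * cmod (z - u))\<^sup>2 / sqrt s + cmod (z - u)" using s by simp
    also have "\<dots> = 1 / sqrt s + sqrt s * (cmod (z - u))\<^sup>2 - cmod (z - u)"
      using s by (simp add: power2_eq_square field_simps)
    finally have "m * cmod (u - z) \<le> e u"
      unfolding e_def using m by (intro mult_left_mono) (auto simp: norm_minus_commute)
    thus ?thesis using f(2)[of u z] by linarith
  qed
  have E: "(\<integral>\<^sup>+ u. ennreal (e u * g u) \<partial>lborel) \<le> ennreal (3 * m / sqrt s)"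
  proof -
    have "e u * g u \<le> (m / sqrt s) * g u + m * (2 * sqrt s / pi) * exp (- s * (cmod (z - u))\<^sup>2)" for u
    proof -
      define x where "x = s * (cmod (z - u))\<^sup>2"
      have "x \<le> exp x" using exp_ge_add_one_self[of x] by linarith
      hence "x * exp (- x) \<le> 1" by (simp add: exp_minus field_simps)
      hence "(x * exp (- x)) * exp (- x) \<le> 1 * exp (- x)" by (intro mult_right_mono) auto
      hence xx: "x * exp (- (2 * x)) \<le> exp (- x)" by (simp add: mult.assoc flip: exp_add)
      have "e u * g u = (m / sqrt s) * g u + m * (2 * sqrt s / pi) * (x * exp (- (2 * x)))"
        using s by (simp add: e_def g_def x_def field_simps)
      also have "\<dots> \<le> (m / sqrt s) * g u + m * (2 * sqrt s / pi) * exp (- x)"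
        using xx m s by (intro add_left_mono mult_left_mono) auto
      finally show ?thesis by (simp add: x_def)
    qed
    hence "(\<integral>\<^sup>+ u. ennreal (e u * g u) \<partial>lborel)
        \<le> (\<integral>\<^sup>+ u. ennreal (m / sqrt s) * ennreal (g u) + ennreal (m * (2 * sqrt s / pi)) * ennreal (exp (- s * (cmod (z - u))\<^sup>2)) \<partial>lborel)"
      using s m g by (intro nn_integral_mono) (simp add: ennreal_leI flip: ennreal_mult ennreal_plus)
    also have "\<dots> = ennreal (m / sqrt s) + ennreal (m * (2 * sqrt s / pi)) * ennreal (pi / s)"
      using nn_integral_gaussian_complex[OF s, of z]
      by (subst nn_integral_add, measurable, subst (1 2) nn_integral_cmult, measurable) (simp add: G)
    also have "\<dots> = ennreal (3 * m / sqrt s)"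
    proof -
      have "m * (2 * sqrt s / pi) * (pi / s) = 2 * m / sqrt s"
        using s by (simp add: field_simps)
      thus ?thesis using s m by (simp flip: ennreal_mult ennreal_plus add: field_simps)
    qed
    finally show ?thesis .
  qed
  have P: "P z = (\<integral>\<^sup>+ u. ennreal (f u * g u) \<partial>lborel)" by (simp add: P_def g_def)
  have fz: "ennreal (f z) = (\<integral>\<^sup>+ u. ennreal (f z * g u) \<partial>lborel)"
    using f g G by (simp add: ennreal_mult nn_integral_cmult)
  have ineq: "a * g u \<le> b * g u + e u * g u" if "a \<le> b + e u" for a b u
    using mult_right_mono[OF that g[of u]] by (simp add: distrib_right)
  have "P z \<le> (\<integral>\<^sup>+ u. ennreal (f z * g u) + ennreal (e u * g u) \<partial>lborel)"
    unfolding P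
  proof (intro nn_integral_mono)
    fix u show "ennreal (f u * g u) \<le> ennreal (f z * g u) + ennreal (e u * g u)"
      using ineq[of "f u" "f z" u] close[of u] f(1)[of z] g[of u] e0[of u]
      by (simp add: ennreal_leI flip: ennreal_plus)
  qed
  also have "\<dots> = ennreal (f z) + (\<integral>\<^sup>+ u. ennreal (e u * g u) \<partial>lborel)"
    unfolding fz by (intro nn_integral_add) auto
  finally show "P z \<le> ennreal (f z) + ennreal (3 * m / sqrt s)" using E by (meson add_left_mono order_trans)
  have "ennreal (f z) \<le> (\<integral>\<^sup>+ u. ennreal (f u * g u) + ennreal (e u * g u) \<partial>lborel)"
    unfolding fz
  proof (intro nn_integral_mono)
    fix u show "ennreal (f z * g u) \<le> ennreal (f u * g u) + ennreal (e u * g u)"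
      using ineq[of "f z" "f u" u] close[of u] f(1)[of u] g[of u] e0[of u]
      by (simp add: ennreal_leI flip: ennreal_plus)
  qed
  also have "\<dots> = P z + (\<integral>\<^sup>+ u. ennreal (e u * g u) \<partial>lborel)"
    unfolding P by (intro nn_integral_add) auto
  finally show "ennreal (f z) \<le> P z + ennreal (3 * m / sqrt s)" using E by (meson add_left_mono order_trans)
qed

text \<open>The distance is an integral over (t, s, u), so Fubini yields slices on which the
  Gaussian averages agree for almost every \<open>u\<close>. The slice can be taken with
  \<open>s\<close> as large as desired, as an approximate identity requires.\<close>

lemma gauss_dist_0_AE:
  assumes \<mu>: "finite_measure \<mu>" "sets \<mu> = sets borel" and \<nu>: "finite_measure \<nu>" "sets \<nu> = sets borel"
    and 0: "gauss_dist 1 \<mu> \<nu> = 0"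
  shows "\<exists>s>a. AE u in lborel. (\<integral>z. exp (- 2 * s * (cmod (z - u))\<^sup>2) \<partial>\<mu>) = (\<integral>z. exp (- 2 * s * (cmod (z - u))\<^sup>2) \<partial>\<nu>)"
proof -
  note [measurable] = gauss_mean_measurable[OF \<mu>] gauss_mean_measurable[OF \<nu>]
  have "AE p in lborel. gauss_mean 1 \<mu> p = gauss_mean 1 \<nu> p"
    using 0 unfolding gauss_dist_def by (subst (asm) nn_integral_0_iff_AE) (auto elim!: eventually_mono)
  hence "AE p in lborel \<Otimes>\<^sub>M lborel. gauss_mean 1 \<mu> p = gauss_mean 1 \<nu> p" unfolding lborel_prod .
  hence "AE t in lborel. AE p in lborel. gauss_mean 1 \<mu> (t, p) = gauss_mean 1 \<nu> (t, p)"
    by (rule lborel_pair.AE_pair)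
  from AE_lborel_exists_Ioo[OF this zero_less_one]
  obtain t where t: "0 < t" "t < 1" "AE p in lborel. gauss_mean 1 \<mu> (t, p) = gauss_mean 1 \<nu> (t, p)"
    by blast
  have "AE p in lborel \<Otimes>\<^sub>M lborel. gauss_mean 1 \<mu> (t, p) = gauss_mean 1 \<nu> (t, p)" using t(3) unfolding lborel_prod .
  hence "AE s in lborel. AE u in lborel. gauss_mean 1 \<mu> (t, s, u) = gauss_mean 1 \<nu> (t, s, u)"
    by (rule lborel_pair.AE_pair)
  from AE_lborel_exists_Ioo[OF this less_add_one[of "max 0 a"]]
  obtain s where s: "max 0 a < s" "AE u in lborel. gauss_mean 1 \<mu> (t, s, u) = gauss_mean 1 \<nu> (t, s, u)"
    by blast
  have "gauss_mean 1 M (t, s, u) = sqrt (exp (- s * t) * (4 * s / pi)) * (\<integral>z. exp (- 2 * s * (cmod (z - u))\<^sup>2) \<partial>M)" for M u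
    using s t by (simp add: gauss_mean_def gauss_feature_def)
  hence "AE u in lborel. (\<integral>z. exp (- 2 * s * (cmod (z - u))\<^sup>2) \<partial>\<mu>) = (\<integral>z. exp (- 2 * s * (cmod (z - u))\<^sup>2) \<partial>\<nu>)"
    using s by (auto elim!: eventually_mono)
  thus ?thesis using s by (intro exI[of _ s]) auto
qed

text \<open>By Tonelli, integrating the smoothed \<open>f\<close> against a measure is integrating
  \<open>f\<close> against the Gaussian averages of that measure, and these agree for \<mu> and
  \<nu>.\<close>

lemma gauss_dist_0_integral_le:
  assumes \<mu>: "prob_space \<mu>" "sets \<mu> = sets borel" and \<nu>: "prob_space \<nu>" "sets \<nu> = sets borel"
    and 0: "gauss_dist 1 \<mu> \<nu> = 0"
    and f: "\<And>z. f z \<ge> 0" "\<And>u v. \<bar>f u - f v\<bar> \<le> m * cmod (u - v)" and m: "m \<ge> 0"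
  shows "(\<integral>\<^sup>+ z. ennreal (f z) \<partial>\<mu>) \<le> (\<integral>\<^sup>+ z. ennreal (f z) \<partial>\<nu>)"
proof (rule ennreal_le_epsilon)
  fix e :: real assume e: "e > 0"
  note [measurable_cong] = \<mu>(2) \<nu>(2)
  interpret M: prob_space \<mu> by fact
  interpret N: prob_space \<nu> by fact
  have fin: "finite_measure \<mu>" "finite_measure \<nu>" by unfold_locales
  \<comment> \<open>The smoothing error \<open>3 * m / sqrt s\<close> is paid once for each measure;
    this threshold makes the sum at most \<open>e\<close>.\<close>
  obtain s where s: "s > max 0 ((6 * m / e)\<^sup>2)"
    and ae: "AE u in lborel. (\<integral>z. exp (- 2 * s * (cmod (z - u))\<^sup>2) \<partial>\<mu>) = (\<integral>z. exp (- 2 * s * (cmod (z - u))\<^sup>2) \<partial>\<nu>)"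
    using gauss_dist_0_AE[OF fin(1) \<mu>(2) fin(2) \<nu>(2) 0] by blast
  have s0: "s > 0" using s by linarith
  have "6 * m / e \<le> sqrt s" using s by (intro real_le_rsqrt) auto
  hence se: "2 * (3 * m / sqrt s) \<le> e" using s0 e by (simp add: field_simps)
  have f_meas [measurable]: "f \<in> borel_measurable borel"
  proof (intro borel_measurable_continuous_onI)
    have "m-lipschitz_on UNIV f" using f(2) m by (auto simp: lipschitz_on_def dist_norm)
    thus "continuous_on UNIV f" by (rule lipschitz_on_continuous_on)
  qed
  define P where "P z = (\<integral>\<^sup>+ u. ennreal (f u * (2 * s / pi * exp (- 2 * s * (cmod (z - u))\<^sup>2))) \<partial>lborel)" for z
  have P_meas [measurable]: "P \<in> borel_measurable borel" unfolding P_def by measurable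
  define g where "g M u = (\<integral>z. exp (- 2 * s * (cmod (z - u))\<^sup>2) \<partial>M)" for M :: "complex measure" and u
  have Peq: "(\<integral>\<^sup>+ z. P z \<partial>M) = (\<integral>\<^sup>+ u. ennreal (f u * (2 * s / pi)) * ennreal (g M u) \<partial>lborel)"
    if M: "prob_space M" "sets M = sets borel" for M
  proof -
    note [measurable_cong] = M(2)
    interpret PM: prob_space M by fact
    interpret Q: pair_sigma_finite M "lborel :: complex measure" ..
    have int: "integrable M (\<lambda>z. exp (- 2 * s * (cmod (z - u))\<^sup>2))" for u
      using s0 by (intro PM.integrable_const_bound[where B = 1]) auto
    have "(\<integral>\<^sup>+ z. P z \<partial>M) = (\<integral>\<^sup>+ u. \<integral>\<^sup>+ z. ennreal (f u * (2 * s / pi * exp (- 2 * s * (cmod (z - u))\<^sup>2))) \<partial>M \<partial>lborel)"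
      unfolding P_def by (intro Q.Fubini'[symmetric]) simp
    also have "\<dots> = (\<integral>\<^sup>+ u. ennreal (f u * (2 * s / pi)) * ennreal (g M u) \<partial>lborel)"
    proof (intro nn_integral_cong)
      fix u
      have "(\<integral>\<^sup>+ z. ennreal (f u * (2 * s / pi * exp (- 2 * s * (cmod (z - u))\<^sup>2))) \<partial>M)
         = (\<integral>\<^sup>+ z. ennreal (f u * (2 * s / pi)) * ennreal (exp (- 2 * s * (cmod (z - u))\<^sup>2)) \<partial>M)"
        using f(1)[of u] s0 by (intro nn_integral_cong) (simp flip: ennreal_mult)
      also have "\<dots> = ennreal (f u * (2 * s / pi)) * (\<integral>\<^sup>+ z. ennreal (exp (- 2 * s * (cmod (z - u))\<^sup>2)) \<partial>M)"
        by (intro nn_integral_cmult) simp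
      also have "(\<integral>\<^sup>+ z. ennreal (exp (- 2 * s * (cmod (z - u))\<^sup>2)) \<partial>M) = ennreal (g M u)"
        unfolding g_def by (intro nn_integral_eq_integral int) simp
      finally show "(\<integral>\<^sup>+ z. ennreal (f u * (2 * s / pi * exp (- 2 * s * (cmod (z - u))\<^sup>2))) \<partial>M)
         = ennreal (f u * (2 * s / pi)) * ennreal (g M u)" .
    qed
    finally show ?thesis .
  qed
  have PP: "(\<integral>\<^sup>+ z. P z \<partial>\<mu>) = (\<integral>\<^sup>+ z. P z \<partial>\<nu>)"
    unfolding Peq[OF \<mu>] Peq[OF \<nu>] using ae by (intro nn_integral_cong_AE) (auto simp: g_def elim!: eventually_mono)
  let ?e = "3 * m / sqrt s"
  have L: "P z \<le> ennreal (f z) + ennreal ?e" "ennreal (f z) \<le> P z + ennreal ?e" for z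
    unfolding P_def using nn_integral_gaussian_Lipschitz[OF f s0 m] by auto
  have "(\<integral>\<^sup>+ z. ennreal (f z) \<partial>\<mu>) \<le> (\<integral>\<^sup>+ z. P z + ennreal ?e \<partial>\<mu>)"
    by (intro nn_integral_mono L)
  also have "\<dots> = (\<integral>\<^sup>+ z. P z \<partial>\<nu>) + ennreal ?e"
    by (subst nn_integral_add) (auto simp: M.emeasure_space_1 PP)
  also have "(\<integral>\<^sup>+ z. P z \<partial>\<nu>) \<le> (\<integral>\<^sup>+ z. ennreal (f z) + ennreal ?e \<partial>\<nu>)"
    by (intro nn_integral_mono L)
  also have "\<dots> = (\<integral>\<^sup>+ z. ennreal (f z) \<partial>\<nu>) + ennreal ?e"
    by (subst nn_integral_add) (auto simp: N.emeasure_space_1)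
  also have "\<dots> + ennreal ?e = (\<integral>\<^sup>+ z. ennreal (f z) \<partial>\<nu>) + ennreal (2 * ?e)"
  proof -
    have "?e \<ge> 0" using m s0 by simp
    hence "ennreal (2 * ?e) = ennreal ?e + ennreal ?e" by (simp only: mult_2 ennreal_plus)
    thus ?thesis by (simp only: add.assoc)
  qed
  also have "\<dots> \<le> (\<integral>\<^sup>+ z. ennreal (f z) \<partial>\<nu>) + ennreal e"
    using se by (intro add_left_mono ennreal_leI)
  finally show "(\<integral>\<^sup>+ z. ennreal (f z) \<partial>\<mu>) \<le> (\<integral>\<^sup>+ z. ennreal (f z) \<partial>\<nu>) + ennreal e" by (simp add: add_right_mono)
qed

lemma gauss_dist_commute: "gauss_dist T \<mu> \<nu> = gauss_dist T \<nu> \<mu>"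
  by (simp add: gauss_dist_def power2_commute)

text \<open>Truncated multiples of the distance to the complement are Lipschitz and increase to the
  indicator of an open set, and the open sets form an intersection-stable generator of the Borel
  sets.\<close>

lemma gauss_dist_0_imp_eq:
  assumes \<mu>: "prob_space \<mu>" "sets \<mu> = sets borel" and \<nu>: "prob_space \<nu>" "sets \<nu> = sets borel"
    and 0: "gauss_dist 1 \<mu> \<nu> = 0"
  shows "\<mu> = \<nu>"
proof (rule measure_eqI_generator_eq)
  interpret M: prob_space \<mu> by fact
  interpret N: prob_space \<nu> by fact
  note [measurable_cong] = \<mu>(2) \<nu>(2)
  show "Int_stable {S :: complex set. open S}" by (auto simp: Int_stable_def)
  show "{S :: complex set. open S} \<subseteq> Pow UNIV" by simp
  show "sets \<mu> = sigma_sets UNIV {S. open S}" "sets \<nu> = sigma_sets UNIV {S. open S}"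
    using \<mu> \<nu> by (simp_all add: borel_def)
  show "range (\<lambda>i. UNIV) \<subseteq> {S :: complex set. open S}" "(\<Union>i::nat. UNIV) = (UNIV :: complex set)" by auto
  show "emeasure \<mu> UNIV \<noteq> \<infinity>" for i :: nat using M.emeasure_finite by simp
  fix U :: "complex set" assume "U \<in> {S. open S}"
  hence U: "open U" by simp
  show "emeasure \<mu> U = emeasure \<nu> U"
  \<comment> \<open>\<open>infdist\<close> to the empty complement is 0 by convention, so the
    functions \<open>f n\<close> would vanish for the whole space.\<close>
  proof (cases "U = UNIV")
    case True
    thus ?thesis using M.emeasure_space_1 N.emeasure_space_1 sets_eq_imp_space_eq[OF \<mu>(2)] sets_eq_imp_space_eq[OF \<nu>(2)]
      by simp
  next
    case False
    define f where "f n z = min 1 (real n * infdist z (- U))" for n z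
    have fm [measurable]: "f n \<in> borel_measurable borel" for n
      unfolding f_def by (intro borel_measurable_continuous_onI continuous_intros)
    have Lip: "\<bar>f n u - f n v\<bar> \<le> real n * cmod (u - v)" for n u v
    proof -
      have "\<bar>infdist u (-U) - infdist v (-U)\<bar> \<le> dist u v" by (rule infdist_triangle_abs)
      hence "real n * \<bar>infdist u (-U) - infdist v (-U)\<bar> \<le> real n * dist u v" by (rule mult_left_mono) simp
      hence "\<bar>real n * infdist u (-U) - real n * infdist v (-U)\<bar> \<le> real n * dist u v"
        by (simp add: abs_mult flip: right_diff_distrib)
      thus ?thesis by (simp add: f_def dist_norm min_def abs_if split: if_splits)
    qed
    have f0: "f n z \<ge> 0" for n z by (simp add: f_def infdist_nonneg)
    have "(\<integral>\<^sup>+ z. ennreal (f n z) \<partial>\<mu>) = (\<integral>\<^sup>+ z. ennreal (f n z) \<partial>\<nu>)" for n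
      using gauss_dist_0_integral_le[OF \<mu> \<nu> 0 f0 Lip] gauss_dist_0_integral_le[OF \<nu> \<mu> _ f0 Lip] 0
      by (intro antisym) (auto simp: gauss_dist_commute[of _ \<nu>])
    moreover have "emeasure M U = (SUP n. \<integral>\<^sup>+ z. ennreal (f n z) \<partial>M)" if [measurable_cong]: "sets M = sets borel" for M
    proof -
      have ind: "indicator U z = (SUP n. ennreal (f n z))" for z
      proof (cases "z \<in> U")
        case True
        have "infdist z (-U) > 0"
          using True U False in_closed_iff_infdist_zero[of "-U" z] infdist_nonneg[of z "-U"] by (auto simp: closed_Compl less_le)
        then obtain n :: nat where "1 < real n * infdist z (-U)" using reals_Archimedean3 by blast
        hence "f n z = 1" by (simp add: f_def)
        moreover have "f k z \<le> 1" for k by (simp add: f_def)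
        ultimately have "(SUP n. ennreal (f n z)) = 1"
          by (intro antisym SUP_least SUP_upper2[of n]) auto
        thus ?thesis using True by simp
      next
        case False
        thus ?thesis by (simp add: f_def infdist_zero)
      qed
      have "emeasure M U = (\<integral>\<^sup>+ z. (SUP n. ennreal (f n z)) \<partial>M)"
        unfolding ind[symmetric] using U by (simp add: that)
      also have "\<dots> = (SUP n. \<integral>\<^sup>+ z. ennreal (f n z) \<partial>M)"
      proof (intro nn_integral_monotone_convergence_SUP)
        show "incseq (\<lambda>n z. ennreal (f n z))"
          by (intro incseq_SucI le_funI ennreal_leI)
             (auto simp: f_def min_def infdist_nonneg distrib_right intro: mult_left_le_one_le add_increasing)
      qed simp
      finally show ?thesis .
    qed
    ultimately show ?thesis using \<mu> \<nu> by simp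
  qed
qed

section \<open>Fourier coefficients and logarithmic means on circles\<close>

text \<open>The parameter circle as a density on the whole line rather than a measure on
  \<open>{0..1}\<close>: its measurable sets are exactly the Borel sets of the reals, so
  parametrisations need no restriction.\<close>

definition circ :: "real measure" where
  "circ = density lborel (\<lambda>x. ennreal (indicator {0..1} x))"

lemma sets_circ [simp, measurable_cong]: "sets circ = sets borel"
  by (simp add: circ_def)

lemma space_circ [simp]: "space circ = UNIV"
  by (simp add: circ_def)

lemma emeasure_circ: "A \<in> sets borel \<Longrightarrow> emeasure circ A = emeasure lborel (A \<inter> {0..1})"
proof -
  assume A [measurable]: "A \<in> sets borel"
  have "emeasure circ A = (\<integral>\<^sup>+ x. ennreal (indicator {0..1} x) * indicator A x \<partial>lborel)"
    unfolding circ_def by (rule emeasure_density) auto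
  also have "\<dots> = (\<integral>\<^sup>+ x. indicator (A \<inter> {0..1}) x \<partial>lborel)"
    by (intro nn_integral_cong) (auto simp: indicator_def)
  finally show ?thesis by simp
qed

interpretation circ: prob_space circ
  by standard (simp add: emeasure_circ)

lemma prob_circ_UNIV [simp]: "measure circ UNIV = 1"
  using circ.prob_space by simp

lemma emeasure_circ_UNIV [simp]: "emeasure circ UNIV = 1"
  using circ.emeasure_space_1 by simp

interpretation circ2: pair_prob_space circ circ ..

definition ucis :: "real \<Rightarrow> complex" where "ucis t = cis (2 * pi * t)"

lemma norm_ucis [simp]: "cmod (ucis t) = 1"
  and ucis_nz [simp]: "ucis t \<noteq> 0"
  and ucis_cnj [simp]: "ucis t * cnj (ucis t) = 1" "cnj (ucis t) * ucis t = 1"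
  by (simp_all add: ucis_def cis_cnj cis_mult)

lemma ucis_eq_exp: "ucis t = exp (2 * of_real pi * \<i> * of_real t)"
  by (simp add: ucis_def cis_conv_exp mult_ac)

lemma ucis_power_cnj [simp]: "ucis t ^ n * cnj (ucis t) ^ n = 1"
  by (simp flip: power_mult_distrib)

lemma continuous_on_ucis [continuous_intros]:
  "continuous_on A f \<Longrightarrow> continuous_on A (\<lambda>x. ucis (f x))"
  unfolding ucis_def by (intro continuous_intros)

lemma measurable_ucis [measurable]: "ucis \<in> borel_measurable borel"
  by (intro borel_measurable_continuous_onI continuous_intros)

lemma AE_circ_ucis_neq: "AE s in circ. ucis s \<noteq> w"
proof -
  have "countable {s. ucis s = w}"
  proof (cases "\<exists>s0. ucis s0 = w")
    case True
    then obtain s0 where s0: "ucis s0 = w" by blast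
    have "{s. ucis s = w} \<subseteq> range (\<lambda>n::int. s0 + of_int n)"
    proof safe
      fix s assume "w = ucis s"
      with s0 obtain n :: int where "2 * of_real pi * \<i> * of_real s = 2 * of_real pi * \<i> * of_real s0 + complex_of_real (of_int (2 * n) * pi) * \<i>"
        unfolding ucis_eq_exp by (metis exp_eq)
      also have "\<dots> = 2 * of_real pi * \<i> * of_real (s0 + of_int n)" by (simp add: algebra_simps)
      finally have "s = s0 + of_int n" by (simp only: mult_cancel_left of_real_eq_iff) simp
      thus "s \<in> range (\<lambda>n::int. s0 + of_int n)" by blast
    qed
    thus ?thesis by (rule countable_subset) simp
  qed auto
  hence "AE s in lborel. s \<notin> {s. ucis s = w}"
    by (intro AE_not_in countable_imp_null_set_lborel)
  thus ?thesis unfolding circ_def by (subst AE_density) (auto elim!: eventually_mono)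
qed

lemma circ_integrable_continuous:
  fixes f :: "real \<Rightarrow> 'b::euclidean_space"
  assumes "continuous_on UNIV f"
  shows "integrable circ f"
proof -
  have [measurable]: "f \<in> borel_measurable borel" using assms by (rule borel_measurable_continuous_onI)
  have "compact (f ` {0..1})"
    by (intro compact_continuous_image continuous_on_subset[OF assms]) auto
  then obtain B where B: "\<And>x. x \<in> {0..1} \<Longrightarrow> norm (f x) \<le> B"
    by (metis bounded_iff compact_imp_bounded imageI)
  have "AE x in circ. norm (f x) \<le> B"
    unfolding circ_def by (subst AE_density) (auto simp: indicator_def B)
  thus ?thesis by (intro circ.integrable_const_bound) auto
qed

lemma circ_integral_HK:
  fixes f :: "real \<Rightarrow> complex"
  assumes "continuous_on UNIV f"
  shows "integral\<^sup>L circ f = integral {0..1} f"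
proof -
  have [measurable]: "f \<in> borel_measurable borel" using assms by (rule borel_measurable_continuous_onI)
  have "set_integrable lborel {0..1} f"
    by (intro borel_integrable_atLeastAtMost' continuous_on_subset[OF assms]) auto
  hence "(LINT x : {0..1} | lborel. f x) = integral {0..1} f" by (rule set_borel_integral_eq_integral)
  thus ?thesis unfolding circ_def set_lebesgue_integral_def by (subst integral_density) auto
qed

lemma continuous_on_circle_compose:
  assumes "continuous_on (cball 0 r) (f :: complex \<Rightarrow> 'b::topological_space)" "r \<ge> 0"
  shows "continuous_on UNIV (\<lambda>t. f (of_real r * ucis t))"
  using assms by (intro continuous_on_compose2[OF assms(1)] continuous_intros) (auto simp: norm_mult)

text \<open>Cauchy's formula for higher derivatives on a circle, where dividing by
  \<open>ucis t\<close> is multiplying by its conjugate.\<close>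

lemma fourier_coeff:
  assumes "continuous_on (cball 0 r) g" "g holomorphic_on ball 0 r" "r > 0"
  shows "(\<integral>t. g (of_real r * ucis t) * cnj (ucis t) ^ n \<partial>circ) = (deriv ^^ n) g 0 / fact n * of_real r ^ n"
proof -
  have "((\<lambda>u. g u / (u - 0) ^ Suc n) has_contour_integral ((2 * pi * \<i>) / fact n * (deriv ^^ n) g 0)) (circlepath 0 r)"
    using assms by (intro Cauchy_has_contour_integral_higher_derivative_circlepath) auto
  hence "((\<lambda>t. g (of_real r * ucis t) / (of_real r * ucis t) ^ Suc n * (2 * pi * \<i> * r * ucis t))
       has_integral ((2 * pi * \<i>) / fact n * (deriv ^^ n) g 0)) {0..1}"
    unfolding has_contour_integral vector_derivative_circlepath by (simp add: circlepath ucis_eq_exp)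
  also have "(\<lambda>t. g (of_real r * ucis t) / (of_real r * ucis t) ^ Suc n * (2 * pi * \<i> * r * ucis t))
     = (\<lambda>t. (g (of_real r * ucis t) * cnj (ucis t) ^ n) * (2 * pi * \<i> / of_real r ^ n))"
  proof
    fix t
    have "cnj (ucis t) = 1 / ucis t" by (simp add: field_simps)
    thus "g (of_real r * ucis t) / (of_real r * ucis t) ^ Suc n * (2 * pi * \<i> * r * ucis t)
       = (g (of_real r * ucis t) * cnj (ucis t) ^ n) * (2 * pi * \<i> / of_real r ^ n)"
      using \<open>r > 0\<close> by (simp add: field_simps power_mult_distrib)
  qed
  finally have "((\<lambda>t. (g (of_real r * ucis t) * cnj (ucis t) ^ n) * (2 * pi * \<i> / of_real r ^ n) * (of_real r ^ n / (2 * pi * \<i>)))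
       has_integral ((2 * pi * \<i>) / fact n * (deriv ^^ n) g 0) * (of_real r ^ n / (2 * pi * \<i>))) {0..1}"
    by (rule has_integral_mult_left)
  hence "((\<lambda>t. g (of_real r * ucis t) * cnj (ucis t) ^ n)
       has_integral (deriv ^^ n) g 0 / fact n * of_real r ^ n) {0..1}"
    using \<open>r > 0\<close> by (simp add: field_simps)
  moreover have "continuous_on UNIV (\<lambda>t. g (of_real r * ucis t) * cnj (ucis t) ^ n)"
    using assms by (intro continuous_intros continuous_on_circle_compose) auto
  ultimately show ?thesis by (simp add: circ_integral_HK integral_unique)
qed

lemma fourier_mean:
  assumes "continuous_on (cball 0 r) g" "g holomorphic_on ball 0 r" "r > 0"
  shows "(\<integral>t. g (of_real r * ucis t) \<partial>circ) = g 0"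
  using fourier_coeff[OF assms, of 0] by simp

lemma fourier_coeff_neg:
  assumes "continuous_on (cball 0 r) g" "g holomorphic_on ball 0 r" "r > 0" "n > 0"
  shows "(\<integral>t. g (of_real r * ucis t) * ucis t ^ n \<partial>circ) = 0"
proof -
  have "(\<integral>t. (of_real r * ucis t) ^ n * g (of_real r * ucis t) \<partial>circ) = 0 ^ n * g 0"
    using assms by (intro fourier_mean[of r "\<lambda>u. u ^ n * g u"] continuous_intros holomorphic_intros) auto
  hence "of_real r ^ n * (\<integral>t. g (of_real r * ucis t) * ucis t ^ n \<partial>circ) = 0"
    using assms by (subst integral_mult_right_zero[symmetric]) (simp add: power_mult_distrib mult_ac)
  thus ?thesis using assms by simp
qed

lemma ucis_orthogonal:
  "(\<integral>t. ucis t ^ m * cnj (ucis t) ^ n \<partial>circ) = (if m = n then 1 else 0)"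
proof -
  have "(\<integral>t. ucis t ^ m * cnj (ucis t) ^ n \<partial>circ) = 0" if "m < n" for m n :: nat
  proof -
    have "ucis t ^ m * cnj (ucis t) ^ n = cnj (ucis t ^ (n - m))" for t
    proof -
      have "cnj (ucis t) ^ n = cnj (ucis t) ^ m * cnj (ucis t) ^ (n - m)"
        using that by (simp flip: power_add)
      thus ?thesis by (simp flip: power_mult_distrib add: mult.assoc[symmetric])
    qed
    thus ?thesis using fourier_coeff_neg[of 1 "\<lambda>_. 1" "n - m"] that
      by (simp add: Bochner_Integration.integral_cnj del: complex_cnj_power)
  qed
  from this[of m n] this[of n m] show ?thesis
  proof -
    have "(\<integral>t. ucis t ^ m * cnj (ucis t) ^ n \<partial>circ) = cnj (\<integral>t. ucis t ^ n * cnj (ucis t) ^ m \<partial>circ)"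
      by (subst Bochner_Integration.integral_cnj[symmetric]) (simp add: mult.commute)
    thus ?thesis using \<open>m < n \<Longrightarrow> _\<close> \<open>n < m \<Longrightarrow> _\<close>
      by (cases m n rule: linorder_cases) (auto simp flip: power_mult_distrib simp: circ.prob_space)
  qed
qed

text \<open>The kernel is continuous off the diagonal and tends to infinity towards it.
  Semicontinuity is what Fatou's lemma needs when points of a sequence of curves may merge in the
  limit.\<close>

lemma log_kernel_lsc:
  assumes "f \<longlonglongrightarrow> z" "g \<longlonglongrightarrow> w" "R > 0"
  shows "log_kernel R z w \<le> liminf (\<lambda>n. log_kernel R (f n) (g n))"
proof (subst le_Liminf_iff, intro allI impI)
  have d: "(\<lambda>n. cmod (f n - g n)) \<longlonglongrightarrow> cmod (z - w)" by (intro tendsto_intros assms)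
  fix y assume y: "y < log_kernel R z w"
  then obtain c where c: "y = ennreal c" "c \<ge> 0" by (cases y) (auto simp: top_unique)
  have ev: "\<forall>\<^sub>F n in sequentially. f n = g n \<or> c < 2 * ln (R / cmod (f n - g n))"
  proof (cases "z = w")
    case True
    \<comment> \<open>Below this distance the kernel exceeds \<open>c + 1\<close>.\<close>
    with d have "\<forall>\<^sub>F n in sequentially. cmod (f n - g n) < R * exp (- (c + 1) / 2)"
      using assms(3) by (intro order_tendstoD) auto
    thus ?thesis
    proof eventually_elim
      case (elim n)
      show ?case
      proof (cases "f n = g n")
        case False
        hence "exp ((c + 1) / 2) < R / cmod (f n - g n)" using elim
          by (simp add: field_simps exp_minus minus_divide_left[symmetric] del: minus_add_distrib)
        hence "(c + 1) / 2 < ln (R / cmod (f n - g n))"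
          by (smt (verit) exp_gt_zero ln_exp ln_less_cancel_iff)
        thus ?thesis by simp
      qed simp
    qed
  next
    case False
    hence "(\<lambda>n. 2 * ln (R / cmod (f n - g n))) \<longlonglongrightarrow> 2 * ln (R / cmod (z - w))"
      using assms(3) by (intro tendsto_intros d) auto
    moreover have "c < 2 * ln (R / cmod (z - w))"
      using y c False by (simp add: log_kernel_def ennreal_less_iff)
    ultimately have "\<forall>\<^sub>F n in sequentially. c < 2 * ln (R / cmod (f n - g n))" by (rule order_tendstoD(1))
    thus ?thesis by eventually_elim simp
  qed
  show "\<forall>\<^sub>F n in sequentially. y < log_kernel R (f n) (g n)"
    using ev by eventually_elim (use c in \<open>auto simp: log_kernel_def ennreal_less_iff ennreal_lessI\<close>)
qed

text \<open>A zero-free function on a disc has a holomorphic logarithm, whose real part is ln |g|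
  and has the mean value property.\<close>

lemma log_mean_eq:
  assumes g: "g holomorphic_on ball 0 R" "\<And>u. u \<in> ball 0 R \<Longrightarrow> g u \<noteq> 0" and r: "0 < r" "r < R"
  shows "(\<integral>t. ln (cmod (g (of_real r * ucis t))) \<partial>circ) = ln (cmod (g 0))"
proof -
  obtain f where f: "f holomorphic_on ball 0 R" "\<And>u. u \<in> ball 0 R \<Longrightarrow> g u = exp (f u)"
    using contractible_imp_holomorphic_log[OF g(1) convex_imp_contractible g(2)] by (auto simp: convex_ball)
  have ln: "ln (cmod (g u)) = Re (f u)" if "u \<in> ball 0 R" for u using f(2)[OF that] by simp
  have "cball 0 r \<subseteq> ball 0 R" using r by auto
  hence c: "continuous_on (cball 0 r) f" and h: "f holomorphic_on ball 0 r"
    using f(1) holomorphic_on_subset[OF f(1), of "cball 0 r"] holomorphic_on_subset[OF f(1), of "ball 0 r"] r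
    by (auto intro: holomorphic_on_imp_continuous_on)
  have "(\<integral>t. ln (cmod (g (of_real r * ucis t))) \<partial>circ) = (\<integral>t. Re (f (of_real r * ucis t)) \<partial>circ)"
    using r by (simp add: ln norm_mult)
  also have "\<dots> = Re (f 0)"
    using fourier_mean[OF c h r(1)] r by (subst integral_Re) (auto intro!: circ_integrable_continuous continuous_on_circle_compose c)
  also have "\<dots> = ln (cmod (g 0))" using ln[of 0] r by simp
  finally show ?thesis .
qed

lemma log_kernel_mean_eq:
  assumes g: "g holomorphic_on ball 0 R" "\<And>u. u \<in> ball 0 R \<Longrightarrow> g u \<noteq> 0" and r: "0 < r" "r < R"
    and B: "\<And>u. cmod u = r \<Longrightarrow> cmod (g u) \<le> B" and "B > 0"
  shows "(\<integral>\<^sup>+t. log_kernel B (g (of_real r * ucis t)) 0 \<partial>circ) = ennreal (2 * ln (B / cmod (g 0)))"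
proof -
  have nz: "g (of_real r * ucis t) \<noteq> 0" for t using r by (intro g) (auto simp: norm_mult)
  have B': "cmod (g (of_real r * ucis t)) \<le> B" for t using r by (intro B) (auto simp: norm_mult)
  have "cball 0 r \<subseteq> ball 0 R" using r by auto
  hence "continuous_on (cball 0 r) g" using g(1) by (meson holomorphic_on_imp_continuous_on continuous_on_subset)
  hence cont: "continuous_on UNIV (\<lambda>t. g (of_real r * ucis t))" using r by (intro continuous_on_circle_compose) auto
  have c2: "continuous_on UNIV (\<lambda>t. ln (cmod (g (of_real r * ucis t))))"
    using nz by (intro continuous_intros cont) auto
  have g0: "g 0 \<noteq> 0" using r by (intro g) auto
  have "(\<integral>\<^sup>+t. log_kernel B (g (of_real r * ucis t)) 0 \<partial>circ)
     = (\<integral>\<^sup>+t. ennreal (2 * ln B - 2 * ln (cmod (g (of_real r * ucis t)))) \<partial>circ)"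
    using nz \<open>B > 0\<close> by (simp add: log_kernel_def ln_div)
  also have "\<dots> = ennreal (\<integral>t. 2 * ln B - 2 * ln (cmod (g (of_real r * ucis t))) \<partial>circ)"
    using nz B' \<open>B > 0\<close>
    by (intro nn_integral_eq_integral circ_integrable_continuous continuous_intros c2 AE_I2) auto
  also have "(\<integral>t. 2 * ln B - 2 * ln (cmod (g (of_real r * ucis t))) \<partial>circ)
      = 2 * ln B - 2 * ln (cmod (g 0))"
    using log_mean_eq[OF g r] circ_integrable_continuous[OF c2]
    by (subst Bochner_Integration.integral_diff) (auto simp: circ.prob_space)
  finally show ?thesis using g0 \<open>B > 0\<close> by (simp add: ln_div)
qed

text \<open>Here \<open>g\<close> may vanish on the boundary circle. Equality on smaller circles and
  Fatou's lemma leave an inequality, which serves for a pole of the potential lying on the curve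
  itself.\<close>

lemma log_kernel_mean_le:
  assumes g: "g holomorphic_on ball 0 R" "\<And>u. u \<in> ball 0 R \<Longrightarrow> g u \<noteq> 0" and R: "0 < R"
    and cont: "continuous_on (cball 0 R) g"
    and B: "\<And>u. u \<in> cball 0 R \<Longrightarrow> cmod (g u) \<le> B" and "B > 0"
  shows "(\<integral>\<^sup>+t. log_kernel B (g (of_real R * ucis t)) 0 \<partial>circ) \<le> ennreal (2 * ln (B / cmod (g 0)))"
proof -
  define r where "r n = R * (1 - 1 / (real n + 2))" for n
  have "1 / (real n + 2) < 1" for n by simp
  hence r: "0 < r n" "r n < R" for n using R by (auto simp: r_def intro!: mult_pos_pos)
  have r0: "r \<longlonglongrightarrow> R" unfolding r_def by real_asymp
  have conv: "(\<lambda>n. g (of_real (r n) * ucis t)) \<longlonglongrightarrow> g (of_real R * ucis t)" for t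
    using r R by (intro continuous_on_tendsto_compose[OF cont] tendsto_intros r0) (auto simp: norm_mult less_imp_le intro!: always_eventually)
  have [measurable]: "(\<lambda>t. g (of_real (r n) * ucis t)) \<in> borel_measurable borel" for n
    using r[of n] by (intro borel_measurable_continuous_onI continuous_on_circle_compose continuous_on_subset[OF cont]) auto
  have "(\<integral>\<^sup>+t. log_kernel B (g (of_real R * ucis t)) 0 \<partial>circ)
      \<le> (\<integral>\<^sup>+t. liminf (\<lambda>n. log_kernel B (g (of_real (r n) * ucis t)) 0) \<partial>circ)"
    using \<open>B > 0\<close> by (intro nn_integral_mono log_kernel_lsc conv tendsto_const)
  also have "\<dots> \<le> liminf (\<lambda>n. \<integral>\<^sup>+t. log_kernel B (g (of_real (r n) * ucis t)) 0 \<partial>circ)"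
    by (intro nn_integral_liminf) measurable
  also have "(\<lambda>n. \<integral>\<^sup>+t. log_kernel B (g (of_real (r n) * ucis t)) 0 \<partial>circ) = (\<lambda>n. ennreal (2 * ln (B / cmod (g 0))))"
    using r by (intro ext log_kernel_mean_eq[OF g] B \<open>B > 0\<close>) (auto simp: less_imp_le)
  finally show ?thesis by (simp add: Liminf_const)
qed

section \<open>The area theorem\<close>

lemma borel_measurable_cnj [measurable (raw)]:
  "f \<in> borel_measurable M \<Longrightarrow> (\<lambda>x. cnj (f x)) \<in> borel_measurable M"
  by (rule measurable_compose[of f]) (auto intro!: borel_measurable_continuous_onI continuous_intros)

text \<open>Since |q| <= 1 and \<open>q\<close> has mean zero, 1 + q and 1 - q are probability
  densities on the parameter circle. Comparing the energies of their images along \<open>Z\<close>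
  shows that the form of the nonnegative kernel is nonnegative at \<open>q\<close>; the constant
  \<open>ln R\<close> drops out because of the mean, and the sign turns for the logarithm of the
  distance.\<close>

lemma curve_energy_aux:
  fixes Z :: "real \<Rightarrow> complex" and q :: "real \<Rightarrow> real"
  defines "P \<equiv> circ \<Otimes>\<^sub>M circ"
  assumes Z: "continuous_on UNIV Z" "\<And>s t. cmod (Z s - Z t) \<le> R" "R > 0"
    and neq: "AE p in P. Z (fst p) \<noteq> Z (snd p)"
    and int: "integrable P (\<lambda>p. ln (cmod (Z (fst p) - Z (snd p))))"
    and q: "continuous_on UNIV q" "\<And>t. \<bar>q t\<bar> \<le> 1" "(\<integral>t. q t \<partial>circ) = 0"
  shows "(\<integral>p. ln (cmod (Z (fst p) - Z (snd p))) * (q (fst p) * q (snd p)) \<partial>P) \<le> 0"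
proof -
  have [measurable]: "Z \<in> borel_measurable borel" "q \<in> borel_measurable borel"
    using Z(1) q(1) by (auto intro: borel_measurable_continuous_onI)
  have setsP [measurable_cong]: "sets P = sets (borel \<Otimes>\<^sub>M borel)"
    unfolding P_def by (intro sets_pair_measure_cong) simp_all
  define K where "K p = 2 * ln R - 2 * ln (cmod (Z (fst p) - Z (snd p)))" for p
  have K_int: "integrable P K"
    unfolding K_def using int
    by (intro Bochner_Integration.integrable_diff integrable_mult_right) (auto simp: P_def)
  have qint: "integrable circ q" using q(1) by (rule circ_integrable_continuous)
  have wint: "integrable P (\<lambda>p. K p * (f (fst p) * g (snd p)))"
    if [measurable]: "f \<in> borel_measurable borel" "g \<in> borel_measurable borel" and fg: "\<And>t. \<bar>f t\<bar> \<le> 2" "\<And>t. \<bar>g t\<bar> \<le> 2"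
    for f g :: "real \<Rightarrow> real"
  proof (rule Bochner_Integration.integrable_bound)
    show "integrable P (\<lambda>p. 4 * K p)" using K_int by simp
    show "AE p in P. norm (K p * (f (fst p) * g (snd p))) \<le> norm (4 * K p)"
    proof (intro AE_I2)
      fix p
      have "\<bar>f (fst p)\<bar> * \<bar>g (snd p)\<bar> \<le> 2 * 2" by (intro mult_mono fg) auto
      hence "\<bar>K p\<bar> * (\<bar>f (fst p)\<bar> * \<bar>g (snd p)\<bar>) \<le> \<bar>K p\<bar> * 4" by (intro mult_left_mono) auto
      thus "norm (K p * (f (fst p) * g (snd p))) \<le> norm (4 * K p)" by (simp add: abs_mult)
    qed
  qed (use K_int in measurable)
  define \<nu> where "\<nu> f = distr (density circ (\<lambda>t. ennreal (f t))) borel Z" for f :: "real \<Rightarrow> real"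
  define A where "A f g = (\<integral>p. K p * (f (fst p) * g (snd p)) \<partial>P)" for f g :: "real \<Rightarrow> real"
  have energy: "mutual_energy R (\<nu> f) (\<nu> g) = ennreal (A f g)" "A f g \<ge> 0"
    if fm [measurable]: "f \<in> borel_measurable borel" "g \<in> borel_measurable borel"
      and fg: "\<And>t. 0 \<le> f t \<and> f t \<le> 2" "\<And>t. 0 \<le> g t \<and> g t \<le> 2"
    for f g :: "real \<Rightarrow> real"
  proof -
    have nn: "AE p in P. 0 \<le> K p * (f (fst p) * g (snd p))"
      using neq
    proof eventually_elim
      case (elim p)
      hence "ln (cmod (Z (fst p) - Z (snd p))) \<le> ln R" using Z(2)[of "fst p" "snd p"] Z(3) by simp
      thus ?case unfolding K_def using fg by (intro mult_nonneg_nonneg) auto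
    qed
    have "mutual_energy R (\<nu> f) (\<nu> g)
        = (\<integral>\<^sup>+ s. ennreal (f s) * (\<integral>\<^sup>+ t. ennreal (g t) * log_kernel R (Z s) (Z t) \<partial>circ) \<partial>circ)"
      unfolding mutual_energy_def \<nu>_def
      by (simp add: nn_integral_distr nn_integral_density cong: nn_integral_cong)
    also have "\<dots> = (\<integral>\<^sup>+ s. \<integral>\<^sup>+ t. ennreal (f s) * (ennreal (g t) * log_kernel R (Z s) (Z t)) \<partial>circ \<partial>circ)"
      by (simp add: nn_integral_cmult)
    also have "\<dots> = (\<integral>\<^sup>+ p. ennreal (f (fst p)) * (ennreal (g (snd p)) * log_kernel R (Z (fst p)) (Z (snd p))) \<partial>P)"
      unfolding P_def by (subst circ.nn_integral_fst[symmetric]) auto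
    also have "\<dots> = (\<integral>\<^sup>+ p. ennreal (K p * (f (fst p) * g (snd p))) \<partial>P)"
      using neq
    proof (intro nn_integral_cong_AE, eventually_elim)
      case (elim p)
      hence "ln (cmod (Z (fst p) - Z (snd p))) \<le> ln R" using Z(2)[of "fst p" "snd p"] Z(3) by simp
      hence "K p \<ge> 0" by (simp add: K_def)
      moreover have "log_kernel R (Z (fst p)) (Z (snd p)) = ennreal (K p)"
        using elim Z(3) by (simp add: log_kernel_def K_def ln_div)
      ultimately show ?case using fg[of "fst p"] fg[of "snd p"] by (simp add: ennreal_mult mult_ac)
    qed
    also have "\<dots> = ennreal (A f g)"
      unfolding A_def by (intro nn_integral_eq_integral wint nn fm) (use fg in \<open>auto simp: abs_le_iff intro: order_trans[of _ 0]\<close>)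
    finally show "mutual_energy R (\<nu> f) (\<nu> g) = ennreal (A f g)" .
    show "A f g \<ge> 0" unfolding A_def by (intro integral_nonneg_AE nn)
  qed
  define f1 f2 where "f1 t = 1 + q t" and "f2 t = 1 - q t" for t
  have fb: "0 \<le> f1 t \<and> f1 t \<le> 2" "0 \<le> f2 t \<and> f2 t \<le> 2" for t using q(2)[of t] by (auto simp: f1_def f2_def)
  have fm [measurable]: "f1 \<in> borel_measurable borel" "f2 \<in> borel_measurable borel"
    unfolding f1_def[abs_def] f2_def[abs_def] by measurable
  have prob: "prob_space (\<nu> f)" if "f = f1 \<or> f = f2" for f
  proof -
    have [measurable]: "f \<in> borel_measurable borel" using that by auto
    have f0: "f t \<ge> 0" for t using that fb by auto
    have "(\<integral>\<^sup>+ t. ennreal (f t) \<partial>circ) = ennreal (\<integral>t. f t \<partial>circ)"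
      using f0 that qint by (intro nn_integral_eq_integral) (auto simp: f1_def f2_def)
    also have "(\<integral>t. f t \<partial>circ) = 1"
      using that qint q(3) by (auto simp: f1_def f2_def)
    finally have "prob_space (density circ (\<lambda>t. ennreal (f t)))"
      by (intro prob_spaceI) (simp add: emeasure_density)
    thus ?thesis unfolding \<nu>_def by (intro prob_space.prob_space_distr) auto
  qed
  have sets: "sets (\<nu> f) = sets borel" for f by (simp add: \<nu>_def)
  have ran: "AE z in \<nu> f. z \<in> range Z" if "f = f1 \<or> f = f2" for f
  proof -
    have [measurable]: "f \<in> borel_measurable borel" using that by auto
    \<comment> \<open>The range is a countable union of compact sets, hence Borel.\<close>
    have "range Z = (\<Union>n::nat. Z ` {- real n..real n})"
    proof safe
      fix x :: real
      obtain n :: nat where "\<bar>x\<bar> \<le> real n" using real_arch_simple by blast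
      thus "Z x \<in> (\<Union>n::nat. Z ` {- real n..real n})" by (intro UN_I[of n] imageI) auto
    qed auto
    moreover have "Z ` {- real n..real n} \<in> sets borel" for n :: nat
      by (intro borel_compact compact_continuous_image continuous_on_subset[OF Z(1)]) auto
    ultimately have "range Z \<in> sets borel" by auto
    thus ?thesis unfolding \<nu>_def by (subst AE_distr_iff) auto
  qed
  have le: "2 * A f g \<le> A f f + A g g" if "f = f1 \<or> f = f2" "g = f1 \<or> g = f2" for f g
  proof -
    have fgm: "f \<in> borel_measurable borel" "g \<in> borel_measurable borel" using that by auto
    have fgb: "0 \<le> f t \<and> f t \<le> 2" "0 \<le> g t \<and> g t \<le> 2" for t using that fb by auto
    have "2 * mutual_energy R (\<nu> f) (\<nu> g) + gauss_dist 1 (\<nu> f) (\<nu> g) \<le> mutual_energy R (\<nu> f) (\<nu> f) + mutual_energy R (\<nu> g) (\<nu> g)"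
      using that Z by (intro mutual_energy_le[OF prob sets ran prob sets ran]) auto
    hence "2 * mutual_energy R (\<nu> f) (\<nu> g) \<le> mutual_energy R (\<nu> f) (\<nu> f) + mutual_energy R (\<nu> g) (\<nu> g)"
      by (meson order_trans le_add_same_cancel1 zero_le add_increasing2 order_refl)
    hence "2 * ennreal (A f g) \<le> ennreal (A f f) + ennreal (A g g)"
      by (simp add: energy fgm fgb)
    hence "ennreal (2 * A f g) \<le> ennreal (A f f + A g g)"
      using energy(2)[of f f] energy(2)[of g g] energy(2)[of f g] fgm fgb by (simp add: ennreal_mult)
    thus ?thesis using energy(2)[of f f] energy(2)[of g g] fgm fgb by (subst (asm) ennreal_le_iff) auto
  qed
  have i: "integrable P (\<lambda>p. K p * (f (fst p) * g (snd p)))" if "f = f1 \<or> f = f2" "g = f1 \<or> g = f2" for f g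
    using that fb by (intro wint) (auto simp: abs_le_iff intro: order_trans[of _ 0])
  have iq: "integrable P (\<lambda>p. K p * (q (fst p) * q (snd p)))"
    using q(2) by (intro wint) (auto intro: order_trans[OF q(2)])
  \<comment> \<open>As f1 - f2 = 2 q, this alternating sum is four times the form at
    \<open>q\<close>.\<close>
  have "A f1 f1 + A f2 f2 - A f1 f2 - A f2 f1 = (\<integral>p. K p * (f1 (fst p) * f1 (snd p)) + K p * (f2 (fst p) * f2 (snd p))
      - K p * (f1 (fst p) * f2 (snd p)) - K p * (f2 (fst p) * f1 (snd p)) \<partial>P)"
    unfolding A_def by (simp add: i)
  also have "\<dots> = (\<integral>p. 4 * (K p * (q (fst p) * q (snd p))) \<partial>P)"
    by (intro Bochner_Integration.integral_cong) (auto simp: f1_def f2_def algebra_simps)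
  finally have pos: "0 \<le> (\<integral>p. K p * (q (fst p) * q (snd p)) \<partial>P)"
    using le[of f1 f2] le[of f2 f1] by simp
  have qq: "integrable P (\<lambda>p. q (fst p) * q (snd p))"
  proof -
    interpret P: prob_space P unfolding P_def by (intro prob_space_pair circ.prob_space_axioms)
    show ?thesis
    proof (rule P.integrable_const_bound[where B = 1])
      show "AE p in P. norm (q (fst p) * q (snd p)) \<le> 1"
        by (intro AE_I2) (metis abs_ge_zero mult_le_one norm_mult q(2) real_norm_def)
    qed measurable
  qed
  have qq0: "(\<integral>p. q (fst p) * q (snd p) \<partial>P) = 0"
    using circ2.integral_fst'[of "\<lambda>p. q (fst p) * q (snd p)"] qq q(3) by (simp add: P_def)
  have lq: "integrable P (\<lambda>p. ln (cmod (Z (fst p) - Z (snd p))) * (q (fst p) * q (snd p)))"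
  proof -
    have "(\<lambda>p. ln (cmod (Z (fst p) - Z (snd p))) * (q (fst p) * q (snd p)))
       = (\<lambda>p. ln R * (q (fst p) * q (snd p)) - (1/2) * (K p * (q (fst p) * q (snd p))))"
      by (auto simp: K_def fun_eq_iff algebra_simps)
    thus ?thesis using qq iq by simp
  qed
  have "(\<integral>p. K p * (q (fst p) * q (snd p)) \<partial>P)
     = (\<integral>p. 2 * ln R * (q (fst p) * q (snd p)) - 2 * (ln (cmod (Z (fst p) - Z (snd p))) * (q (fst p) * q (snd p))) \<partial>P)"
    by (intro Bochner_Integration.integral_cong) (auto simp: K_def algebra_simps)
  also have "\<dots> = - 2 * (\<integral>p. ln (cmod (Z (fst p) - Z (snd p))) * (q (fst p) * q (snd p)) \<partial>P)"
    using qq lq by (subst Bochner_Integration.integral_diff) (auto simp: qq0)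
  finally show ?thesis using pos by simp
qed

text \<open>The real part of q(s) cnj (q(t)) is the product of the real parts plus the product of
  the imaginary parts, so the complex case is two real ones, rescaled to modulus at most 1.\<close>

lemma curve_energy_nonpos:
  fixes Z :: "real \<Rightarrow> complex" and q :: "real \<Rightarrow> complex"
  defines "P \<equiv> circ \<Otimes>\<^sub>M circ"
  assumes Z: "continuous_on UNIV Z" "\<And>s t. cmod (Z s - Z t) \<le> R" "R > 0"
    and neq: "AE p in P. Z (fst p) \<noteq> Z (snd p)"
    and int: "integrable P (\<lambda>p. ln (cmod (Z (fst p) - Z (snd p))))"
    and q: "continuous_on UNIV q" "\<And>t. cmod (q t) \<le> B" "(\<integral>t. q t \<partial>circ) = 0"
  shows "Re (\<integral>p. of_real (ln (cmod (Z (fst p) - Z (snd p)))) * (q (fst p) * cnj (q (snd p))) \<partial>P) \<le> 0"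
    and "integrable P (\<lambda>p. of_real (ln (cmod (Z (fst p) - Z (snd p)))) * (q (fst p) * cnj (q (snd p))))"
proof -
  define B' where "B' = max B 1"
  have B': "B' > 0" "cmod (q t) \<le> B'" for t using q(2)[of t] by (auto simp: B'_def)
  have [measurable]: "Z \<in> borel_measurable borel" "q \<in> borel_measurable borel"
    using Z(1) q(1) by (auto intro: borel_measurable_continuous_onI)
  have setsP [measurable_cong]: "sets P = sets (borel \<Otimes>\<^sub>M borel)"
    unfolding P_def by (intro sets_pair_measure_cong) simp_all
  let ?l = "\<lambda>p. ln (cmod (Z (fst p) - Z (snd p)))"
  show integ: "integrable P (\<lambda>p. of_real (?l p) * (q (fst p) * cnj (q (snd p))))"
  proof (rule Bochner_Integration.integrable_bound)
    show "integrable P (\<lambda>p. B' * B' * ?l p)" using int by simp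
    show "AE p in P. norm (of_real (?l p) * (q (fst p) * cnj (q (snd p)))) \<le> norm (B' * B' * ?l p)"
    proof (intro AE_I2)
      fix p
      have "cmod (q (fst p)) * cmod (q (snd p)) \<le> B' * B'" using B' by (intro mult_mono) (auto simp: less_imp_le)
      hence "\<bar>?l p\<bar> * (cmod (q (fst p)) * cmod (q (snd p))) \<le> \<bar>?l p\<bar> * (B' * B')" by (intro mult_left_mono) auto
      thus "norm (of_real (?l p) * (q (fst p) * cnj (q (snd p)))) \<le> norm (B' * B' * ?l p)"
        using B' by (simp add: norm_mult abs_mult mult_ac)
    qed
  qed measurable
  have part: "(\<integral>p. ?l p * (f (q (fst p)) * f (q (snd p))) \<partial>P) \<le> 0 \<and> integrable P (\<lambda>p. ?l p * (f (q (fst p)) * f (q (snd p))))"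
    if f: "f = Re \<or> f = Im" for f
  proof -
    have fb: "\<bar>f z\<bar> \<le> cmod z" for z using f abs_Re_le_cmod abs_Im_le_cmod by auto
    have fc: "continuous_on UNIV (\<lambda>t. f (q t))" using f q(1) by (auto intro: continuous_intros)
    have [measurable]: "(\<lambda>t. f (q t)) \<in> borel_measurable borel" using fc by (rule borel_measurable_continuous_onI)
    have "(\<integral>p. ?l p * ((f (q (fst p)) / B') * (f (q (snd p)) / B')) \<partial>P) \<le> 0"
      unfolding P_def
    proof (rule curve_energy_aux[OF Z neq[unfolded P_def] int[unfolded P_def]])
      show "continuous_on UNIV (\<lambda>t. f (q t) / B')" using B' by (intro continuous_intros fc) auto
      show "\<bar>f (q t) / B'\<bar> \<le> 1" for t using B'(1) B'(2)[of t] fb[of "q t"] by simp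
      show "(\<integral>t. f (q t) / B' \<partial>circ) = 0"
        using f q(3) circ_integrable_continuous[OF q(1)] by auto
    qed
    also have "(\<lambda>p. ?l p * ((f (q (fst p)) / B') * (f (q (snd p)) / B'))) = (\<lambda>p. (?l p * (f (q (fst p)) * f (q (snd p)))) / (B' * B'))"
      by auto
    finally have "(\<integral>p. ?l p * (f (q (fst p)) * f (q (snd p))) \<partial>P) / (B' * B') \<le> 0" by simp
    hence 1: "(\<integral>p. ?l p * (f (q (fst p)) * f (q (snd p))) \<partial>P) \<le> 0"
      using mult_pos_pos[OF B'(1) B'(1)] by (simp add: divide_le_0_iff)
    have 2: "integrable P (\<lambda>p. ?l p * (f (q (fst p)) * f (q (snd p))))"
    proof (rule Bochner_Integration.integrable_bound)
      show "integrable P (\<lambda>p. B' * B' * ?l p)" using int by simp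
      show "AE p in P. norm (?l p * (f (q (fst p)) * f (q (snd p)))) \<le> norm (B' * B' * ?l p)"
      proof (intro AE_I2)
        fix p
        have "\<bar>f (q (fst p))\<bar> * \<bar>f (q (snd p))\<bar> \<le> B' * B'"
          using B' by (intro mult_mono order_trans[OF fb B'(2)]) (auto simp: less_imp_le)
        hence "\<bar>?l p\<bar> * (\<bar>f (q (fst p))\<bar> * \<bar>f (q (snd p))\<bar>) \<le> \<bar>?l p\<bar> * (B' * B')" by (intro mult_left_mono) auto
        thus "norm (?l p * (f (q (fst p)) * f (q (snd p)))) \<le> norm (B' * B' * ?l p)"
          using B' by (simp add: abs_mult mult_ac)
      qed
    qed measurable
    from 1 2 show ?thesis by simp
  qed
  have "Re (\<integral>p. of_real (?l p) * (q (fst p) * cnj (q (snd p))) \<partial>P) = (\<integral>p. Re (of_real (?l p) * (q (fst p) * cnj (q (snd p)))) \<partial>P)"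
    by (rule integral_Re[OF integ, symmetric])
  also have "\<dots> = (\<integral>p. ?l p * (Re (q (fst p)) * Re (q (snd p))) + ?l p * (Im (q (fst p)) * Im (q (snd p))) \<partial>P)"
    by (simp add: algebra_simps)
  also have "\<dots> = (\<integral>p. ?l p * (Re (q (fst p)) * Re (q (snd p))) \<partial>P) + (\<integral>p. ?l p * (Im (q (fst p)) * Im (q (snd p))) \<partial>P)"
    using part[of Re] part[of Im] by (intro Bochner_Integration.integral_add) auto
  also have "\<dots> \<le> 0" using part[of Re] part[of Im] by simp
  finally show "Re (\<integral>p. of_real (?l p) * (q (fst p) * cnj (q (snd p))) \<partial>P) \<le> 0" .
qed

section \<open>Divided differences and their logarithm\<close>

lemma continuous_log_holomorphic:
  assumes "continuous_on (ball a R) l" "(\<lambda>u. exp (l u)) holomorphic_on ball a R"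
  shows "l holomorphic_on ball a (R :: real)"
proof -
  obtain g where g: "g holomorphic_on ball a R" "\<And>u. u \<in> ball a R \<Longrightarrow> exp (l u) = exp (g u)"
    using contractible_imp_holomorphic_log[OF assms(2) convex_imp_contractible[OF convex_ball] exp_not_eq_zero] by blast
  \<comment> \<open>Two logarithms of one function differ by integer multiples of 2 pi i, and
    continuity on the connected ball makes the multiple constant.\<close>
  have "(\<lambda>u. l u - g u) constant_on ball a R"
  proof (rule continuous_discrete_range_constant)
    show "continuous_on (ball a R) (\<lambda>u. l u - g u)"
      by (intro continuous_on_diff assms holomorphic_on_imp_continuous_on[OF g(1)])
    fix x assume x: "x \<in> ball a R"
    show "\<exists>e>0. \<forall>y. y \<in> ball a R \<and> l y - g y \<noteq> l x - g x \<longrightarrow> e \<le> norm (l y - g y - (l x - g x))"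
    proof (intro exI[of _ "2 * pi"] conjI allI impI)
      fix y assume y: "y \<in> ball a R \<and> l y - g y \<noteq> l x - g x"
      obtain m n :: int where "l x = g x + complex_of_real (of_int (2 * m) * pi) * \<i>"
        "l y = g y + complex_of_real (of_int (2 * n) * pi) * \<i>"
        using g(2)[OF x] g(2)[of y] y exp_eq by meson
      hence eq: "l y - g y - (l x - g x) = complex_of_real (of_int (n - m) * (2 * pi)) * \<i>"
        by (simp add: algebra_simps)
      hence "n \<noteq> m" using y by auto
      hence "1 \<le> \<bar>real_of_int (n - m)\<bar>" by linarith
      hence "1 * (2 * pi) \<le> \<bar>real_of_int (n - m)\<bar> * (2 * pi)" by (intro mult_right_mono) auto
      thus "2 * pi \<le> norm (l y - g y - (l x - g x))" unfolding eq
          by (simp only: norm_mult norm_of_real abs_mult norm_ii) simp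
    qed simp
  qed simp
  then obtain c where c: "\<And>u. u \<in> ball a R \<Longrightarrow> l u - g u = c" by (auto simp: constant_on_def)
  have "(\<lambda>u. g u + c) holomorphic_on ball a R" by (intro holomorphic_intros g)
  moreover have "l u = g u + c" if "u \<in> ball a R" for u using c[OF that] by (simp add: algebra_simps)
  hence "g u + c = l u" if "u \<in> ball a R" for u using that by simp
  ultimately show ?thesis by (rule holomorphic_transform) simp
qed

text \<open>Averaging \<open>deriv h\<close> along the segment from \<open>v\<close> to
  \<open>u\<close> extends the difference quotient to the diagonal with joint continuity built in;
  separate holomorphy then follows by removing the singularity at \<open>u = v\<close>.\<close>

lemma divided_difference:
  assumes h: "h holomorphic_on ball 0 1"
  obtains D :: "complex \<Rightarrow> complex \<Rightarrow> complex"
  where "continuous_on (ball 0 1 \<times> ball 0 1) (\<lambda>(u, v). D u v)"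
    "\<And>u v. u \<in> ball 0 1 \<Longrightarrow> v \<in> ball 0 1 \<Longrightarrow> D u v * (u - v) = h u - h v"
    "\<And>u. u \<in> ball 0 1 \<Longrightarrow> D u u = deriv h u"
    "\<And>u v. u \<in> ball 0 1 \<Longrightarrow> v \<in> ball 0 1 \<Longrightarrow> D u v = D v u"
    "\<And>v. v \<in> ball 0 1 \<Longrightarrow> (\<lambda>u. D u v) holomorphic_on ball 0 1"
proof -
  define D where "D u v = integral (cbox 0 1) (\<lambda>t::real. deriv h (v + of_real t * (u - v)))" for u v
  have dh: "deriv h holomorphic_on ball 0 1" using h by (rule holomorphic_deriv) simp
  have seg: "v + of_real t * (u - v) \<in> ball 0 1" if "u \<in> ball 0 1" "v \<in> ball 0 1" "t \<in> {0..1}" for u v :: complex and t :: real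
  proof -
    have "(1 - t) *\<^sub>R v + t *\<^sub>R u \<in> ball 0 1" using that by (intro convexD_alt[OF convex_ball]) auto
    also have "(1 - t) *\<^sub>R v + t *\<^sub>R u = v + of_real t * (u - v)" by (simp add: scaleR_conv_of_real algebra_simps)
    finally show ?thesis .
  qed
  have cont: "continuous_on (ball 0 1 \<times> ball 0 1) (\<lambda>p. D (fst p) (snd p))"
    unfolding D_def
    by (intro integral_continuous_on_param, unfold case_prod_beta)
       (intro continuous_on_compose2[OF holomorphic_on_imp_continuous_on[OF dh]] continuous_intros, auto intro!: seg simp del: mem_ball)
  have eq: "D u v * (u - v) = h u - h v" if "u \<in> ball 0 1" "v \<in> ball 0 1" for u v
  proof -
    have "((\<lambda>t. deriv h (v + of_real t * (u - v)) * (u - v)) has_integral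
           h (v + of_real 1 * (u - v)) - h (v + of_real 0 * (u - v))) {0..1::real}"
    proof (rule fundamental_theorem_of_calculus)
      fix t :: real assume t: "t \<in> {0..1}"
      have d: "(h has_field_derivative deriv h (v + of_real t * (u - v))) (at (v + of_real t * (u - v)))"
        using h seg[OF that t] by (intro holomorphic_derivI) auto
      have "((\<lambda>t. v + t *\<^sub>R (u - v)) has_vector_derivative (u - v)) (at t within {0..1})"
        by (auto intro!: derivative_eq_intros)
      hence "((\<lambda>t. v + of_real t * (u - v)) has_vector_derivative (u - v)) (at t within {0..1})"
        by (simp only: scaleR_conv_of_real)
      from field_vector_diff_chain_within[OF this has_field_derivative_at_within[OF d]]
      show "((\<lambda>t. h (v + of_real t * (u - v))) has_vector_derivative deriv h (v + of_real t * (u - v)) * (u - v)) (at t within {0..1})"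
        unfolding comp_def by (subst mult.commute)
    qed simp
    moreover have "((\<lambda>t. deriv h (v + of_real t * (u - v))) has_integral D u v) {0..1}"
    proof -
      have "continuous_on {0..1} (\<lambda>t::real. deriv h (v + of_real t * (u - v)))"
        by (intro continuous_on_compose2[OF holomorphic_on_imp_continuous_on[OF dh]] continuous_intros)
           (auto intro!: seg that simp del: mem_ball)
      hence "(\<lambda>t. deriv h (v + of_real t * (u - v))) integrable_on {0..1}" by (rule integrable_continuous_interval)
      thus ?thesis unfolding D_def by (simp add: has_integral_integral)
    qed
    from has_integral_mult_left[OF this, of "u - v"] 
    have "((\<lambda>t. deriv h (v + of_real t * (u - v)) * (u - v)) has_integral D u v * (u - v)) {0..1}" .
    ultimately show ?thesis by (auto dest: has_integral_unique)
  qed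
  have diag: "D u u = deriv h u" for u by (simp add: D_def)
  have sym: "D u v = D v u" if "u \<in> ball 0 1" "v \<in> ball 0 1" for u v
  proof (cases "u = v")
    case False
    have "D v u * (u - v) = - (D v u * (v - u))" by (simp add: algebra_simps)
    hence "D u v * (u - v) = D v u * (u - v)" using eq[OF that] eq[OF that(2,1)] by simp
    thus ?thesis using False by simp
  qed simp
  have hol: "(\<lambda>u. D u v) holomorphic_on ball 0 1" if v: "v \<in> ball 0 1" for v
  proof (rule no_isolated_singularity)
    show "continuous_on (ball 0 1) (\<lambda>u. D u v)"
      by (rule continuous_on_compose2[OF cont, of _ "\<lambda>u. (u, v)", simplified]) (use v in \<open>auto intro!: continuous_intros\<close>)
    have "(\<lambda>u. (h u - h v) / (u - v)) holomorphic_on (ball 0 1 - {v})"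
      using h by (intro holomorphic_intros) (auto intro: holomorphic_on_subset)
    moreover have "(h u - h v) / (u - v) = D u v" if "u \<in> ball 0 1 - {v}" for u
      using eq[of u v] v that by (auto simp: field_simps)
    ultimately show "(\<lambda>u. D u v) holomorphic_on (ball 0 1 - {v})" by (rule holomorphic_transform)
  qed auto
  show ?thesis by (rule that[of D]) (use cont eq diag sym hol in \<open>auto simp: case_prod_beta simp del: mem_ball\<close>)
qed

text \<open>With S u = 1/u + h u, the function \<open>L\<close> is a logarithm of (S u - S v) / (1/u
  - 1/v), the generating function of the Grunsky coefficients. It exists since univalence makes the
  quotient zero-free and the bidisc is contractible. Its branch is fixed only up to a multiple of 2
  pi i, which neither the derivatives nor the real part see.\<close>

lemma log_divided_difference:
  assumes h: "h holomorphic_on ball 0 1" and inj: "inj_on (\<lambda>u. 1 / u + h u) (ball 0 1 - {0})"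
  obtains L :: "complex \<Rightarrow> complex \<Rightarrow> complex"
  where "continuous_on (ball 0 1 \<times> ball 0 1) (\<lambda>(u, v). L u v)"
    "\<And>u. u \<in> ball 0 1 \<Longrightarrow> L u holomorphic_on ball 0 1"
    "\<And>v. v \<in> ball 0 1 \<Longrightarrow> (\<lambda>u. L u v) holomorphic_on ball 0 1"
    "\<And>u. u \<in> ball 0 1 \<Longrightarrow> deriv (L u) 0 = - (h u - h 0)"
    "\<And>v. v \<in> ball 0 1 \<Longrightarrow> deriv (\<lambda>u. L u v) 0 = - (h v - h 0)"
    "\<And>u v. u \<in> ball 0 1 \<Longrightarrow> v \<in> ball 0 1 \<Longrightarrow> u \<noteq> v \<Longrightarrow> exp (L u v) = 1 - u * v * ((h u - h v) / (u - v))"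
proof -
  obtain D where D: "continuous_on (ball 0 1 \<times> ball 0 1) (\<lambda>(u, v). D u v)"
    "\<And>u v. u \<in> ball 0 1 \<Longrightarrow> v \<in> ball 0 1 \<Longrightarrow> D u v * (u - v) = h u - h v"
    "\<And>u. u \<in> ball 0 1 \<Longrightarrow> D u u = deriv h u"
    "\<And>u v. u \<in> ball 0 1 \<Longrightarrow> v \<in> ball 0 1 \<Longrightarrow> D u v = D v u"
    "\<And>v. v \<in> ball 0 1 \<Longrightarrow> (\<lambda>u. D u v) holomorphic_on ball 0 1"
    using divided_difference[OF h] by blast
  define G where "G u v = 1 - u * v * D u v" for u v
  \<comment> \<open>\<open>G\<close> is 1 on the axes; on the diagonal it is nonzero because an
    injective map has nonzero derivative, elsewhere by injectivity.\<close>
  have Gnz: "G u v \<noteq> 0" if u: "u \<in> ball 0 1" and v: "v \<in> ball 0 1" for u v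
  proof (cases "u = 0 \<or> v = 0")
    case False
    show ?thesis
    proof (cases "u = v")
      case True
      define S where "S u = 1 / u + h u" for u
      have op: "open (ball 0 1 - {0::complex})" by auto
      have hol: "S holomorphic_on (ball 0 1 - {0})"
        unfolding S_def by (intro holomorphic_intros holomorphic_on_subset[OF h]) auto
      have "deriv S u \<noteq> 0"
        using False u inj by (intro holomorphic_injective_imp_regular[OF hol op]) (auto simp: S_def[abs_def])
      moreover have "(S has_field_derivative - (1 / u\<^sup>2) + deriv h u) (at u)"
        unfolding S_def[abs_def] using False u h
        by (auto intro!: derivative_eq_intros holomorphic_derivI[OF h] simp: power2_eq_square)
      hence "deriv S u = - (1 / u\<^sup>2) + deriv h u" by (rule DERIV_imp_deriv)
      ultimately show ?thesis using D(3)[OF u] False True by (auto simp: G_def field_simps power2_eq_square)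
    next
      case uv: False
      have "1 / u + h u \<noteq> 1 / v + h v" using inj_onD[OF inj, of u v] u v uv False by auto
      hence "(1 / u + h u - (1 / v + h v)) * (u * v) \<noteq> 0" using False by auto
      also have "(1 / u + h u - (1 / v + h v)) * (u * v) = (v - u) + (h u - h v) * (u * v)"
        using False by (simp add: field_simps)
      also have "\<dots> = (v - u) * G u v" by (simp add: G_def algebra_simps flip: D(2)[OF u v])
      finally show ?thesis by auto
    qed
  qed (auto simp: G_def)
  have Gc: "continuous_on (ball 0 1 \<times> ball 0 1) (\<lambda>p. G (fst p) (snd p))"
    unfolding G_def using D(1) by (intro continuous_intros) (simp add: case_prod_beta)
  obtain l where l: "continuous_on (ball 0 1 \<times> ball 0 1) l"
    "\<And>p. p \<in> ball 0 1 \<times> ball 0 1 \<Longrightarrow> G (fst p) (snd p) = exp (l p)"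
  proof (rule continuous_logarithm_on_contractible[OF Gc convex_imp_contractible[OF convex_Times[OF convex_ball convex_ball]]])
    fix p :: "complex \<times> complex" assume "p \<in> ball 0 1 \<times> ball 0 1"
    thus "G (fst p) (snd p) \<noteq> 0" by (intro Gnz) (auto simp: mem_Times_iff)
  qed blast
  define L where "L u v = l (u, v)" for u v
  have exL: "exp (L u v) = G u v" if "u \<in> ball 0 1" "v \<in> ball 0 1" for u v
    using l(2)[of "(u, v)"] that by (simp add: L_def)
  have Gsym: "G u v = G v u" if "u \<in> ball 0 1" "v \<in> ball 0 1" for u v
    using D(4)[OF that] by (simp add: G_def mult_ac)
  have Gh: "(\<lambda>u. G u v) holomorphic_on ball 0 1" if "v \<in> ball 0 1" for v
    unfolding G_def by (intro holomorphic_intros D that)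
  have Gh': "G u holomorphic_on ball 0 1" if u: "u \<in> ball 0 1" for u
    using Gh[OF u] by (rule holomorphic_transform) (use Gsym u in auto)
  \<comment> \<open>The logarithm on the bidisc is so far only continuous; holomorphy is recovered
    in each variable separately.\<close>
  have L1: "L u holomorphic_on ball 0 1" if u: "u \<in> ball 0 1" for u
  proof (rule continuous_log_holomorphic)
    show "continuous_on (ball 0 1) (L u)" unfolding L_def
      by (rule continuous_on_compose2[OF l(1)]) (use u in \<open>auto intro!: continuous_intros\<close>)
    show "(\<lambda>v. exp (L u v)) holomorphic_on ball 0 1"
      using Gh'[OF u] by (rule holomorphic_transform) (use exL u in auto)
  qed
  have L2: "(\<lambda>u. L u v) holomorphic_on ball 0 1" if v: "v \<in> ball 0 1" for v
  proof (rule continuous_log_holomorphic)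
    show "continuous_on (ball 0 1) (\<lambda>u. L u v)" unfolding L_def
      by (rule continuous_on_compose2[OF l(1)]) (use v in \<open>auto intro!: continuous_intros\<close>)
    show "(\<lambda>u. exp (L u v)) holomorphic_on ball 0 1"
      using Gh[OF v] by (rule holomorphic_transform) (use exL v in auto)
  qed
  have dG: "((\<lambda>u. G u v) has_field_derivative - (h v - h 0)) (at 0)" if v: "v \<in> ball 0 1" for v
  proof -
    have d: "((\<lambda>u. D u v) has_field_derivative deriv (\<lambda>u. D u v) 0) (at 0)"
      by (intro holomorphic_derivI[OF D(5)[OF v]]) auto
    have "v * D 0 v = h v - h 0" using D(2)[of 0 v] v by (simp add: algebra_simps)
    thus ?thesis unfolding G_def by (auto intro!: derivative_eq_intros d)
  qed
  have dl: "deriv f 0 = d" if f: "f holomorphic_on ball 0 1" and g: "\<And>u. u \<in> ball 0 1 \<Longrightarrow> exp (f u) = g u"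
    and g0: "g 0 = 1" and d: "(g has_field_derivative d) (at 0)" for f g :: "complex \<Rightarrow> complex" and d
  proof -
    have "((\<lambda>u. exp (f u)) has_field_derivative exp (f 0) * deriv f 0) (at 0)"
      by (auto intro!: derivative_eq_intros holomorphic_derivI[OF f])
    moreover have "((\<lambda>u. exp (f u)) has_field_derivative d) (at 0)"
      using d by (rule has_field_derivative_transform_within_open[of _ _ _ "ball 0 1"]) (auto simp: g)
    ultimately show ?thesis using g[of 0] g0 by (auto dest: DERIV_unique)
  qed
  have dL2: "deriv (\<lambda>u. L u v) 0 = - (h v - h 0)" if v: "v \<in> ball 0 1" for v
    by (rule dl[OF L2[OF v] _ _ dG[OF v]]) (use v exL in \<open>auto simp: G_def\<close>)
  have dL1: "deriv (L u) 0 = - (h u - h 0)" if u: "u \<in> ball 0 1" for u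
    by (rule dl[OF L1[OF u] _ _ dG[OF u]]) (use u exL Gsym in \<open>auto simp: G_def\<close>)
  show ?thesis
  proof (rule that[of L])
    show "continuous_on (ball 0 1 \<times> ball 0 1) (\<lambda>(u, v). L u v)" using l(1) by (simp add: L_def case_prod_beta)
    show "exp (L u v) = 1 - u * v * ((h u - h v) / (u - v))" if "u \<in> ball 0 1" "v \<in> ball 0 1" "u \<noteq> v" for u v
      using exL[OF that(1,2)] D(2)[OF that(1,2), symmetric] that(3) by (simp add: G_def)
  qed (use L1 L2 dL1 dL2 in auto)
qed

section \<open>The logarithm of the distance on the unit circle\<close>

lemma integrable_ln_of_log_kernel:
  fixes f g :: "'a \<Rightarrow> complex"
  assumes "finite_measure M" and [measurable]: "f \<in> borel_measurable M" "g \<in> borel_measurable M"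
    and "AE x in M. f x \<noteq> g x" "AE x in M. cmod (f x - g x) \<le> R" "R > 0"
    and fin: "(\<integral>\<^sup>+ x. log_kernel R (f x) (g x) \<partial>M) < \<infinity>"
  shows "integrable M (\<lambda>x. ln (cmod (f x - g x)))"
proof -
  interpret finite_measure M by fact
  define K where "K x = 2 * ln R - 2 * ln (cmod (f x - g x))" for x
  have "integrable M K"
    unfolding K_def[abs_def]
  proof (rule integrableI_nonneg)
    show "AE x in M. 0 \<le> 2 * ln R - 2 * ln (cmod (f x - g x))"
      using assms(4,5) by eventually_elim (use \<open>R > 0\<close> in auto)
    have "(\<integral>\<^sup>+ x. ennreal (2 * ln R - 2 * ln (cmod (f x - g x))) \<partial>M) = (\<integral>\<^sup>+ x. log_kernel R (f x) (g x) \<partial>M)"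
      using assms(4) by (intro nn_integral_cong_AE, eventually_elim) (use \<open>R > 0\<close> in \<open>auto simp: log_kernel_def ln_div\<close>)
    thus "(\<integral>\<^sup>+ x. ennreal (2 * ln R - 2 * ln (cmod (f x - g x))) \<partial>M) < \<infinity>" using fin by simp
  qed measurable
  hence "integrable M (\<lambda>x. ln R - (1/2) * K x)"
    by (intro Bochner_Integration.integrable_diff integrable_mult_right) auto
  moreover have "(\<lambda>x. ln R - (1/2) * K x) = (\<lambda>x. ln (cmod (f x - g x)))"
    by (auto simp: K_def algebra_simps)
  ultimately show ?thesis by simp
qed

text \<open>On the circle |u - w| = |1 - u cnj w|, and the function on the right has value 1 at 0
  and no zero inside the disc; its zero on the boundary leaves an inequality.\<close>

lemma unit_circle_log_kernel:
  assumes "cmod w = 1"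
  shows "(\<integral>\<^sup>+ s. log_kernel 2 (ucis s) w \<partial>circ) \<le> ennreal (2 * ln 2)"
proof -
  have eq: "cmod (1 - ucis s * cnj w) = cmod (ucis s - w)" for s
  proof -
    have "w * cnj w = 1" using assms by (simp add: complex_norm_square[symmetric])
    hence "w * (1 - ucis s * cnj w) = w - ucis s" by (simp add: algebra_simps)
    hence "cmod w * cmod (1 - ucis s * cnj w) = cmod (w - ucis s)" by (metis norm_mult)
    thus ?thesis using assms by (simp add: norm_minus_commute)
  qed
  have "(\<integral>\<^sup>+ s. log_kernel 2 (ucis s) w \<partial>circ) = (\<integral>\<^sup>+ s. log_kernel 2 (1 - of_real 1 * ucis s * cnj w) 0 \<partial>circ)"
    using eq by (intro nn_integral_cong) (metis (no_types, lifting) diff_zero log_kernel_def mult_1 norm_eq_zero of_real_1 right_minus_eq)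
  also have "\<dots> \<le> ennreal (2 * ln (2 / cmod (1 - 0 * cnj w)))"
  proof (rule log_kernel_mean_le[where g = "\<lambda>u. 1 - u * cnj w"])
    show "1 - u * cnj w \<noteq> 0" if "u \<in> ball 0 1" for u
    proof
      assume "1 - u * cnj w = 0"
      hence "cmod (u * cnj w) = 1" by (simp flip: eq_iff_diff_eq_0)
      thus False using that assms by (simp add: norm_mult)
    qed
    show "cmod (1 - u * cnj w) \<le> 2" if "u \<in> cball 0 1" for u
      using norm_triangle_ineq4[of 1 "u * cnj w"] that assms by (simp add: norm_mult)
  qed (auto intro!: holomorphic_intros continuous_intros)
  finally show ?thesis by simp
qed

text \<open>Re g is half of g plus its conjugate, and against a positive power of
  \<open>ucis t\<close> only the conjugate half has a nonzero mean.\<close>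

lemma fourier_Re:
  assumes "continuous_on (cball 0 r) g" "g holomorphic_on ball 0 r" "r > 0" "n > 0"
  shows "(\<integral>t. of_real (Re (g (of_real r * ucis t))) * ucis t ^ n \<partial>circ) = cnj ((deriv ^^ n) g 0 / fact n * of_real r ^ n) / 2"
proof -
  have c: "continuous_on UNIV (\<lambda>t. g (of_real r * ucis t))"
    using assms by (intro continuous_on_circle_compose) auto
  have i1: "integrable circ (\<lambda>t. g (of_real r * ucis t) * ucis t ^ n)"
    by (intro circ_integrable_continuous continuous_intros c)
  have i2: "integrable circ (\<lambda>t. cnj (g (of_real r * ucis t) * cnj (ucis t) ^ n))"
    by (intro circ_integrable_continuous continuous_intros c)
  have "(\<integral>t. of_real (Re (g (of_real r * ucis t))) * ucis t ^ n \<partial>circ)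
     = (\<integral>t. (g (of_real r * ucis t) * ucis t ^ n + cnj (g (of_real r * ucis t) * cnj (ucis t) ^ n)) / 2 \<partial>circ)"
    by (intro Bochner_Integration.integral_cong refl)
       (simp add: complex_add_cnj[symmetric] distrib_right[symmetric] del: complex_add_cnj add: complex_eq_iff algebra_simps)
  also have "\<dots> = ((\<integral>t. g (of_real r * ucis t) * ucis t ^ n \<partial>circ) + cnj (\<integral>t. g (of_real r * ucis t) * cnj (ucis t) ^ n \<partial>circ)) / 2"
    using i1 i2 by (simp only: integral_divide_zero Bochner_Integration.integral_add Bochner_Integration.integral_cnj)
  also have "\<dots> = cnj ((deriv ^^ n) g 0 / fact n * of_real r ^ n) / 2"
    by (simp only: fourier_coeff[OF assms(1-3)] fourier_coeff_neg[OF assms]) simp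
  finally show ?thesis .
qed

text \<open>The coefficients are those of Ln (1 - cnj w u), halved by taking the real part. They are
  read off on circles of radius \<open>\<rho> k\<close> and carried to the boundary by dominated
  convergence.\<close>

lemma unit_circle_log_fourier:
  assumes w: "cmod w = 1"
  shows "integrable circ (\<lambda>s. ln (cmod (ucis s - w)))"
    and "n > 0 \<Longrightarrow> (\<integral>s. of_real (ln (cmod (ucis s - w))) * ucis s ^ n \<partial>circ) = - (w ^ n) / (2 * of_nat n)"
    and "n > 0 \<Longrightarrow> (\<integral>s. of_real (ln (cmod (ucis s - w))) * cnj (ucis s) ^ n \<partial>circ) = - (cnj w ^ n) / (2 * of_nat n)"
proof -
  show int: "integrable circ (\<lambda>s. ln (cmod (ucis s - w)))"
  proof (rule integrable_ln_of_log_kernel)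
    show "AE x in circ. cmod (ucis x - w) \<le> 2"
      using norm_triangle_ineq4[of "ucis _" w] w by (intro AE_I2) (smt (verit) norm_ucis)
    show "(\<integral>\<^sup>+ s. log_kernel 2 (ucis s) w \<partial>circ) < \<infinity>"
      using unit_circle_log_kernel[OF w] by (auto intro: le_less_trans)
  qed (auto intro: AE_circ_ucis_neq circ.finite_measure_axioms)
  have 1: "(\<integral>s. of_real (ln (cmod (ucis s - w))) * ucis s ^ n \<partial>circ) = - (w ^ n) / (2 * of_nat n)" if n: "n > 0" for n
  proof -
    define f where "f u = Ln (1 + (- (cnj w) * u))" for u
    have ww: "w * cnj w = 1" using w by (simp add: complex_norm_square[symmetric])
    have re: "Re (1 + (- (cnj w) * u)) > 0" if "cmod u < 1" for u
    proof -
      have "Re (cnj w * u) \<le> cmod (cnj w * u)" by (rule complex_Re_le_cmod)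
      also have "\<dots> < 1" using that w by (simp add: norm_mult)
      finally show ?thesis by simp
    qed
    have fh: "f holomorphic_on ball 0 1"
    proof -
      have nn: "1 + (- (cnj w) * u) \<notin> \<real>\<^sub>\<le>\<^sub>0" if "cmod u < 1" for u
        using re[OF that] by (metis complex_nonpos_Reals_iff not_le)
      thus ?thesis unfolding f_def by (intro holomorphic_on_Ln' nn holomorphic_intros) auto
    qed
    have cf: "(deriv ^^ n) f 0 / fact n = - (cnj w ^ n) / of_nat n"
    proof -
      have fps: "f has_fps_expansion Abs_fps (\<lambda>n. (-1) ^ Suc n / of_nat n * (- cnj w) ^ n)"
      proof (rule has_fps_expansionI)
        have "\<forall>\<^sub>F u in nhds (0::complex). u \<in> ball 0 1" by (intro eventually_nhds_in_open) auto
        thus "\<forall>\<^sub>F u in nhds 0. (\<lambda>n. fps_nth (Abs_fps (\<lambda>n. (-1) ^ Suc n / of_nat n * (- cnj w) ^ n)) n * u ^ n) sums f u"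
        proof eventually_elim
          case (elim u)
          hence "cmod (- (cnj w) * u) < 1" using w by (simp add: norm_mult)
          from Ln_series[OF this] show ?case by (simp add: f_def power_mult_distrib[symmetric] mult.assoc)
        qed
      qed
      have "(deriv ^^ n) f 0 / fact n = (-1) ^ Suc n / of_nat n * (- cnj w) ^ n"
        unfolding fps_nth_fps_expansion[OF fps, symmetric] fps_nth_Abs_fps ..
      also have "\<dots> = - ((-1) ^ n * (- cnj w) ^ n) / of_nat n" by simp
      also have "(-1) ^ n * (- cnj w) ^ n = cnj w ^ n" by (simp only: power_mult_distrib[symmetric]) simp
      finally show ?thesis .
    qed
    define \<rho> where "\<rho> k = 1 - 1 / (real k + 2)" for k
    have \<rho>: "0 < \<rho> k" "\<rho> k < 1" for k by (auto simp: \<rho>_def)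
    have \<rho>lim: "\<rho> \<longlonglongrightarrow> 1" unfolding \<rho>_def by real_asymp
    define F where "F k s = complex_of_real (Re (f (of_real (\<rho> k) * ucis s))) * ucis s ^ n" for k s
    have cont: "continuous_on (cball 0 (\<rho> k)) f" "f holomorphic_on ball 0 (\<rho> k)" for k
      using \<rho>[of k] by (auto intro!: holomorphic_on_imp_continuous_on holomorphic_on_subset[OF fh])
    have val: "integral\<^sup>L circ (F k) = - (w ^ n) / (2 * of_nat n) * of_real (\<rho> k) ^ n" for k
      unfolding F_def using fourier_Re[OF cont[of k] \<rho>(1)[of k] n] by (simp add: cf)
    have lnf: "Re (f u) = ln (cmod (1 - u * cnj w))" if "cmod u < 1" for u
    proof -
      have "1 + (- (cnj w) * u) \<noteq> 0" using re[OF that] by (metis less_irrefl zero_complex.sel(1))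
      hence "Re (f u) = ln (cmod (1 + (- (cnj w) * u)))" unfolding f_def by (rule Re_Ln)
      thus ?thesis by (simp add: mult.commute)
    qed
    have cm: "cmod (ucis s - w) = cmod (1 - ucis s * cnj w)" for s
    proof -
      have "w * (1 - ucis s * cnj w) = w - ucis s" using ww by (simp add: algebra_simps)
      hence "cmod w * cmod (1 - ucis s * cnj w) = cmod (w - ucis s)" by (metis norm_mult)
      thus ?thesis using w by (simp add: norm_minus_commute)
    qed
    have lim: "(\<lambda>k. integral\<^sup>L circ (F k)) \<longlonglongrightarrow> (\<integral>s. of_real (ln (cmod (ucis s - w))) * ucis s ^ n \<partial>circ)"
    proof (rule integral_dominated_convergence)
      show "(\<lambda>s. of_real (ln (cmod (ucis s - w))) * ucis s ^ n) \<in> borel_measurable circ" by measurable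
      show "F k \<in> borel_measurable circ" for k
      proof -
        have "continuous_on UNIV (F k)" unfolding F_def using \<rho>[of k]
          by (intro continuous_intros continuous_on_circle_compose cont) auto
        hence [measurable]: "F k \<in> borel_measurable borel" by (rule borel_measurable_continuous_onI)
        show ?thesis by measurable
      qed
      show "integrable circ (\<lambda>s. 2 * ln 2 - ln (cmod (ucis s - w)))" using int by simp
      show "AE s in circ. (\<lambda>k. F k s) \<longlonglongrightarrow> of_real (ln (cmod (ucis s - w))) * ucis s ^ n"
        using AE_circ_ucis_neq[of w]
      proof eventually_elim
        case (elim s)
        have "(\<lambda>k. of_real (ln (cmod (1 - of_real (\<rho> k) * ucis s * cnj w))) * ucis s ^ n)
            \<longlonglongrightarrow> of_real (ln (cmod (1 - of_real 1 * ucis s * cnj w))) * ucis s ^ n"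
          using elim cm[of s] by (intro tendsto_intros \<rho>lim) auto
        moreover have "Re (f (of_real (\<rho> k) * ucis s)) = ln (cmod (1 - of_real (\<rho> k) * ucis s * cnj w))" for k
          using \<rho>[of k] by (intro lnf) (simp add: norm_mult)
        ultimately show ?case by (simp add: F_def cm)
      qed
      show "AE s in circ. norm (F k s) \<le> 2 * ln 2 - ln (cmod (ucis s - w))" for k
        using AE_circ_ucis_neq[of w]
      proof eventually_elim
        case (elim s)
        define z where "z = ucis s * cnj w"
        have z: "cmod z = 1" using w by (simp add: z_def norm_mult)
        let ?a = "cmod (1 - z)" and ?b = "cmod (1 - of_real (\<rho> k) * z)"
        have a: "?a > 0" "?a \<le> 2" using elim cm[of s] norm_triangle_ineq4[of 1 z] z by (auto simp: z_def)
        have b1: "1 - \<rho> k \<le> ?b" using norm_triangle_ineq2[of 1 "of_real (\<rho> k) * z"] \<rho>[of k] z by (simp add: norm_mult)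
        have b2: "?b \<le> 2" using norm_triangle_ineq4[of 1 "of_real (\<rho> k) * z"] \<rho>[of k] z by (simp add: norm_mult)
        \<comment> \<open>Passing from 1 - \<rho> z to 1 - z costs 1 - \<rho>, itself at most |1 -
          \<rho> z|. Hence |1 - z| <= 2 |1 - \<rho> z|, a lower bound uniform in \<open>k\<close>
          that yields the integrable majorant.\<close>
        have "1 - z = (1 - of_real (\<rho> k) * z) - of_real (1 - \<rho> k) * z" by (simp add: algebra_simps)
        hence "?a \<le> ?b + cmod (of_real (1 - \<rho> k) * z)" by (metis norm_triangle_ineq4)
        also have "cmod (of_real (1 - \<rho> k) * z) = 1 - \<rho> k" using \<rho>[of k] z by (simp only: norm_mult norm_of_real) simp
        finally have b3: "?a \<le> 2 * ?b" using b1 by simp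
        have b0: "?b > 0" using b1 \<rho>[of k] by linarith
        have "ln ?a \<le> ln (2 * ?b)" using a b0 b3 by (subst ln_le_cancel_iff) auto
        hence l1: "ln ?a \<le> ln 2 + ln ?b" using b0 by (simp add: ln_mult)
        have l2: "ln ?b \<le> ln 2" "ln ?a \<le> ln 2" using a b0 b2 by simp_all
        have "0 \<le> ln (2::real)" by simp
        hence "\<bar>ln ?b\<bar> \<le> 2 * ln 2 - ln ?a" using l1 l2 by linarith
        moreover have "norm (F k s) = \<bar>ln ?b\<bar>"
          using \<rho>[of k] unfolding F_def by (subst lnf) (auto simp: norm_mult norm_power z_def mult.assoc)
        ultimately show ?case by (simp add: cm z_def)
      qed
    qed
    moreover have "(\<lambda>k. integral\<^sup>L circ (F k)) \<longlonglongrightarrow> - (w ^ n) / (2 * of_nat n) * of_real 1 ^ n"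
      unfolding val by (intro tendsto_intros \<rho>lim)
    ultimately show ?thesis using LIMSEQ_unique by fastforce
  qed
  thus "n > 0 \<Longrightarrow> (\<integral>s. of_real (ln (cmod (ucis s - w))) * ucis s ^ n \<partial>circ) = - (w ^ n) / (2 * of_nat n)" .
  assume "n > 0"
  have "(\<integral>s. of_real (ln (cmod (ucis s - w))) * cnj (ucis s) ^ n \<partial>circ)
     = (\<integral>s. cnj (of_real (ln (cmod (ucis s - w))) * ucis s ^ n) \<partial>circ)" by simp
  also have "\<dots> = cnj (\<integral>s. of_real (ln (cmod (ucis s - w))) * ucis s ^ n \<partial>circ)" by (rule Bochner_Integration.integral_cnj)
  also have "\<dots> = - (cnj w ^ n) / (2 * of_nat n)" unfolding 1[OF \<open>n > 0\<close>] by simp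
  finally show "(\<integral>s. of_real (ln (cmod (ucis s - w))) * cnj (ucis s) ^ n \<partial>circ) = - (cnj w ^ n) / (2 * of_nat n)" .
qed

lemma integrable_ln_ucis_pair:
  "integrable (circ \<Otimes>\<^sub>M circ) (\<lambda>p. ln (cmod (ucis (fst p) - ucis (snd p))))"
  and AE_ucis_pair_neq: "AE p in circ \<Otimes>\<^sub>M circ. ucis (fst p) \<noteq> ucis (snd p)"
proof -
  have [measurable_cong]: "sets (circ \<Otimes>\<^sub>M circ) = sets (borel \<Otimes>\<^sub>M borel)"
    by (intro sets_pair_measure_cong) simp_all
  show ne: "AE p in circ \<Otimes>\<^sub>M circ. ucis (fst p) \<noteq> ucis (snd p)"
  proof (rule circ2.AE_pair_measure)
    show "{p \<in> space (circ \<Otimes>\<^sub>M circ). ucis (fst p) \<noteq> ucis (snd p)} \<in> sets (circ \<Otimes>\<^sub>M circ)"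
      by measurable
    show "AE x in circ. AE y in circ. ucis (fst (x, y)) \<noteq> ucis (snd (x, y))"
      using AE_circ_ucis_neq by (auto simp: eq_commute)
  qed
  show "integrable (circ \<Otimes>\<^sub>M circ) (\<lambda>p. ln (cmod (ucis (fst p) - ucis (snd p))))"
  proof (rule integrable_ln_of_log_kernel)
    show "finite_measure (circ \<Otimes>\<^sub>M circ)"
      using prob_space_pair[OF circ.prob_space_axioms circ.prob_space_axioms] by (rule prob_space.finite_measure)
    show "AE x in circ \<Otimes>\<^sub>M circ. cmod (ucis (fst x) - ucis (snd x)) \<le> 2"
    proof (intro AE_I2)
      fix x show "cmod (ucis (fst x) - ucis (snd x)) \<le> 2" using norm_triangle_ineq4[of "ucis (fst x)" "ucis (snd x)"] by simp
    qed
    have "(\<integral>\<^sup>+ p. log_kernel 2 (ucis (fst p)) (ucis (snd p)) \<partial>(circ \<Otimes>\<^sub>M circ))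
       = (\<integral>\<^sup>+ s. \<integral>\<^sup>+ t. log_kernel 2 (ucis s) (ucis t) \<partial>circ \<partial>circ)"
      by (subst circ.nn_integral_fst[symmetric]) auto
    also have "\<dots> \<le> (\<integral>\<^sup>+ s. ennreal (2 * ln 2) \<partial>circ)"
    proof (intro nn_integral_mono)
      fix s
      have "(\<integral>\<^sup>+ t. log_kernel 2 (ucis s) (ucis t) \<partial>circ) = (\<integral>\<^sup>+ t. log_kernel 2 (ucis t) (ucis s) \<partial>circ)"
        by (intro nn_integral_cong) (auto simp: log_kernel_def norm_minus_commute)
      thus "(\<integral>\<^sup>+ t. log_kernel 2 (ucis s) (ucis t) \<partial>circ) \<le> ennreal (2 * ln 2)" using unit_circle_log_kernel by simp
    qed
    also have "\<dots> < \<infinity>" by (simp add: circ.emeasure_space_1)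
    finally show "(\<integral>\<^sup>+ p. log_kernel 2 (ucis (fst p)) (ucis (snd p)) \<partial>(circ \<Otimes>\<^sub>M circ)) < \<infinity>" .
  qed (use ne in auto)
qed

text \<open>Orthogonality: the conjugate frequency of the first factor meets only
  \<open>b * ucis t\<close>, and each power \<open>ucis t ^ n\<close> only its own
  conjugate.\<close>

lemma trig_pairing:
  fixes A B :: "nat \<Rightarrow> complex"
  shows "(\<integral>t. (a * cnj (ucis t) + (\<Sum>n=1..N. A n * ucis t ^ n)) * (b * ucis t + (\<Sum>n=1..N. B n * cnj (ucis t) ^ n)) \<partial>circ)
     = a * b + (\<Sum>n=1..N. A n * B n)"
proof -
  have int: "integrable circ (\<lambda>t. c * (ucis t ^ m * cnj (ucis t) ^ n))" for c :: complex and m n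
    by (intro circ_integrable_continuous continuous_intros)
  have e1: "(\<integral>t. c * (ucis t ^ m * cnj (ucis t) ^ n) \<partial>circ) = (if m = n then c else 0)" for c :: complex and m n
    by (simp add: ucis_orthogonal)
  have "(\<lambda>t. (a * cnj (ucis t) + (\<Sum>n=1..N. A n * ucis t ^ n)) * (b * ucis t + (\<Sum>n=1..N. B n * cnj (ucis t) ^ n)))
     = (\<lambda>t. a * b * (ucis t ^ 1 * cnj (ucis t) ^ 1) + (\<Sum>n=1..N. a * B n * (ucis t ^ 0 * cnj (ucis t) ^ (Suc n)))
        + (\<Sum>n=1..N. A n * b * (ucis t ^ (Suc n) * cnj (ucis t) ^ 0))
        + (\<Sum>n=1..N. \<Sum>m=1..N. A n * B m * (ucis t ^ n * cnj (ucis t) ^ m)))"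
    by (rule ext) (simp add: distrib_left distrib_right sum_distrib_left sum_distrib_right sum_product mult_ac del: ucis_cnj ucis_power_cnj,
      subst sum.swap, simp add: mult_ac del: ucis_cnj ucis_power_cnj)
  hence "(\<integral>t. (a * cnj (ucis t) + (\<Sum>n=1..N. A n * ucis t ^ n)) * (b * ucis t + (\<Sum>n=1..N. B n * cnj (ucis t) ^ n)) \<partial>circ)
     = a * b + (\<Sum>n=1..N. 0) + (\<Sum>n=1..N. 0) + (\<Sum>n=1..N. \<Sum>m=1..N. if n = m then A n * B m else 0)"
    by (simp only:, subst Bochner_Integration.integral_add, (intro Bochner_Integration.integrable_add Bochner_Integration.integrable_sum int)+)
       (subst Bochner_Integration.integral_add, (intro Bochner_Integration.integrable_add Bochner_Integration.integrable_sum int)+,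
        subst Bochner_Integration.integral_add, (intro Bochner_Integration.integrable_add Bochner_Integration.integrable_sum int)+,
        simp only: Bochner_Integration.integral_sum Bochner_Integration.integrable_sum int e1, simp)
  also have "(\<Sum>n=1..N. \<Sum>m=1..N. if n = m then A n * B m else 0) = (\<Sum>n=1..N. A n * B n)"
    by (intro sum.cong refl) (simp add: sum.delta)
  finally show ?thesis by simp
qed

text \<open>The logarithmic energy of the density \<open>q = - cnj u + \<Sum>n. n c\<^sub>n u\<^sup>n\<close> (up to powers of \<open>r\<close>) on the
  image of the circle of radius \<open>r\<close> is nonnegative. The part of the kernel that depends on \<open>h\<close> is the
  real part of a function \<open>L\<close> holomorphic in both variables, and it pairs the antiholomorphic half of \<open>q\<close> only
  with the coefficients of \<open>h\<close>.\<close>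
lemma area_theorem_radius:
  assumes h: "h holomorphic_on ball 0 1" and inj: "inj_on (\<lambda>u. 1 / u + h u) (ball 0 1 - {0})"
    and r: "0 < r" "r < 1"
  defines "c \<equiv> \<lambda>n. (deriv ^^ n) h 0 / fact n"
  shows "(r - 1 / 2) * (\<Sum>n=1..N. of_nat n * r ^ (2 * n) * (cmod (c n))\<^sup>2) \<le> 1 / 2"
proof -
  obtain L :: "complex \<Rightarrow> complex \<Rightarrow> complex"
  where L: "continuous_on (ball 0 1 \<times> ball 0 1) (\<lambda>(u, v). L u v)"
    "\<And>u. u \<in> ball 0 1 \<Longrightarrow> L u holomorphic_on ball 0 1"
    "\<And>v. v \<in> ball 0 1 \<Longrightarrow> (\<lambda>u. L u v) holomorphic_on ball 0 1"
    "\<And>u. u \<in> ball 0 1 \<Longrightarrow> deriv (L u) 0 = - (h u - h 0)"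
    "\<And>v. v \<in> ball 0 1 \<Longrightarrow> deriv (\<lambda>u. L u v) 0 = - (h v - h 0)"
    "\<And>u v. u \<in> ball 0 1 \<Longrightarrow> v \<in> ball 0 1 \<Longrightarrow> u \<noteq> v \<Longrightarrow> exp (L u v) = 1 - u * v * ((h u - h v) / (u - v))"
    using log_divided_difference[OF h inj] by blast
  define P where "P = circ \<Otimes>\<^sub>M circ"
  have setsP [measurable_cong]: "sets P = sets (borel \<Otimes>\<^sub>M borel)"
    unfolding P_def by (intro sets_pair_measure_cong) simp_all
  interpret P: prob_space P unfolding P_def by (intro prob_space_pair circ.prob_space_axioms)
  define u where "u t = of_real r * ucis t" for t
  have u: "u t \<in> ball 0 1" "u t \<noteq> 0" "u t \<in> cball 0 r" for t using r by (auto simp: u_def norm_mult)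
  have uc [continuous_intros]: "continuous_on A f \<Longrightarrow> continuous_on A (\<lambda>x. u (f x))" for A and f :: "'x::topological_space \<Rightarrow> real"
    unfolding u_def by (intro continuous_intros)
  define Z where "Z t = 1 / u t + h (u t)" for t
  \<comment> \<open>At r = 1 this choice maximises Re (cnj y c) - |y|^2 / (2 n) for each n, the gain
    from the \<open>L\<close> part against the cost in circle energy; for r < 1 it is off by a power
    of \<open>r\<close> that disappears in the limit.\<close>
  define y where "y n = of_nat n * of_real r ^ n * c n" for n
  define q where "q t = - cnj (ucis t) + (\<Sum>n=1..N. y n * ucis t ^ n)" for t
  have qc [continuous_intros]: "continuous_on A f \<Longrightarrow> continuous_on A (\<lambda>x. q (f x))" for A and f :: "'x::topological_space \<Rightarrow> real"
    unfolding q_def by (intro continuous_intros)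
  have [measurable]: "q \<in> borel_measurable borel" by (intro borel_measurable_continuous_onI continuous_intros)
  have cnjq: "cnj (q t) = (-1) * ucis t + (\<Sum>n=1..N. cnj (y n) * cnj (ucis t) ^ n)" for t by (simp add: q_def)
  have hb: "continuous_on (cball 0 r) F" "F holomorphic_on ball 0 r" if "F holomorphic_on ball 0 1" for F
    using r that by (auto intro!: holomorphic_on_imp_continuous_on holomorphic_on_subset[OF that])
  have int: "integrable circ (\<lambda>t. F (u t) * G t)" if "F holomorphic_on ball 0 1" "continuous_on UNIV G" for F G :: "_ \<Rightarrow> complex"
    unfolding u_def using r that by (intro circ_integrable_continuous continuous_intros continuous_on_circle_compose hb(1)) auto
  \<comment> \<open>The positive frequencies of \<open>q\<close> annihilate a holomorphic factor.
    Only \<open>- cnj (ucis t)\<close> survives, and it picks the first Taylor coefficient.\<close>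
  have Fq: "(\<integral>t. F (u t) * q t \<partial>circ) = - (of_real r * deriv F 0)" if F: "F holomorphic_on ball 0 1" for F
  proof -
    have "(\<integral>t. F (u t) * q t \<partial>circ) = (\<integral>t. - (F (u t) * cnj (ucis t) ^ 1) + (\<Sum>n=1..N. y n * (F (u t) * ucis t ^ n)) \<partial>circ)"
      by (intro Bochner_Integration.integral_cong) (auto simp: q_def algebra_simps sum_distrib_left)
    also have "\<dots> = - (\<integral>t. F (u t) * cnj (ucis t) ^ 1 \<partial>circ) + (\<Sum>n=1..N. y n * (\<integral>t. F (u t) * ucis t ^ n \<partial>circ))"
      by (subst Bochner_Integration.integral_add)
         (auto intro!: Bochner_Integration.integrable_sum integrable_mult_right integrable_minus int[OF F] continuous_intros
            simp: Bochner_Integration.integral_sum int[OF F] continuous_intros simp del: power_one_right)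
    also have "\<dots> = - (of_real r * deriv F 0)"
      unfolding u_def fourier_coeff[OF hb[OF F] r(1)] using fourier_coeff_neg[OF hb[OF F] r(1)] by simp
    finally show ?thesis .
  qed
  have Fq': "(\<integral>t. F (u t) * cnj (q t) \<partial>circ) = (\<Sum>n=1..N. cnj (y n) * ((deriv ^^ n) F 0 / fact n * of_real r ^ n))"
    if F: "F holomorphic_on ball 0 1" for F
  proof -
    have "(\<integral>t. F (u t) * cnj (q t) \<partial>circ) = (\<integral>t. - (F (u t) * ucis t ^ 1) + (\<Sum>n=1..N. cnj (y n) * (F (u t) * cnj (ucis t) ^ n)) \<partial>circ)"
      by (intro Bochner_Integration.integral_cong) (auto simp: q_def algebra_simps sum_distrib_left)
    also have "\<dots> = - (\<integral>t. F (u t) * ucis t ^ 1 \<partial>circ) + (\<Sum>n=1..N. cnj (y n) * (\<integral>t. F (u t) * cnj (ucis t) ^ n \<partial>circ))"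
      by (subst Bochner_Integration.integral_add)
         (auto intro!: Bochner_Integration.integrable_sum integrable_mult_right integrable_minus int[OF F] continuous_intros
            simp: Bochner_Integration.integral_sum int[OF F] continuous_intros simp del: power_one_right)
    also have "\<dots> = (\<Sum>n=1..N. cnj (y n) * ((deriv ^^ n) F 0 / fact n * of_real r ^ n))"
      unfolding u_def fourier_coeff[OF hb[OF F] r(1)] using fourier_coeff_neg[OF hb[OF F] r(1), of 1] by simp
    finally show ?thesis .
  qed
  have q0: "(\<integral>t. q t \<partial>circ) = 0" using Fq[of "\<lambda>_. 1"] by simp
  have q0': "(\<integral>t. cnj (q t) \<partial>circ) = 0" using q0 by simp
  define \<Sigma> where "\<Sigma> = (\<Sum>n=1..N. of_nat n * r ^ (2 * n) * (cmod (c n))\<^sup>2)"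
  have trm: "cnj (y n) * (c n * of_real r ^ n) = of_real (of_nat n * r ^ (2 * n) * (cmod (c n))\<^sup>2)" for n
  proof -
    have "cnj (y n) * (c n * of_real r ^ n) = of_nat n * (of_real r ^ n * of_real r ^ n) * (c n * cnj (c n))"
      by (simp add: y_def mult_ac)
    also have "\<dots> = of_nat n * of_real r ^ (2 * n) * of_real ((cmod (c n))\<^sup>2)"
      unfolding complex_norm_square by (simp flip: power_add add: mult_2)
    finally show ?thesis by simp
  qed
  have hu: "continuous_on UNIV (\<lambda>t. h (u t))"
    unfolding u_def using r by (intro continuous_on_circle_compose hb(1)[OF h]) auto
  have hq: "(\<integral>t. (h (u t) - h 0) * cnj (q t) \<partial>circ) = of_real \<Sigma>"
  proof -
    have "(\<integral>t. (h (u t) - h 0) * cnj (q t) \<partial>circ) = (\<integral>t. h (u t) * cnj (q t) - h 0 * cnj (q t) \<partial>circ)"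
      by (simp add: algebra_simps)
    also have "\<dots> = (\<integral>t. h (u t) * cnj (q t) \<partial>circ) - h 0 * (\<integral>t. cnj (q t) \<partial>circ)"
      by (subst Bochner_Integration.integral_diff)
         (auto intro!: continuous_intros circ_integrable_continuous hu)
    also have "\<dots> = of_real \<Sigma>"
      unfolding q0' Fq'[OF h] c_def[symmetric] using trm by (simp add: \<Sigma>_def c_def)
    finally show ?thesis .
  qed
  obtain B where B: "\<And>t. cmod (q t) \<le> B"
  proof
    fix t show "cmod (q t) \<le> 1 + (\<Sum>n=1..N. cmod (y n))"
      unfolding q_def by (rule order_trans[OF norm_triangle_ineq] add_mono order_trans[OF norm_sum] sum_mono | simp add: norm_mult norm_power)+
  qed
  have Lc: "continuous_on UNIV (\<lambda>p. L (u (fst p)) (u (snd p)))"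
  proof -
    have "continuous_on UNIV (\<lambda>p. (u (fst p), u (snd p)))" by (intro continuous_intros)
    moreover have "range (\<lambda>p. (u (fst p), u (snd p))) \<subseteq> ball 0 1 \<times> ball 0 1"
      using u(1) by (auto simp del: mem_ball)
    ultimately show ?thesis using continuous_on_compose2[OF L(1)] by fastforce
  qed
  have Lm [measurable]: "(\<lambda>p. L (u (fst p)) (u (snd p))) \<in> borel_measurable (borel \<Otimes>\<^sub>M borel)"
    using borel_measurable_continuous_onI[OF Lc] by (simp add: borel_prod)
  obtain BL where BL: "\<And>s t. cmod (L (u s) (u t)) \<le> BL"
  proof -
    have "compact ((\<lambda>(u, v). L u v) ` (cball 0 r \<times> cball 0 r))"
      using r by (intro compact_continuous_image continuous_on_subset[OF L(1)] compact_Times) auto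
    then obtain K where "\<And>z. z \<in> (\<lambda>(u, v). L u v) ` (cball 0 r \<times> cball 0 r) \<Longrightarrow> cmod z \<le> K"
      by (metis bounded_iff compact_imp_bounded)
    moreover have "L (u s) (u t) \<in> (\<lambda>(u, v). L u v) ` (cball 0 r \<times> cball 0 r)" for s t
      by (rule image_eqI[of _ _ "(u s, u t)"]) (use u(3) in auto)
    ultimately show ?thesis by (intro that[of K]) auto
  qed
  have intL: "integrable P (\<lambda>p. L (u (fst p)) (u (snd p)) * (f (fst p) * g (snd p)))"
    if [measurable]: "f \<in> borel_measurable borel" "g \<in> borel_measurable borel" and "\<And>t. cmod (f t) \<le> B" "\<And>t. cmod (g t) \<le> B" for f g
  proof (rule P.integrable_const_bound[where B = "BL * (B * B)"])
    have "BL \<ge> 0" "B \<ge> 0" using BL[of 0 0] B[of 0] norm_ge_zero order_trans by blast+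
    thus "AE p in P. norm (L (u (fst p)) (u (snd p)) * (f (fst p) * g (snd p))) \<le> BL * (B * B)"
      using that BL by (intro AE_I2) (auto simp: norm_mult intro!: mult_mono)
  qed measurable
  have intLq: "integrable P (\<lambda>p. L (u (fst p)) (u (snd p)) * (q (fst p) * cnj (q (snd p))))"
    "integrable P (\<lambda>p. L (u (fst p)) (u (snd p)) * (cnj (q (fst p)) * q (snd p)))"
    using B by (auto intro!: intL)
  \<comment> \<open>Pairing the first variable with \<open>q\<close> leaves r (h - h 0), because
    \<open>L\<close> has derivative -(h - h 0) at 0; pairing the second with \<open>cnj q\<close>
    then leaves r \<Sigma>.\<close>
  have Phi1: "(\<integral>p. L (u (fst p)) (u (snd p)) * (q (fst p) * cnj (q (snd p))) \<partial>P) = of_real (r * \<Sigma>)"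
  proof -
    have "(\<integral>p. L (u (fst p)) (u (snd p)) * (q (fst p) * cnj (q (snd p))) \<partial>P)
       = (\<integral>t. \<integral>s. L (u s) (u t) * (q s * cnj (q t)) \<partial>circ \<partial>circ)"
      using circ2.integral_snd[of "\<lambda>s t. L (u s) (u t) * (q s * cnj (q t))"] intLq by (simp add: P_def case_prod_unfold)
    also have "\<dots> = (\<integral>t. of_real r * ((h (u t) - h 0) * cnj (q t)) \<partial>circ)"
    proof (intro Bochner_Integration.integral_cong refl)
      fix t
      have "(\<integral>s. L (u s) (u t) * (q s * cnj (q t)) \<partial>circ) = (\<integral>s. L (u s) (u t) * q s \<partial>circ) * cnj (q t)"
        by (simp only: mult.assoc[symmetric]) simp
      moreover have "(\<integral>s. L (u s) (u t) * q s \<partial>circ) = of_real r * (h (u t) - h 0)"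
        unfolding Fq[OF L(3)[OF u(1)[of t]]] L(5)[OF u(1)[of t]] by (simp add: right_diff_distrib)
      ultimately show "(\<integral>s. L (u s) (u t) * (q s * cnj (q t)) \<partial>circ) = of_real r * ((h (u t) - h 0) * cnj (q t))"
        by (simp only: mult.assoc)
    qed
    also have "\<dots> = of_real (r * \<Sigma>)" using hq by simp
    finally show ?thesis .
  qed
  have Phi2: "(\<integral>p. L (u (fst p)) (u (snd p)) * (cnj (q (fst p)) * q (snd p)) \<partial>P) = of_real (r * \<Sigma>)"
  proof -
    have "(\<integral>p. L (u (fst p)) (u (snd p)) * (cnj (q (fst p)) * q (snd p)) \<partial>P)
       = (\<integral>s. \<integral>t. L (u s) (u t) * (cnj (q s) * q t) \<partial>circ \<partial>circ)"
      using circ2.integral_fst'[of "\<lambda>p. L (u (fst p)) (u (snd p)) * (cnj (q (fst p)) * q (snd p))"] intLq by (simp add: P_def)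
    also have "\<dots> = (\<integral>s. of_real r * ((h (u s) - h 0) * cnj (q s)) \<partial>circ)"
    proof (intro Bochner_Integration.integral_cong refl)
      fix s
      have "(\<integral>t. L (u s) (u t) * (cnj (q s) * q t) \<partial>circ) = cnj (q s) * (\<integral>t. L (u s) (u t) * q t \<partial>circ)"
        by (simp only: mult.left_commute[of _ "cnj (q s)"]) simp
      moreover have "(\<integral>t. L (u s) (u t) * q t \<partial>circ) = of_real r * (h (u s) - h 0)"
        unfolding Fq[OF L(2)[OF u(1)[of s]]] L(4)[OF u(1)[of s]] by (simp add: right_diff_distrib)
      ultimately show "(\<integral>t. L (u s) (u t) * (cnj (q s) * q t) \<partial>circ) = of_real r * ((h (u s) - h 0) * cnj (q s))"
        by (simp only: mult_ac)
    qed
    also have "\<dots> = of_real (r * \<Sigma>)" using hq by simp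
    finally show ?thesis .
  qed
  \<comment> \<open>Re L is half of L plus its conjugate, and conjugation exchanges \<open>q\<close>
    and \<open>cnj q\<close>, so both halves contribute the same real number.\<close>
  have ReL: "(\<integral>p. of_real (Re (L (u (fst p)) (u (snd p)))) * (q (fst p) * cnj (q (snd p))) \<partial>P) = of_real (r * \<Sigma>)"
  proof -
    have "(\<integral>p. of_real (Re (L (u (fst p)) (u (snd p)))) * (q (fst p) * cnj (q (snd p))) \<partial>P)
       = (\<integral>p. (L (u (fst p)) (u (snd p)) * (q (fst p) * cnj (q (snd p)))
             + cnj (L (u (fst p)) (u (snd p)) * (cnj (q (fst p)) * q (snd p)))) / 2 \<partial>P)"
    proof (intro Bochner_Integration.integral_cong refl)
      fix p
      have "of_real (Re z) * w = (z * w + cnj z * w) / 2" for z w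
      proof -
        have "of_real (Re z) = (z + cnj z) / 2" by (simp add: complex_add_cnj)
        thus ?thesis by (simp only: distrib_right[symmetric] times_divide_eq_left)
      qed
      moreover have "cnj (L (u (fst p)) (u (snd p)) * (cnj (q (fst p)) * q (snd p)))
         = cnj (L (u (fst p)) (u (snd p))) * (q (fst p) * cnj (q (snd p)))" by simp
      ultimately show "of_real (Re (L (u (fst p)) (u (snd p)))) * (q (fst p) * cnj (q (snd p)))
        = (L (u (fst p)) (u (snd p)) * (q (fst p) * cnj (q (snd p)))
             + cnj (L (u (fst p)) (u (snd p)) * (cnj (q (fst p)) * q (snd p)))) / 2"
        by (simp only:)
    qed
    also have "\<dots> = ((\<integral>p. L (u (fst p)) (u (snd p)) * (q (fst p) * cnj (q (snd p))) \<partial>P)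
        + cnj (\<integral>p. L (u (fst p)) (u (snd p)) * (cnj (q (fst p)) * q (snd p)) \<partial>P)) / 2"
      unfolding Bochner_Integration.integral_cnj[symmetric] integral_divide_zero
      using intLq by (subst Bochner_Integration.integral_add) (auto simp only: integrable_cnj)
    finally show ?thesis unfolding Phi1 Phi2 by simp
  qed
  define l where "l p = ln (cmod (ucis (fst p) - ucis (snd p)))" for p
  have lint: "integrable P l" unfolding l_def[abs_def] P_def by (rule integrable_ln_ucis_pair)
  have lq_int: "integrable P (\<lambda>p. of_real (l p) * (q (fst p) * cnj (q (snd p))))"
  proof (rule Bochner_Integration.integrable_bound)
    show "integrable P (\<lambda>p. B * B * l p)" using lint by simp
    have "B \<ge> 0" using B[of 0] norm_ge_zero order_trans by blast
    show "AE p in P. norm (of_real (l p) * (q (fst p) * cnj (q (snd p)))) \<le> norm (B * B * l p)"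
    proof (intro AE_I2)
      fix p
      have "cmod (q (fst p)) * cmod (q (snd p)) \<le> B * B" using B \<open>B \<ge> 0\<close> by (intro mult_mono) auto
      hence "\<bar>l p\<bar> * (cmod (q (fst p)) * cmod (q (snd p))) \<le> \<bar>l p\<bar> * (B * B)" by (intro mult_left_mono) auto
      thus "norm (of_real (l p) * (q (fst p) * cnj (q (snd p)))) \<le> norm (B * B * l p)"
        using \<open>B \<ge> 0\<close> by (simp add: norm_mult abs_mult mult_ac)
    qed
  qed (unfold l_def[abs_def], measurable)
  \<comment> \<open>Integration against the logarithm of the distance on the circle multiplies the
    frequencies n and -n by -1 / (2 n).\<close>
  have Nt: "(\<integral>s. of_real (ln (cmod (ucis s - w))) * q s \<partial>circ) = (1 / 2) * cnj w + (\<Sum>n=1..N. - (y n / (2 * of_nat n)) * w ^ n)"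
    if w: "cmod w = 1" for w
  proof -
    have li: "integrable circ (\<lambda>s. of_real (ln (cmod (ucis s - w))) * f s)" if "\<And>s. cmod (f s) \<le> 1" and [measurable]: "f \<in> borel_measurable borel" for f
    proof (rule Bochner_Integration.integrable_bound[OF unit_circle_log_fourier(1)[OF w]])
      show "AE s in circ. norm (of_real (ln (cmod (ucis s - w))) * f s) \<le> norm (ln (cmod (ucis s - w)))"
        using that by (intro AE_I2) (auto simp: norm_mult mult_left_le)
    qed measurable
    have i1: "integrable circ (\<lambda>s. of_real (ln (cmod (ucis s - w))) * cnj (ucis s) ^ 1)"
      by (intro li) (auto simp: norm_power simp del: power_one_right)
    have i2: "integrable circ (\<lambda>s. of_real (ln (cmod (ucis s - w))) * ucis s ^ n)" for n
      by (intro li) (auto simp: norm_power)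
    have "(\<integral>s. of_real (ln (cmod (ucis s - w))) * q s \<partial>circ)
       = (\<integral>s. - (of_real (ln (cmod (ucis s - w))) * cnj (ucis s) ^ 1) + (\<Sum>n=1..N. y n * (of_real (ln (cmod (ucis s - w))) * ucis s ^ n)) \<partial>circ)"
      by (intro Bochner_Integration.integral_cong) (auto simp: q_def algebra_simps sum_distrib_left)
    also have "\<dots> = - (\<integral>s. of_real (ln (cmod (ucis s - w))) * cnj (ucis s) ^ 1 \<partial>circ)
        + (\<Sum>n=1..N. y n * (\<integral>s. of_real (ln (cmod (ucis s - w))) * ucis s ^ n \<partial>circ))"
      by (subst Bochner_Integration.integral_add)
         (auto intro!: Bochner_Integration.integrable_sum integrable_mult_right integrable_minus i1 i1[unfolded power_one_right] i2
            simp: Bochner_Integration.integral_sum i2 simp del: power_one_right)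
    also have "\<dots> = (1 / 2) * cnj w + (\<Sum>n=1..N. - (y n / (2 * of_nat n)) * w ^ n)"
      using unit_circle_log_fourier(2,3)[OF w] by (subst unit_circle_log_fourier(3)[OF w]) (auto intro!: sum.cong)
    finally show ?thesis .
  qed
  have lq: "(\<integral>p. of_real (l p) * (q (fst p) * cnj (q (snd p))) \<partial>P) = of_real (- (1 + \<Sigma>) / 2)"
  proof -
    have "(\<integral>p. of_real (l p) * (q (fst p) * cnj (q (snd p))) \<partial>P)
       = (\<integral>t. \<integral>s. of_real (l (s, t)) * (q s * cnj (q t)) \<partial>circ \<partial>circ)"
      using circ2.integral_snd[of "\<lambda>s t. of_real (l (s, t)) * (q s * cnj (q t))"] lq_int by (simp add: P_def case_prod_unfold)
    also have "\<dots> = (\<integral>t. ((1 / 2) * cnj (ucis t) + (\<Sum>n=1..N. - (y n / (2 * of_nat n)) * ucis t ^ n)) *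
          ((-1) * ucis t + (\<Sum>n=1..N. cnj (y n) * cnj (ucis t) ^ n)) \<partial>circ)"
    proof (intro Bochner_Integration.integral_cong refl)
      fix t
      have "(\<integral>s. of_real (l (s, t)) * (q s * cnj (q t)) \<partial>circ) = (\<integral>s. of_real (ln (cmod (ucis s - ucis t))) * q s \<partial>circ) * cnj (q t)"
        by (simp only: mult.assoc[symmetric] l_def fst_conv snd_conv) simp
      thus "(\<integral>s. of_real (l (s, t)) * (q s * cnj (q t)) \<partial>circ) = ((1 / 2) * cnj (ucis t) + (\<Sum>n=1..N. - (y n / (2 * of_nat n)) * ucis t ^ n)) *
          ((-1) * ucis t + (\<Sum>n=1..N. cnj (y n) * cnj (ucis t) ^ n))"
        using Nt[of "ucis t"] unfolding cnjq by simp
    qed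
    also have "\<dots> = (1 / 2) * (-1) + (\<Sum>n=1..N. - (y n / (2 * of_nat n)) * cnj (y n))"
      by (rule trig_pairing)
    also have "(\<Sum>n=1..N. - (y n / (2 * of_nat n)) * cnj (y n)) = (\<Sum>n=1..N. of_real (- (of_nat n * r ^ (2 * n) * (cmod (c n))\<^sup>2) / 2))"
    proof (intro sum.cong refl)
      fix n assume "n \<in> {1..N}"
      hence n: "of_nat n \<noteq> (0::complex)" by simp
      have "- (y n / (2 * of_nat n)) * cnj (y n) = - (cnj (y n) * (c n * of_real r ^ n)) / 2"
        using n by (simp add: y_def field_simps)
      thus "- (y n / (2 * of_nat n)) * cnj (y n) = of_real (- (of_nat n * r ^ (2 * n) * (cmod (c n))\<^sup>2) / 2)"
        unfolding trm by simp
    qed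
    also have "(1 / 2) * (-1) + (\<Sum>n=1..N. of_real (- (of_nat n * r ^ (2 * n) * (cmod (c n))\<^sup>2) / 2)) = complex_of_real (- (1 + \<Sigma>) / 2)"
      by (simp add: \<Sigma>_def sum_negf sum_divide_distrib[symmetric] add_divide_distrib diff_divide_distrib)
    finally show ?thesis .
  qed
  have qq_int: "integrable P (\<lambda>p. q (fst p) * cnj (q (snd p)))"
  proof (rule P.integrable_const_bound[where B = "B * B"])
    have "B \<ge> 0" using B[of 0] norm_ge_zero order_trans by blast
    thus "AE p in P. norm (q (fst p) * cnj (q (snd p))) \<le> B * B"
      using B by (intro AE_I2) (auto simp: norm_mult intro!: mult_mono)
  qed measurable
  have qq: "(\<integral>p. q (fst p) * cnj (q (snd p)) \<partial>P) = 0"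
    using circ2.integral_fst'[of "\<lambda>p. q (fst p) * cnj (q (snd p))"] qq_int q0' by (simp add: P_def)
  \<comment> \<open>Here \<open>Z s - Z t\<close> factors through the parameters, so the logarithm
    of its modulus is the circle kernel plus a constant plus Re L. The constant does not contribute,
    as \<open>q\<close> has mean zero.\<close>
  have ZZ: "Z s - Z t = (u t - u s) / (u s * u t) * exp (L (u s) (u t))" if "ucis s \<noteq> ucis t" for s t
  proof -
    have uu: "u s \<noteq> u t" using that r by (simp add: u_def)
    hence "exp (L (u s) (u t)) = 1 - u s * u t * ((h (u s) - h (u t)) / (u s - u t))" using u by (intro L(6))
    thus ?thesis using uu u(2)[of s] u(2)[of t] unfolding Z_def by (simp add: field_simps)
  qed
  have lnZ: "ln (cmod (Z s - Z t)) = l (s, t) - ln r + Re (L (u s) (u t))" if "ucis s \<noteq> ucis t" for s t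
  proof -
    have "cmod (Z s - Z t) = cmod (ucis s - ucis t) / r * exp (Re (L (u s) (u t)))"
    proof -
      have "cmod (u t - u s) = r * cmod (ucis s - ucis t)"
        using r by (simp add: u_def norm_mult norm_minus_commute flip: right_diff_distrib)
      moreover have "cmod (u s * u t) = r * r" using r by (simp add: u_def norm_mult)
      ultimately show ?thesis unfolding ZZ[OF that] using r by (simp add: norm_mult norm_divide)
    qed
    thus ?thesis using that r by (simp add: ln_mult ln_div l_def)
  qed
  have AEneq: "AE p in P. ucis (fst p) \<noteq> ucis (snd p)" unfolding P_def by (rule AE_ucis_pair_neq)
  have Zc: "continuous_on UNIV Z" unfolding Z_def[abs_def]
    using u by (intro continuous_intros continuous_on_compose2[OF holomorphic_on_imp_continuous_on[OF h]]) auto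
  have [measurable]: "Z \<in> borel_measurable borel" using Zc by (rule borel_measurable_continuous_onI)
  obtain BZ where BZ: "\<And>t. cmod (Z t) \<le> BZ"
  proof -
    have "compact ((\<lambda>w. 1 / w + h w) ` sphere 0 r)"
      using r by (intro compact_continuous_image continuous_intros holomorphic_on_imp_continuous_on holomorphic_on_subset[OF h]) auto
    then obtain K where "\<And>z. z \<in> (\<lambda>w. 1 / w + h w) ` sphere 0 r \<Longrightarrow> cmod z \<le> K"
      by (metis bounded_iff compact_imp_bounded)
    moreover have "u t \<in> sphere 0 r" for t using r by (simp add: u_def norm_mult)
    ultimately show ?thesis by (intro that[of K]) (auto simp: Z_def)
  qed
  have main: "Re (\<integral>p. of_real (ln (cmod (Z (fst p) - Z (snd p)))) * (q (fst p) * cnj (q (snd p))) \<partial>P) \<le> 0"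
    unfolding P_def
  proof (rule curve_energy_nonpos(1)[OF Zc _ _ _ _ _ B q0])
    show "cmod (Z s - Z t) \<le> 2 * \<bar>BZ\<bar> + 1" for s t
      using norm_triangle_ineq4[of "Z s" "Z t"] BZ[of s] BZ[of t] by linarith
    show "AE p in circ \<Otimes>\<^sub>M circ. Z (fst p) \<noteq> Z (snd p)"
      using AE_ucis_pair_neq
    proof eventually_elim
      case (elim p)
      have "u (fst p) \<noteq> u (snd p)" using elim r by (simp add: u_def)
      thus ?case using ZZ[OF elim] u by auto
    qed
    have i: "integrable P (\<lambda>p. l p - ln r + Re (L (u (fst p)) (u (snd p))))"
    proof (intro Bochner_Integration.integrable_add Bochner_Integration.integrable_diff lint integrable_Re)
      show "integrable P (\<lambda>p. L (u (fst p)) (u (snd p)))"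
        by (rule P.integrable_const_bound[where B = BL]) (use BL in auto)
    qed simp
    have ae: "AE p in P. l p - ln r + Re (L (u (fst p)) (u (snd p))) = ln (cmod (Z (fst p) - Z (snd p)))"
      using AEneq by eventually_elim (simp add: lnZ)
    have "integrable P (\<lambda>p. ln (cmod (Z (fst p) - Z (snd p))))"
      by (rule integrable_cong_AE_imp[OF i _ ae]) measurable
    thus "integrable (circ \<Otimes>\<^sub>M circ) (\<lambda>p. ln (cmod (Z (fst p) - Z (snd p))))" by (simp only: P_def)
    show "continuous_on UNIV q" by (intro continuous_intros)
  qed simp
  have "(\<integral>p. of_real (ln (cmod (Z (fst p) - Z (snd p)))) * (q (fst p) * cnj (q (snd p))) \<partial>P)
     = (\<integral>p. of_real (l p) * (q (fst p) * cnj (q (snd p))) - of_real (ln r) * (q (fst p) * cnj (q (snd p)))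
         + of_real (Re (L (u (fst p)) (u (snd p)))) * (q (fst p) * cnj (q (snd p))) \<partial>P)"
  proof (rule integral_cong_AE)
    show "AE p in P. of_real (ln (cmod (Z (fst p) - Z (snd p)))) * (q (fst p) * cnj (q (snd p)))
      = of_real (l p) * (q (fst p) * cnj (q (snd p))) - of_real (ln r) * (q (fst p) * cnj (q (snd p)))
         + of_real (Re (L (u (fst p)) (u (snd p)))) * (q (fst p) * cnj (q (snd p)))"
      using AEneq by eventually_elim (simp add: lnZ algebra_simps)
  qed (unfold l_def[abs_def], measurable)
  also have "\<dots> = of_real (- (1 + \<Sigma>) / 2) - of_real (ln r) * 0 + of_real (r * \<Sigma>)"
  proof -
    have "integrable P (\<lambda>p. of_real (Re (L (u (fst p)) (u (snd p)))) * (q (fst p) * cnj (q (snd p))))"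
    proof (rule Bochner_Integration.integrable_bound[OF intLq(1)])
      show "AE p in P. norm (of_real (Re (L (u (fst p)) (u (snd p)))) * (q (fst p) * cnj (q (snd p))))
         \<le> norm (L (u (fst p)) (u (snd p)) * (q (fst p) * cnj (q (snd p))))"
        by (intro AE_I2) (auto simp: norm_mult intro!: mult_right_mono abs_Re_le_cmod)
    qed measurable
    thus ?thesis unfolding lq[symmetric] ReL[symmetric] qq[symmetric]
      using lq_int qq_int by simp
  qed
  also have "\<dots> = complex_of_real (- (1 + \<Sigma>) / 2 + r * \<Sigma>)" by simp
  finally have "- (1 + \<Sigma>) / 2 + r * \<Sigma> \<le> 0" using main by (metis Re_complex_of_real)
  thus ?thesis unfolding \<Sigma>_def[symmetric] by (simp add: field_simps)
qed

text \<open>The sum is finite, so the radius can tend to 1 term by term; the factor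
  \<open>r - 1 / 2\<close> then meets the 1 / 2 of the right side, which gives the sharp
  constant.\<close>

theorem area_theorem:
  assumes h: "h holomorphic_on ball 0 1" and inj: "inj_on (\<lambda>u. 1 / u + h u) (ball 0 1 - {0})"
  shows "(\<Sum>n=1..N. of_nat n * (cmod ((deriv ^^ n) h 0 / fact n))\<^sup>2) \<le> 1"
proof -
  define c where "c n = (deriv ^^ n) h 0 / fact n" for n
  have "((\<lambda>r. (r - 1 / 2) * (\<Sum>n=1..N. of_nat n * r ^ (2 * n) * (cmod (c n))\<^sup>2)) \<longlongrightarrow>
          (1 - 1 / 2) * (\<Sum>n=1..N. of_nat n * 1 ^ (2 * n) * (cmod (c n))\<^sup>2)) (at_left (1::real))"
    by (intro tendsto_intros)
  moreover have "\<forall>\<^sub>F r in at_left (1::real). 0 < r \<and> r < 1"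
    by (rule eventually_at_leftI[of 0]) auto
  hence "\<forall>\<^sub>F r in at_left (1::real). (r - 1 / 2) * (\<Sum>n=1..N. of_nat n * r ^ (2 * n) * (cmod (c n))\<^sup>2) \<le> 1 / 2"
    unfolding c_def by eventually_elim (intro area_theorem_radius h inj; simp)
  ultimately have "(1 - 1 / 2) * (\<Sum>n=1..N. of_nat n * 1 ^ (2 * n) * (cmod (c n))\<^sup>2) \<le> 1 / 2"
    by (rule tendsto_upperbound) simp
  thus ?thesis by (simp add: c_def)
qed

section \<open>The exterior conformal map\<close>

lemma holomorphic_factor_zero:
  assumes g: "g holomorphic_on ball 0 1" "g 0 = (0 :: complex)"
  obtains k where "k holomorphic_on ball 0 1" "\<And>u. u \<in> ball 0 1 \<Longrightarrow> g u = u * k u"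
proof -
  obtain D where D: "\<And>u v. u \<in> ball 0 1 \<Longrightarrow> v \<in> ball 0 1 \<Longrightarrow> D u v * (u - v) = g u - g v"
    "\<And>v. v \<in> ball 0 1 \<Longrightarrow> (\<lambda>u. D u v) holomorphic_on ball 0 1"
    using divided_difference[OF g(1)] by metis
  show ?thesis by (rule that[of "\<lambda>u. D u 0"]) (use D(2)[of 0] D(1)[of _ 0] g(2) in \<open>auto simp: mult.commute\<close>)
qed

text \<open>Inversion about a point \<open>a\<close> of \<open>E\<close> turns the exterior together
  with infinity into the plane domain \<open>V\<close>. A bounded component of its complement would
  split \<open>E\<close> with its holes filled, against connectedness.\<close>

lemma inverted_exterior_simply_connected:
  fixes E :: "complex set"
  assumes E: "compact E" "connected E" and a: "a \<in> E"
  defines "V \<equiv> {w. w = 0 \<or> a + 1 / w \<in> outside E}"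
  shows "open V" and "simply_connected V"
proof -
  let ?\<Omega> = "outside E"
  have bE: "bounded E" "closed E" using E(1) compact_imp_bounded compact_imp_closed by auto
  have aO: "a \<notin> ?\<Omega>" using a outside_no_overlap by blast
  have opO: "open ?\<Omega>" using bE(2) by (rule open_outside)
  obtain R where R: "R > 0" "- ?\<Omega> \<subseteq> ball a R"
    using cobounded_outside[OF bE(1)] bounded_subset_ballD by blast
  have V0: "ball 0 (1 / R) \<subseteq> V"
  proof
    fix w :: complex assume w: "w \<in> ball 0 (1 / R)"
    show "w \<in> V"
    proof (cases "w = 0")
      case False
      hence "R < cmod (1 / w)" using w R by (simp add: norm_divide field_simps)
      hence "a + 1 / w \<notin> ball a R" by (simp add: dist_norm norm_minus_commute)
      thus ?thesis using R by (auto simp: V_def)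
    qed (simp add: V_def)
  qed
  define W where "W = (- {0}) \<inter> (\<lambda>w. a + 1 / w) -` ?\<Omega>"
  have opW: "open W" unfolding W_def
    by (intro continuous_open_preimage opO continuous_intros) auto
  have VW: "V = ball 0 (1 / R) \<union> W"
    using V0 R(1) by (auto simp: V_def W_def)
  show opV: "open V" unfolding VW using opW by auto
  have VW0: "V = insert 0 W" using aO by (auto simp: V_def W_def)
  have conV: "connected V"
  proof (rule connected_intermediate_closure)
    have "W = (\<lambda>z. 1 / (z - a)) ` ?\<Omega>"
    proof (intro equalityI subsetI)
      fix w assume "w \<in> W"
      thus "w \<in> (\<lambda>z. 1 / (z - a)) ` ?\<Omega>" by (intro image_eqI[of _ _ "a + 1 / w"]) (auto simp: W_def)
    next
      fix w assume "w \<in> (\<lambda>z. 1 / (z - a)) ` ?\<Omega>"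
      thus "w \<in> W" using aO by (auto simp: W_def)
    qed
    moreover have "connected ?\<Omega>" using bE(1) by (intro connected_outside) auto
    ultimately show "connected W"
      using aO by (auto intro!: connected_continuous_image continuous_intros)
    show "W \<subseteq> V" by (auto simp: VW0)
    have "0 \<in> closure W"
      unfolding closure_approachable
    proof (intro allI impI)
      fix e :: real assume e: "e > 0"
      define x where "x = min e (1 / R) / 2"
      have x: "0 < x" "x < e" "x < 1 / R" using e R by (auto simp: x_def min_def field_simps)
      have "of_real x \<in> V" using V0 x by (auto simp: subset_iff)
      hence "of_real x \<in> W" using x by (auto simp: VW0)
      thus "\<exists>y\<in>W. dist y 0 < e" using x by (intro bexI[of _ "of_real x"]) auto
    qed
    thus "V \<subseteq> closure W" unfolding VW0 using closure_subset by blast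
  qed
  have "\<not> bounded Cc" if Cc: "Cc \<in> components (- V)" for Cc
  proof
    assume bC: "bounded Cc"
    have clV: "closed (- V)" using opV by auto
    have "compact Cc" using bC closed_components[OF clV Cc] compact_eq_bounded_closed by blast
    \<comment> \<open>A component need not be relatively open. Sura-Bura encloses it in a compact
      relatively clopen set, which can be carried back through the inversion.\<close>
    then obtain K where K: "openin (top_of_set (- V)) K" "compact K" "Cc \<subseteq> K"
      using Sura_Bura_clopen_subset[OF closed_imp_locally_compact[OF clV] Cc, of UNIV] by auto
    obtain O' where O': "open O'" "K = - V \<inter> O'" using K(1) by (auto simp: openin_open)
    have Kne: "K \<noteq> {}" using K(3) in_components_nonempty[OF Cc] by auto
    have K0: "0 \<notin> K" using O'(2) by (auto simp: V_def)
    define T where "T = (\<lambda>w. a + 1 / w) ` K"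
    have T: "compact T" unfolding T_def using K0
      by (intro compact_continuous_image continuous_intros K(2)) auto
    let ?F = "- ?\<Omega>"
    \<comment> \<open>\<open>?F\<close> is \<open>E\<close> with its holes filled. The image of
      \<open>K\<close> is clopen in it, nonempty and misses \<open>a\<close>, which is the
      contradiction.\<close>
    have Fcon: "connected ?F" using connected_with_inside[OF bE(2) E(2)] by (simp add: union_with_inside)
    have TF: "T \<subseteq> ?F" using O'(2) by (auto simp: T_def V_def)
    have "T = ?F \<inter> ((- {a}) \<inter> (\<lambda>z. 1 / (z - a)) -` O')"
    proof (intro equalityI subsetI)
      fix z assume "z \<in> T"
      then obtain w where w: "w \<in> K" "z = a + 1 / w" by (auto simp: T_def)
      thus "z \<in> ?F \<inter> ((- {a}) \<inter> (\<lambda>z. 1 / (z - a)) -` O')" using K0 O'(2) TF \<open>z \<in> T\<close> by auto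
    next
      fix z assume z: "z \<in> ?F \<inter> ((- {a}) \<inter> (\<lambda>z. 1 / (z - a)) -` O')"
      hence "1 / (z - a) \<in> K" unfolding O'(2) by (auto simp: V_def)
      thus "z \<in> T" unfolding T_def by (intro image_eqI[of _ _ "1 / (z - a)"]) auto
    qed
    moreover have "open ((- {a}) \<inter> (\<lambda>z. 1 / (z - a)) -` O')"
      by (intro continuous_open_preimage O' continuous_intros) auto
    ultimately have "openin (top_of_set ?F) T" by (metis openin_open)
    moreover have "closedin (top_of_set ?F) T"
      using T TF compact_imp_closed closed_subset by blast
    ultimately have "T = {} \<or> T = ?F" using Fcon connected_clopen by blast
    moreover have "a \<notin> T" using K0 by (auto simp: T_def)
    ultimately show False using aO Kne by (auto simp: T_def)
  qed
  thus "simply_connected V" using conV opV by (simp add: simply_connected_eq_unbounded_complement_components)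
qed

text \<open>A Riemann map \<open>G\<close> of the disc onto the inverted exterior, with G 0 = 0, is
  inverted back: a + 1 / G has a simple pole at 0, and a rotation of the disc makes the residue
  positive. The second point \<open>b\<close> keeps the inverted exterior from being the whole
  plane.\<close>

lemma exterior_map:
  fixes E :: "complex set"
  assumes E: "compact E" "connected E" and ab: "a \<in> E" "b \<in> E" "a \<noteq> b"
  obtains C h B where "C > 0" "h holomorphic_on ball 0 1"
    "inj_on (\<lambda>u. 1 / u + h u) (ball 0 1 - {0})"
    "(\<lambda>u. of_real C * (1 / u + h u)) ` (ball 0 1 - {0}) = outside E"
    "\<And>u. 1 / 2 \<le> cmod u \<Longrightarrow> cmod u < 1 \<Longrightarrow> cmod (of_real C * (1 / u + h u)) \<le> B"
proof -
  define V where "V = {w. w = 0 \<or> a + 1 / w \<in> outside E}"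
  have V: "open V" "simply_connected V"
    unfolding V_def using inverted_exterior_simply_connected[OF E ab(1)] by auto
  have aO: "a \<notin> outside E" "b \<notin> outside E" using ab outside_no_overlap by blast+
  have "0 \<in> V" "1 / (b - a) \<notin> V" using ab aO by (auto simp: V_def)
  hence "V \<noteq> {}" "V \<noteq> UNIV" by auto
  then obtain f g where f: "f holomorphic_on V" "g holomorphic_on ball 0 1"
    "\<And>z. z \<in> V \<Longrightarrow> f z \<in> ball 0 1 \<and> g (f z) = z"
    "\<And>z. z \<in> ball 0 1 \<Longrightarrow> g z \<in> V \<and> f (g z) = z"
    using V Riemann_mapping_theorem[of V] by metis
  have "f 0 \<in> ball 0 1" using f(3)[OF \<open>0 \<in> V\<close>] by simp
  then obtain m mi where m: "m (f 0) = 0" "m holomorphic_on ball 0 1" "m ` ball 0 1 \<subseteq> ball 0 1"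
    "mi holomorphic_on ball 0 1" "mi ` ball 0 1 \<subseteq> ball 0 1"
    "\<And>z. z \<in> ball 0 1 \<Longrightarrow> m (mi z) = z" "\<And>z. z \<in> ball 0 1 \<Longrightarrow> mi (m z) = z"
    using ball_biholomorphism_exists by metis
  define G where "G = g \<circ> mi"
  have Gh: "G holomorphic_on ball 0 1" unfolding G_def
    using m(4,5) f(2) by (intro holomorphic_on_compose_gen) auto
  have Gim: "G ` ball 0 1 = V"
  proof (intro equalityI subsetI)
    fix w assume "w \<in> V"
    hence fw: "f w \<in> ball 0 1" "g (f w) = w" using f(3) by auto
    hence "m (f w) \<in> ball 0 1" using m(3) by blast
    moreover have "G (m (f w)) = w" using m(7)[OF fw(1)] fw(2) by (simp add: G_def)
    ultimately have "G (m (f w)) = w" "m (f w) \<in> ball 0 1" by auto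
    thus "w \<in> G ` ball 0 1" by (metis image_eqI)
  qed (use m(5) f(4) in \<open>auto simp: G_def simp del: mem_ball\<close>)
  have Ginj: "inj_on G (ball 0 1)"
  proof (rule inj_on_inverseI[of _ "m \<circ> f"])
    fix z :: complex assume z: "z \<in> ball 0 1"
    hence "mi z \<in> ball 0 1" using m(5) by blast
    thus "(m \<circ> f) (G z) = z" using f(4)[of "mi z"] m(6)[OF z] by (simp add: G_def)
  qed
  have "mi 0 = f 0" using m(1,7) \<open>f 0 \<in> ball 0 1\<close> by metis
  hence G0: "G 0 = 0" using f(3)[OF \<open>0 \<in> V\<close>] by (simp add: G_def)
  obtain k where k: "k holomorphic_on ball 0 1" "\<And>u. u \<in> ball 0 1 \<Longrightarrow> G u = u * k u"
    using holomorphic_factor_zero[OF Gh G0] by blast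
  have knz: "k u \<noteq> 0" if u: "u \<in> ball 0 1" for u
  proof (cases "u = 0")
    case True
    have "deriv G 0 \<noteq> 0" using Gh Ginj by (intro holomorphic_injective_imp_regular[of _ "ball 0 1"]) auto
    moreover have "(G has_field_derivative k 0) (at 0)"
    proof -
      have "((\<lambda>u. u * k u) has_field_derivative k 0) (at 0)"
        using holomorphic_derivI[OF k(1), of 0] by (auto intro!: derivative_eq_intros)
      thus ?thesis by (rule has_field_derivative_transform_within_open[of _ _ _ "ball 0 1"]) (auto simp: k(2))
    qed
    ultimately show ?thesis using True by (auto dest: DERIV_imp_deriv)
  next
    case False
    hence "G u \<noteq> G 0" using inj_onD[OF Ginj, of u 0] u by auto
    thus ?thesis using k(2)[OF u] G0 by auto
  qed
  \<comment> \<open>The residue of 1 / G at 0. Its modulus becomes \<open>C\<close>, its direction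
    the rotation \<open>\<omega>\<close>.\<close>
  define \<kappa> where "\<kappa> = 1 / k 0"
  define C where "C = cmod \<kappa>"
  define \<omega> where "\<omega> = \<kappa> / of_real C"
  have C: "C > 0" using knz[of 0] by (simp add: C_def \<kappa>_def)
  have \<omega>: "cmod \<omega> = 1" using C by (simp add: \<omega>_def norm_divide) (simp add: C_def)
  hence \<omega>0: "\<omega> \<noteq> 0" by auto
  have \<omega>b: "\<omega> * u \<in> ball 0 1 \<longleftrightarrow> u \<in> ball 0 1" for u using \<omega> by (simp add: norm_mult)
  define n where "n u = 1 / (\<omega> * k (\<omega> * u)) - of_real C" for u
  have "n holomorphic_on ball 0 1"
    unfolding n_def using \<omega>0 \<omega>b knz
    by (intro holomorphic_intros holomorphic_on_compose_gen[of "\<lambda>u. \<omega> * u" _ k "ball 0 1", unfolded comp_def] k(1)) auto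
  moreover have "n 0 = 0"
  proof -
    have "1 / (\<omega> * k 0) = \<kappa> / \<omega>" by (simp add: \<kappa>_def)
    also have "\<dots> = of_real C" using C \<omega>0 by (auto simp: \<omega>_def)
    finally show ?thesis by (simp add: n_def)
  qed
  ultimately obtain h1 where h1: "h1 holomorphic_on ball 0 1" "\<And>u. u \<in> ball 0 1 \<Longrightarrow> n u = u * h1 u"
    using holomorphic_factor_zero by blast
  define h where "h u = a / of_real C + h1 u / of_real C" for u
  have F: "of_real C * (1 / u + h u) = a + 1 / G (\<omega> * u)" if u: "u \<in> ball 0 1 - {0}" for u
  proof -
    have "1 / G (\<omega> * u) = (n u + of_real C) / u" using k(2)[of "\<omega> * u"] u \<omega>b[of u] by (simp add: n_def)
    also have "\<dots> = h1 u + of_real C / u" using h1(2)[of u] u by (simp add: add_divide_distrib)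
    finally show ?thesis using C by (simp add: h_def field_simps)
  qed
  have Gnz: "G (\<omega> * u) \<noteq> 0" if "u \<in> ball 0 1 - {0}" for u
    using k(2)[of "\<omega> * u"] knz[of "\<omega> * u"] that \<omega>b[of u] \<omega>0 by auto
  \<comment> \<open>\<open>G\<close> maps the disc of radius 1 / 2 onto a neighbourhood of 0, so by
    injectivity it stays away from 0 on the rest of the disc.\<close>
  have "\<exists>B. \<forall>u. 1 / 2 \<le> cmod u \<and> cmod u < 1 \<longrightarrow> cmod (of_real C * (1 / u + h u)) \<le> B"
  proof -
    have "open (G ` ball 0 (1 / 2))"
      by (rule open_mapping_thm3) (auto intro: holomorphic_on_subset[OF Gh] inj_on_subset[OF Ginj])
    moreover have "0 \<in> G ` ball 0 (1 / 2)" by (rule image_eqI[of _ _ 0]) (auto simp: G0)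
    ultimately obtain d where d: "d > 0" "ball 0 d \<subseteq> G ` ball 0 (1 / 2)" by (meson openE)
    show ?thesis
    proof (intro exI[of _ "cmod a + 1 / d"] allI impI)
      fix u :: complex assume u: "1 / 2 \<le> cmod u \<and> cmod u < 1"
      hence u': "u \<in> ball 0 1 - {0}" by auto
      have "G (\<omega> * u) \<notin> ball 0 d"
      proof
        assume "G (\<omega> * u) \<in> ball 0 d"
        then obtain v where v: "v \<in> ball 0 (1 / 2)" "G (\<omega> * u) = G v" using d by blast
        hence "\<omega> * u = v" using inj_onD[OF Ginj v(2)] u' \<omega>b[of u] by auto
        thus False using v(1) u \<omega> by (auto simp: norm_mult)
      qed
      hence "1 / cmod (G (\<omega> * u)) \<le> 1 / d" using d(1) by (intro divide_left_mono) (auto intro!: mult_pos_pos)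
      thus "cmod (of_real C * (1 / u + h u)) \<le> cmod a + 1 / d"
        unfolding F[OF u'] using norm_triangle_ineq[of a "1 / G (\<omega> * u)"] by (simp add: norm_divide)
    qed
  qed
  then obtain B where B: "\<And>u. 1 / 2 \<le> cmod u \<Longrightarrow> cmod u < 1 \<Longrightarrow> cmod (of_real C * (1 / u + h u)) \<le> B" by blast
  show ?thesis
  proof (rule that[OF C _ _ _ B])
    show "h holomorphic_on ball 0 1" unfolding h_def using C by (intro holomorphic_intros h1) auto
    show "inj_on (\<lambda>u. 1 / u + h u) (ball 0 1 - {0})"
    proof (rule inj_onI)
      fix u v assume uv: "u \<in> ball 0 1 - {0}" "v \<in> ball 0 1 - {0}" "1 / u + h u = 1 / v + h v"
      hence "1 / G (\<omega> * u) = 1 / G (\<omega> * v)" using F[OF uv(1)] F[OF uv(2)] by simp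
      hence "G (\<omega> * u) = G (\<omega> * v)" by simp
      thus "u = v" using inj_onD[OF Ginj, of "\<omega> * u" "\<omega> * v"] uv \<omega>b[of u] \<omega>b[of v] \<omega>0 by auto
    qed
    have "(\<lambda>u. of_real C * (1 / u + h u)) ` (ball 0 1 - {0}) = (\<lambda>u. a + 1 / G (\<omega> * u)) ` (ball 0 1 - {0})"
      by (intro image_cong refl F)
    also have "\<dots> = outside E"
    proof (intro equalityI subsetI)
      fix z assume "z \<in> (\<lambda>u. a + 1 / G (\<omega> * u)) ` (ball 0 1 - {0})"
      then obtain u where u: "u \<in> ball 0 1 - {0}" "z = a + 1 / G (\<omega> * u)" by blast
      have "G (\<omega> * u) \<in> V" using Gim u(1) \<omega>b[of u] by blast
      thus "z \<in> outside E" using Gnz[OF u(1)] u(2) by (auto simp: V_def)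
    next
      fix z assume z: "z \<in> outside E"
      hence "z \<noteq> a" using aO by auto
      hence "1 / (z - a) \<in> V" using z by (simp add: V_def)
      then obtain v where v: "v \<in> ball 0 1" "G v = 1 / (z - a)" using Gim by (metis imageE)
      have "v \<noteq> 0" using v(2) G0 \<open>z \<noteq> a\<close> by auto
      hence "v / \<omega> \<in> ball 0 1 - {0}" using v(1) \<omega> \<omega>0 by (auto simp: norm_divide)
      thus "z \<in> (\<lambda>u. a + 1 / G (\<omega> * u)) ` (ball 0 1 - {0})"
        using v(2) \<omega>0 by (intro image_eqI[of _ _ "v / \<omega>"]) auto
    qed
    finally show "(\<lambda>u. of_real C * (1 / u + h u)) ` (ball 0 1 - {0}) = outside E" .
  qed
qed

section \<open>Radial limits and the equilibrium measure\<close>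

text \<open>The series converges at a slightly larger radius, hence absolutely at \<open>r\<close>.
  This bounds the partial sums uniformly, so the orthogonality relations pass to the limit.\<close>

lemma parseval:
  assumes a: "\<And>u. u \<in> ball 0 R \<Longrightarrow> (\<lambda>n. a n * u ^ n) sums g u" and r: "0 < r" "r < R"
  shows "(\<lambda>n. (cmod (a n))\<^sup>2 * r ^ (2 * n)) sums (\<integral>t. (cmod (g (of_real r * ucis t)))\<^sup>2 \<partial>circ)"
proof -
  define p where "p N t = (\<Sum>n<N. a n * (of_real r * ucis t) ^ n)" for N t
  have rb: "of_real r * ucis t \<in> ball 0 R" for t using r by (simp add: norm_mult)
  obtain x where x: "r < x" "x < R" using r(2) dense by blast
  have "summable (\<lambda>n. a n * complex_of_real x ^ n)"
    using r x by (intro sums_summable[OF a]) auto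
  hence abs: "summable (\<lambda>n. cmod (a n * of_real r ^ n))"
    by (rule powser_insidea) (use r x in auto)
  define K where "K = (\<Sum>n. cmod (a n * of_real r ^ n))"
  have pb: "cmod (p N t) \<le> K" for N t
  proof -
    have "cmod (p N t) \<le> (\<Sum>n<N. cmod (a n * of_real r ^ n))"
      unfolding p_def by (rule order_trans[OF norm_sum]) (simp add: norm_mult norm_power power_mult_distrib)
    also have "\<dots> \<le> K" unfolding K_def by (intro sum_le_suminf abs) auto
    finally show ?thesis .
  qed
  have pc: "continuous_on UNIV (p N)" for N unfolding p_def by (intro continuous_intros)
  have plim: "(\<lambda>N. p N t) \<longlonglongrightarrow> g (of_real r * ucis t)" for t
    using a[OF rb[of t]] unfolding sums_def p_def .
  have gm [measurable]: "(\<lambda>t. g (of_real r * ucis t)) \<in> borel_measurable borel"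
    by (rule borel_measurable_LIMSEQ_metric[OF borel_measurable_continuous_onI[OF pc] plim])
  have int: "(\<integral>t. (cmod (p N t))\<^sup>2 \<partial>circ) = (\<Sum>n<N. (cmod (a n))\<^sup>2 * r ^ (2 * n))" for N
  proof -
    have "complex_of_real (\<integral>t. (cmod (p N t))\<^sup>2 \<partial>circ) = (\<integral>t. p N t * cnj (p N t) \<partial>circ)"
      by (simp only: integral_complex_of_real[symmetric] complex_norm_square)
    also have "\<dots> = (\<integral>t. (\<Sum>m<N. \<Sum>n<N. a m * of_real r ^ m * cnj (a n * of_real r ^ n) * (ucis t ^ m * cnj (ucis t) ^ n)) \<partial>circ)"
      by (intro Bochner_Integration.integral_cong refl) (simp add: p_def sum_product power_mult_distrib mult_ac)
    also have "\<dots> = (\<Sum>m<N. \<Sum>n<N. a m * of_real r ^ m * cnj (a n * of_real r ^ n) * (if m = n then 1 else 0))"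
    proof -
      have i: "integrable circ (\<lambda>t. c * (ucis t ^ m * cnj (ucis t) ^ n))" for c :: complex and m n
        by (intro circ_integrable_continuous continuous_intros)
      show ?thesis
        by (simp only: Bochner_Integration.integral_sum Bochner_Integration.integrable_sum i
            integral_mult_right_zero ucis_orthogonal)
    qed
    also have "\<dots> = (\<Sum>m<N. complex_of_real ((cmod (a m))\<^sup>2 * r ^ (2 * m)))"
    proof (intro sum.cong refl)
      fix m assume "m \<in> {..<N}"
      hence "(\<Sum>n<N. a m * of_real r ^ m * cnj (a n * of_real r ^ n) * (if m = n then 1 else 0)) = a m * of_real r ^ m * cnj (a m * of_real r ^ m)"
        by (simp add: if_distrib[of "\<lambda>x. _ * x"] cong: if_cong)
      also have "\<dots> = (a m * cnj (a m)) * (of_real r ^ m * of_real r ^ m)" by simp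
      also have "\<dots> = of_real ((cmod (a m))\<^sup>2) * of_real r ^ (2 * m)"
        unfolding complex_norm_square by (simp flip: power_add add: mult_2)
      finally show "(\<Sum>n<N. a m * of_real r ^ m * cnj (a n * of_real r ^ n) * (if m = n then 1 else 0)) = complex_of_real ((cmod (a m))\<^sup>2 * r ^ (2 * m))"
        by simp
    qed
    finally show ?thesis by (simp only: of_real_sum[symmetric] of_real_eq_iff)
  qed
  have "(\<lambda>N. \<integral>t. (cmod (p N t))\<^sup>2 \<partial>circ) \<longlonglongrightarrow> (\<integral>t. (cmod (g (of_real r * ucis t)))\<^sup>2 \<partial>circ)"
  proof (rule integral_dominated_convergence[where w = "\<lambda>_. K\<^sup>2"])
    show "(\<lambda>t. (cmod (p N t))\<^sup>2) \<in> borel_measurable circ" for N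
    proof -
      have [measurable]: "p N \<in> borel_measurable borel" using pc by (rule borel_measurable_continuous_onI)
      show ?thesis by measurable
    qed
    show "AE t in circ. norm ((cmod (p N t))\<^sup>2) \<le> K\<^sup>2" for N
      using pb by (intro AE_I2) (auto intro!: power_mono)
    show "AE t in circ. (\<lambda>N. (cmod (p N t))\<^sup>2) \<longlonglongrightarrow> (cmod (g (of_real r * ucis t)))\<^sup>2"
      by (intro AE_I2 tendsto_intros plim)
  qed auto
  thus ?thesis unfolding sums_def int .
qed

text \<open>The disc coordinate \<open>u\<close> is the inverse of the usual exterior one, so \<open>u = 0\<close> corresponds to \<open>\<infinity>\<close>.\<close>
locale exterior_conformal =
  fixes E :: "complex set" and C B :: real and h :: "complex \<Rightarrow> complex"
  assumes E: "compact E" and EB: "E \<subseteq> cball 0 B" and C: "C > 0" and B: "B \<ge> 1"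
    and h: "h holomorphic_on ball 0 1"
    and inj: "inj_on (\<lambda>u. 1 / u + h u) (ball 0 1 - {0})"
    and im: "(\<lambda>u. of_real C * (1 / u + h u)) ` (ball 0 1 - {0}) = outside E"
    and bd: "\<And>u. 1 / 2 \<le> cmod u \<Longrightarrow> cmod u < 1 \<Longrightarrow> cmod (of_real C * (1 / u + h u)) \<le> B"
begin

definition "F u = of_real C * (1 / u + h u)"
definition "c n = (deriv ^^ n) h 0 / fact n"
text \<open>Radii approaching 1 geometrically, so that the L1 increments of \<open>h\<close> between
  consecutive circles are summable. They start at 3 / 4, inside the range where \<open>F\<close> is
  bounded.\<close>

definition rad :: "nat \<Rightarrow> real" where "rad k = 1 - (1 / 4) ^ (k + 1)"
definition "Zk k t = F (of_real (rad k) * ucis t)"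
text \<open>\<open>lim\<close> is meaningful only where the sequence converges, which is almost
  everywhere; elsewhere its value is arbitrary, yet \<open>Z\<close> is measurable.\<close>

definition "Z t = lim (\<lambda>k. Zk k t)"
definition "\<mu> = distr circ borel Z"

lemma rad: "1 / 2 \<le> rad k" "0 < rad k" "rad k < 1" "rad k \<le> rad (Suc k)"
proof -
  have "(1 / 4 :: real) ^ k \<le> 1" by (intro power_le_one) auto
  thus "1 / 2 \<le> rad k" "0 < rad k" "rad k < 1" "rad k \<le> rad (Suc k)" by (auto simp: rad_def)
qed

lemma rad_lim: "rad \<longlonglongrightarrow> 1"
proof -
  have "(\<lambda>k. (1 / 4 :: real) ^ (k + 1)) \<longlonglongrightarrow> 0"
    by (rule LIMSEQ_ignore_initial_segment[OF LIMSEQ_power_zero]) simp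
  thus ?thesis unfolding rad_def using tendsto_diff[OF tendsto_const] by fastforce
qed

lemma h_sums: "u \<in> ball 0 1 \<Longrightarrow> (\<lambda>n. c n * u ^ n) sums h u"
  using holomorphic_power_series[OF h, of u] by (simp add: c_def)

lemma area: "(\<Sum>n=1..N. of_nat n * (cmod (c n))\<^sup>2) \<le> 1"
  unfolding c_def by (rule area_theorem[OF h inj])

lemma F_holo: "F holomorphic_on (ball 0 1 - {0})"
  unfolding F_def by (intro holomorphic_intros holomorphic_on_subset[OF h]) auto

lemma h_cont_circle: "0 \<le> r \<Longrightarrow> r < 1 \<Longrightarrow> continuous_on UNIV (\<lambda>t. h (of_real r * ucis t))"
  by (intro continuous_on_circle_compose holomorphic_on_imp_continuous_on holomorphic_on_subset[OF h]) auto

lemma Zk_cont: "continuous_on UNIV (Zk k)"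
  unfolding Zk_def F_def using rad[of k] by (intro continuous_intros h_cont_circle) auto

lemma Zk_meas [measurable]: "Zk k \<in> borel_measurable borel"
  using Zk_cont by (rule borel_measurable_continuous_onI)

lemma Z_meas [measurable]: "Z \<in> borel_measurable borel"
  unfolding Z_def[abs_def] by (intro borel_measurable_lim_metric Zk_meas)

lemma Zk_bound: "cmod (Zk k t) \<le> B"
  unfolding Zk_def F_def using rad[of k] by (intro bd) (auto simp: norm_mult)

lemma circle_in_ball: "of_real (rad k) * ucis t \<in> ball 0 1 - {0}"
  using rad[of k] by (auto simp: norm_mult)

text \<open>Parseval gives the sum of |c n|^2 (r^n - s^n)^2. By Bernoulli's inequality the last
  factor is at most n (1 - s), and n is exactly the weight that the area theorem controls.\<close>

lemma h_diff_L2: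
  assumes "0 < s" "s \<le> r" "r < 1"
  shows "(\<integral>t. (cmod (h (of_real r * ucis t) - h (of_real s * ucis t)))\<^sup>2 \<partial>circ) \<le> 1 - s"
proof -
  define g where "g u = h (of_real r * u) - h (of_real s * u)" for u
  have gs: "(\<lambda>n. (c n * (of_real r ^ n - of_real s ^ n)) * u ^ n) sums g u" if u: "u \<in> ball 0 (1 / r)" for u
  proof -
    have "r * cmod u < 1" using u assms by (simp add: field_simps)
    moreover have "s * cmod u \<le> r * cmod u" using assms by (intro mult_right_mono) auto
    ultimately have "of_real r * u \<in> ball 0 1" "of_real s * u \<in> ball 0 1" using assms by (auto simp: norm_mult)
    from sums_diff[OF h_sums[OF this(1)] h_sums[OF this(2)]] show ?thesis
      by (simp add: g_def power_mult_distrib algebra_simps)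
  qed
  have "(\<lambda>n. (cmod (c n * (of_real r ^ n - of_real s ^ n)))\<^sup>2 * 1 ^ (2 * n)) sums (\<integral>t. (cmod (g (of_real 1 * ucis t)))\<^sup>2 \<partial>circ)"
    using assms by (intro parseval[OF gs]) auto
  hence sm: "(\<lambda>n. (cmod (c n))\<^sup>2 * (r ^ n - s ^ n)\<^sup>2) sums (\<integral>t. (cmod (g (ucis t)))\<^sup>2 \<partial>circ)"
    by (simp add: norm_mult power_mult_distrib flip: of_real_power of_real_diff)
  have term_le: "(cmod (c n))\<^sup>2 * (r ^ n - s ^ n)\<^sup>2 \<le> (1 - s) * (of_nat n * (cmod (c n))\<^sup>2)" for n
  proof -
    have p: "s ^ n \<le> r ^ n" "r ^ n \<le> 1" "0 \<le> s ^ n" using assms by (auto intro!: power_mono power_le_one)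
    have "(r ^ n - s ^ n)\<^sup>2 \<le> 1 * (1 - s ^ n)"
      unfolding power2_eq_square using p by (intro mult_mono) auto
    moreover have "1 - s ^ n \<le> of_nat n * (1 - s)"
      using Bernoulli_inequality[of "s - 1" n] assms by (simp add: algebra_simps)
    ultimately have "(r ^ n - s ^ n)\<^sup>2 \<le> of_nat n * (1 - s)" by (metis mult_1 order_trans)
    hence "(cmod (c n))\<^sup>2 * (r ^ n - s ^ n)\<^sup>2 \<le> (cmod (c n))\<^sup>2 * (of_nat n * (1 - s))" by (intro mult_left_mono) auto
    thus ?thesis by (simp add: mult_ac)
  qed
  have "(\<integral>t. (cmod (g (ucis t)))\<^sup>2 \<partial>circ) = (\<Sum>n. (cmod (c n))\<^sup>2 * (r ^ n - s ^ n)\<^sup>2)"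
    using sm by (simp add: sums_iff)
  also have "\<dots> \<le> 1 - s"
  proof (rule suminf_le_const)
    show "summable (\<lambda>n. (cmod (c n))\<^sup>2 * (r ^ n - s ^ n)\<^sup>2)" using sm by (simp add: sums_iff)
    fix N
    have "(\<Sum>n<N. (cmod (c n))\<^sup>2 * (r ^ n - s ^ n)\<^sup>2) \<le> (\<Sum>n<N. (1 - s) * (of_nat n * (cmod (c n))\<^sup>2))"
      by (intro sum_mono term_le)
    also have "\<dots> = (1 - s) * (\<Sum>n<N. of_nat n * (cmod (c n))\<^sup>2)" by (simp add: sum_distrib_left)
    also have "(\<Sum>n<N. of_nat n * (cmod (c n))\<^sup>2) \<le> (\<Sum>n=0..N. of_nat n * (cmod (c n))\<^sup>2)"
      by (intro sum_mono2) auto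
    also have "\<dots> = (\<Sum>n=1..N. of_nat n * (cmod (c n))\<^sup>2)"
      by (simp add: sum.atLeast_Suc_atMost)
    also have "\<dots> \<le> 1" by (rule area)
    finally show "(\<Sum>n<N. (cmod (c n))\<^sup>2 * (r ^ n - s ^ n)\<^sup>2) \<le> 1 - s" using assms by (simp add: mult_left_mono)
  qed
  finally show ?thesis by (simp add: g_def)
qed

lemma h_diff_L1:
  "(\<integral>t. cmod (h (of_real (rad (Suc k)) * ucis t) - h (of_real (rad k) * ucis t)) \<partial>circ) \<le> (1 / 2) ^ k"
proof -
  define f where "f t = cmod (h (of_real (rad (Suc k)) * ucis t) - h (of_real (rad k) * ucis t))" for t
  have fc: "continuous_on UNIV f" unfolding f_def
    using rad[of k] rad[of "Suc k"] by (intro continuous_intros h_cont_circle) auto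
  have "(\<integral>t. (f t)\<^sup>2 \<partial>circ) \<le> (1 / 4) ^ (k + 1)"
    using h_diff_L2[of "rad k" "rad (Suc k)"] rad[of k] rad[of "Suc k"] by (simp add: f_def rad_def[of k])
  \<comment> \<open>A weighted arithmetic-geometric mean inequality in place of Cauchy-Schwarz, with
    weights balanced for an L2 square of order 4^-k.\<close>
  have "(\<integral>t. f t \<partial>circ) \<le> (\<integral>t. (1 / 2) ^ k / 2 + 2 ^ k / 2 * (f t)\<^sup>2 \<partial>circ)"
  proof (rule integral_mono)
    show "integrable circ f" by (intro circ_integrable_continuous fc)
    show "integrable circ (\<lambda>t. (1 / 2) ^ k / 2 + 2 ^ k / 2 * (f t)\<^sup>2)"
      by (intro circ_integrable_continuous continuous_intros fc)
    fix t
    have "0 \<le> (1 / 2 ^ k) * (1 - 2 ^ k * f t)\<^sup>2 / 2" by simp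
    also have "\<dots> = (1 / 2) ^ k / 2 + 2 ^ k / 2 * (f t)\<^sup>2 - f t" by (simp add: power2_eq_square field_simps)
    finally show "f t \<le> (1 / 2) ^ k / 2 + 2 ^ k / 2 * (f t)\<^sup>2" by simp
  qed
  also have "\<dots> = (1 / 2) ^ k / 2 + 2 ^ k / 2 * (\<integral>t. (f t)\<^sup>2 \<partial>circ)"
    by (subst Bochner_Integration.integral_add) (auto intro!: circ_integrable_continuous continuous_intros fc)
  also have "\<dots> \<le> (1 / 2) ^ k / 2 + 2 ^ k / 2 * (1 / 4) ^ (k + 1)"
    using \<open>(\<integral>t. (f t)\<^sup>2 \<partial>circ) \<le> _\<close> by (intro add_left_mono mult_left_mono) auto
  also have "\<dots> \<le> (1 / 2) ^ k"
  proof -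
    have "(2::real) ^ k * (1 / 4) ^ k = (1 / 2) ^ k" by (simp flip: power_mult_distrib)
    thus ?thesis by simp
  qed
  finally show ?thesis by (simp add: f_def)
qed

text \<open>The L1 norms of the increments have a finite sum, so almost everywhere the increments
  themselves are absolutely summable.\<close>

lemma Zk_converges: "AE t in circ. (\<lambda>k. Zk k t) \<longlonglongrightarrow> Z t"
proof -
  define f where "f k t = cmod (h (of_real (rad (Suc k)) * ucis t) - h (of_real (rad k) * ucis t))" for k t
  have fc: "continuous_on UNIV (f k)" for k unfolding f_def
    using rad[of k] rad[of "Suc k"] by (intro continuous_intros h_cont_circle) auto
  have [measurable]: "f k \<in> borel_measurable borel" for k using fc by (rule borel_measurable_continuous_onI)
  have "(\<integral>\<^sup>+ t. (\<Sum>k. ennreal (f k t)) \<partial>circ) = (\<Sum>k. \<integral>\<^sup>+ t. ennreal (f k t) \<partial>circ)"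
    by (rule nn_integral_suminf) measurable
  also have "\<dots> \<le> (\<Sum>k. ennreal ((1 / 2) ^ k))"
  proof (intro suminf_le)
    fix k
    have "(\<integral>\<^sup>+ t. ennreal (f k t) \<partial>circ) = ennreal (\<integral>t. f k t \<partial>circ)"
      by (intro nn_integral_eq_integral circ_integrable_continuous fc) (auto simp: f_def)
    also have "\<dots> \<le> ennreal ((1 / 2) ^ k)" unfolding f_def by (intro ennreal_leI h_diff_L1)
    finally show "(\<integral>\<^sup>+ t. ennreal (f k t) \<partial>circ) \<le> ennreal ((1 / 2) ^ k)" .
  qed auto
  also have "\<dots> < \<infinity>"
    by (subst suminf_ennreal2) (auto intro: summable_geometric)
  finally have "AE t in circ. (\<Sum>k. ennreal (f k t)) \<noteq> \<infinity>"
    by (intro nn_integral_noteq_infinite) auto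
  thus ?thesis
  proof eventually_elim
    case (elim t)
    hence "summable (\<lambda>k. f k t)" by (intro summable_suminf_not_top) (auto simp: f_def)
    hence "summable (\<lambda>k. h (of_real (rad (Suc k)) * ucis t) - h (of_real (rad k) * ucis t))"
      unfolding f_def by (rule summable_norm_cancel)
    hence "convergent (\<lambda>k. h (of_real (rad k) * ucis t))"
      unfolding summable_iff_convergent sum_lessThan_telescope[of "\<lambda>k. h (of_real (rad k) * ucis t)"]
      by (simp add: convergent_diff_const_right_iff)
    moreover have "convergent (\<lambda>k. 1 / (of_real (rad k) * ucis t))"
    proof -
      have "(\<lambda>k. 1 / (of_real (rad k) * ucis t)) \<longlonglongrightarrow> 1 / (of_real 1 * ucis t)"
        by (intro tendsto_intros rad_lim) auto
      thus ?thesis by (auto simp: convergent_def)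
    qed
    ultimately have "convergent (\<lambda>k. Zk k t)"
      unfolding Zk_def F_def by (intro convergent_mult convergent_const convergent_add)
    thus ?case by (simp add: convergent_LIMSEQ_iff Z_def)
  qed
qed

end

section \<open>From the nonnegative kernel to the signed logarithmic energy\<close>

lemma log_energy_mutual_energy:
  assumes \<nu>: "prob_space \<nu>" "sets \<nu> = sets borel" "AE z in \<nu>. z \<in> S"
    and S: "\<And>z w. z \<in> S \<Longrightarrow> w \<in> S \<Longrightarrow> cmod (z - w) \<le> R" and R: "R \<ge> 1"
  shows "mutual_energy R \<nu> \<nu> = \<infinity> \<Longrightarrow> log_energy \<nu> = \<infinity>"
    and "mutual_energy R \<nu> \<nu> = ennreal m \<Longrightarrow> m \<ge> 0 \<Longrightarrow> log_energy \<nu> = ereal (m / 2 - ln R)"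
proof -
  note [measurable_cong] = \<nu>(2)
  interpret prob_space \<nu> by fact
  interpret P: pair_prob_space \<nu> \<nu> ..
  have [measurable_cong]: "sets (\<nu> \<Otimes>\<^sub>M \<nu>) = sets (borel \<Otimes>\<^sub>M borel)"
    by (intro sets_pair_measure_cong \<nu>)
  have prob: "emeasure (\<nu> \<Otimes>\<^sub>M \<nu>) (space (\<nu> \<Otimes>\<^sub>M \<nu>)) = 1"
    using prob_space_pair[OF \<nu>(1) \<nu>(1)] by (rule prob_space.emeasure_space_1)
  have lR: "ln R \<ge> 0" using R by simp
  have [measurable]: "log_kernel_pos \<in> borel_measurable (borel \<Otimes>\<^sub>M borel)"
    "log_kernel_neg \<in> borel_measurable (borel \<Otimes>\<^sub>M borel)"
    unfolding log_kernel_pos_def[abs_def] log_kernel_neg_def[abs_def] by measurable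
  define Pp where "Pp = (\<integral>\<^sup>+ p. log_kernel_pos p \<partial>(\<nu> \<Otimes>\<^sub>M \<nu>))"
  define Nn where "Nn = (\<integral>\<^sup>+ p. log_kernel_neg p \<partial>(\<nu> \<Otimes>\<^sub>M \<nu>))"
  have AES: "AE p in \<nu> \<Otimes>\<^sub>M \<nu>. cmod (fst p - snd p) \<le> R"
  proof (rule P.AE_pair_measure)
    show "{p \<in> space (\<nu> \<Otimes>\<^sub>M \<nu>). cmod (fst p - snd p) \<le> R} \<in> sets (\<nu> \<Otimes>\<^sub>M \<nu>)" by measurable
    show "AE x in \<nu>. AE y in \<nu>. cmod (fst (x, y) - snd (x, y)) \<le> R"
      using \<nu>(3)
    proof eventually_elim
      case (elim x)
      show ?case using \<nu>(3) by eventually_elim (use elim S in auto)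
    qed
  qed
  have M: "mutual_energy R \<nu> \<nu> = (\<integral>\<^sup>+ p. log_kernel R (fst p) (snd p) \<partial>(\<nu> \<Otimes>\<^sub>M \<nu>))"
    unfolding mutual_energy_def by (subst nn_integral_fst[symmetric]) auto
  \<comment> \<open>Twice the pointwise identity pos + ln R = ln (R/x) + neg. With the negative part
    moved across, every term is nonnegative, since R >= 1.\<close>
  have "2 * Pp + ennreal (2 * ln R) = (\<integral>\<^sup>+ p. 2 * log_kernel_pos p + ennreal (2 * ln R) \<partial>(\<nu> \<Otimes>\<^sub>M \<nu>))"
    unfolding Pp_def by (subst nn_integral_add) (auto simp: nn_integral_cmult prob)
  also have "\<dots> = (\<integral>\<^sup>+ p. log_kernel R (fst p) (snd p) + 2 * log_kernel_neg p \<partial>(\<nu> \<Otimes>\<^sub>M \<nu>))"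
    using AES
  proof (intro nn_integral_cong_AE, eventually_elim)
    case (elim p)
    show ?case
    proof (cases "fst p = snd p")
      case False
      define x where "x = cmod (fst p - snd p)"
      have x: "0 < x" "x \<le> R" using False elim by (auto simp: x_def)
      have "2 * max 0 (- ln x) + 2 * ln R = 2 * ln (R / x) + 2 * max 0 (ln x)"
        using x R by (simp add: ln_div max_def)
      moreover have "ln (R / x) \<ge> 0" using x by (intro ln_ge_zero) auto
      ultimately have "ennreal (2 * max 0 (- ln x)) + ennreal (2 * ln R) = ennreal (2 * ln (R / x)) + ennreal (2 * max 0 (ln x))"
        using lR by (subst (1 2) ennreal_plus[symmetric]) auto
      moreover have "2 * log_kernel_pos p = ennreal (2 * max 0 (- ln x))" "2 * log_kernel_neg p = ennreal (2 * max 0 (ln x))"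
        "log_kernel R (fst p) (snd p) = ennreal (2 * ln (R / x))"
        using False by (simp_all only: log_kernel_pos_def log_kernel_neg_def log_kernel_def x_def[symmetric] if_False
            ennreal_mult'[OF zero_le_numeral] ennreal_numeral)
      ultimately show ?thesis by simp
    qed (simp add: log_kernel_pos_def log_kernel_def ennreal_mult_eq_top_iff)
  qed
  also have "\<dots> = mutual_energy R \<nu> \<nu> + 2 * Nn"
    unfolding M Nn_def by (subst nn_integral_add) (auto simp: nn_integral_cmult)
  finally have eq: "2 * Pp + ennreal (2 * ln R) = mutual_energy R \<nu> \<nu> + 2 * Nn" .
  \<comment> \<open>The negative part is at most \<open>ln R\<close>, so the difference in
    \<open>log_energy\<close> is never infinity minus infinity.\<close>
  have "Nn \<le> (\<integral>\<^sup>+ p. ennreal (ln R) \<partial>(\<nu> \<Otimes>\<^sub>M \<nu>))"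
    unfolding Nn_def using AES
  proof (intro nn_integral_mono_AE, eventually_elim)
    case (elim p)
    show ?case
    proof (cases "fst p = snd p")
      case False
      hence "ln (cmod (fst p - snd p)) \<le> ln R" using elim R by simp
      thus ?thesis using lR by (auto simp: log_kernel_neg_def intro!: ennreal_leI)
    qed (use lR in \<open>auto simp: log_kernel_neg_def\<close>)
  qed
  also have "\<dots> = ennreal (ln R)" by (simp add: prob)
  finally obtain n where n: "Nn = ennreal n" "n \<ge> 0"
    by (cases Nn) (auto simp: top_unique)
  have en: "log_energy \<nu> = enn2ereal Pp - enn2ereal Nn" by (simp add: log_energy_def Pp_def Nn_def)
  {
    assume "mutual_energy R \<nu> \<nu> = \<infinity>"
    hence "Pp = \<infinity>" using eq by (cases Pp) (auto simp flip: ennreal_plus ennreal_mult simp: ennreal_mult_eq_top_iff)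
    thus "log_energy \<nu> = \<infinity>" using n by (simp add: en)
  }
  {
    assume m: "mutual_energy R \<nu> \<nu> = ennreal m" "m \<ge> 0"
    have two: "(2 :: ennreal) * ennreal y = ennreal (2 * y)" if "y \<ge> 0" for y
      using that by (simp add: ennreal_mult)
    have "2 * Pp + ennreal (2 * ln R) = ennreal (m + 2 * n)" unfolding eq m n using m n by (simp add: two ennreal_plus)
    moreover obtain p where p: "Pp = ennreal p" "p \<ge> 0"
      using calculation by (cases Pp) (auto simp: ennreal_mult_top)
    ultimately have "ennreal (2 * p + 2 * ln R) = ennreal (m + 2 * n)" using lR by (simp add: two ennreal_plus)
    hence "2 * p + 2 * ln R = m + 2 * n" using p m n lR by (subst (asm) ennreal_inj) auto
    hence "p - n = m / 2 - ln R" by simp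
    thus "log_energy \<nu> = ereal (m / 2 - ln R)" unfolding en p n using p n by simp
  }
qed

section \<open>Level curves, their potentials and the equilibrium measure\<close>

context exterior_conformal
begin

text \<open>The diameter of \<open>cball 0 B\<close>, which contains \<open>E\<close> and all level
  curves that are used, so one kernel serves every energy.\<close>

definition "R = 2 * B"

lemma R: "R \<ge> 1" "R > 0" "z \<in> cball 0 B \<Longrightarrow> w \<in> cball 0 B \<Longrightarrow> cmod (z - w) \<le> R"
  using B norm_triangle_ineq4[of z w] by (auto simp: R_def)

lemma F_image: "F ` (ball 0 1 - {0}) = outside E"
  unfolding im[symmetric] by (intro image_cong refl F_def)

lemma F_outside: "u \<in> ball 0 1 - {0} \<Longrightarrow> F u \<in> outside E"
  unfolding F_def im[symmetric] by blast

lemma F_inj: "u \<in> ball 0 1 - {0} \<Longrightarrow> v \<in> ball 0 1 - {0} \<Longrightarrow> F u = F v \<Longrightarrow> u = v"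
  using inj C by (auto simp: F_def inj_on_def)

definition "\<mu>k k = distr circ borel (Zk k)"

lemma prob_\<mu>: "prob_space \<mu>" "sets \<mu> = sets borel" "prob_space (\<mu>k k)" "sets (\<mu>k k) = sets borel"
  by (auto simp: \<mu>_def \<mu>k_def intro!: circ.prob_space_distr)

text \<open>A limit value F v with 0 < |v| < 1 would, by the open mapping theorem and injectivity,
  trap the parameters near v, whereas their moduli tend to 1. So the limit lies on the frontier of
  the exterior.\<close>

lemma Z_in_E: "AE t in circ. Z t \<in> E"
  using Zk_converges
proof eventually_elim
  case (elim t)
  have out: "Zk k t \<in> outside E" for k unfolding Zk_def by (intro F_outside circle_in_ball)
  have "Z t \<notin> outside E"
  proof
    assume "Z t \<in> outside E"
    hence "Z t \<in> F ` (ball 0 1 - {0})" by (simp only: F_image)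
    then obtain v where v': "Z t = F v" and v: "v \<in> ball 0 1 - {0}" by (rule imageE)
    from v have vn: "0 < cmod v" "cmod v < 1" by simp_all
    obtain d where "0 < d" "d < min (cmod v) (1 - cmod v)"
      using dense[of 0 "min (cmod v) (1 - cmod v)"] vn by auto
    hence d: "d > 0" "d < cmod v" "d < 1 - cmod v" by simp_all
    have sub: "ball v d \<subseteq> ball 0 1 - {0}"
    proof
      fix x assume x: "x \<in> ball v d"
      have 1: "cmod x \<le> cmod v + dist v x" "cmod v \<le> cmod x + dist v x"
        using norm_triangle_ineq2[of x v] norm_triangle_ineq2[of v x] by (simp_all add: dist_norm norm_minus_commute)
      have "dist v x < d" using x by simp
      hence "cmod x < 1" "0 < cmod x" using 1 d by linarith+
      thus "x \<in> ball 0 1 - {0}" by simp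
    qed
    have "inj_on F (ball v d)" using F_inj sub by (intro inj_onI) blast
    hence "open (F ` ball v d)"
      by (intro open_mapping_thm3 holomorphic_on_subset[OF F_holo sub]) auto
    moreover have "Z t \<in> F ` ball v d" unfolding v' using d(1) by (intro imageI) simp
    ultimately have ev: "\<forall>\<^sub>F k in sequentially. Zk k t \<in> F ` ball v d"
      using elim by (rule topological_tendstoD[rotated 1])
    have "\<forall>\<^sub>F k in sequentially. rad k > cmod v + d"
      using d by (intro order_tendstoD(1)[OF rad_lim]) auto
    with ev have "\<forall>\<^sub>F k in sequentially. False"
    proof eventually_elim
      case (elim k)
      then obtain x where x: "x \<in> ball v d" "Zk k t = F x" by blast
      hence "of_real (rad k) * ucis t = x" using F_inj[OF circle_in_ball] sub unfolding Zk_def by blast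
      hence "rad k = cmod x" using rad[of k] by (auto simp: norm_mult)
      moreover have "cmod x \<le> cmod v + dist v x"
        using norm_triangle_ineq2[of x v] by (auto simp: dist_norm norm_minus_commute)
      ultimately show ?case using x elim by auto
    qed
    thus False by simp
  qed
  moreover have "Z t \<in> closure (outside E)"
    unfolding closure_sequential using out elim by (intro exI[of _ "\<lambda>k. Zk k t"]) simp
  ultimately have "Z t \<in> frontier (outside E)"
    using E by (simp add: frontier_def interior_open open_outside compact_imp_closed)
  thus ?case using frontier_outside_subset[OF compact_imp_closed[OF E]] by blast
qed

lemma \<mu>_prob_measure: "\<mu> \<in> prob_measures_on E"
proof -
  have "AE z in \<mu>. z \<in> E"
    unfolding \<mu>_def using Z_in_E compact_imp_closed[OF E] by (subst AE_distr_iff) auto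
  hence "AE z in \<mu>. z \<notin> UNIV - E" by auto
  moreover have "UNIV - E \<in> sets \<mu>" using prob_\<mu>(2) compact_imp_closed[OF E] by auto
  ultimately have "emeasure \<mu> (UNIV - E) = 0" by (subst (asm) AE_iff_null_sets[symmetric]) auto
  thus ?thesis using prob_\<mu> by (simp add: prob_measures_on_def)
qed

lemma prob_measures_on_AE:
  assumes "\<nu> \<in> prob_measures_on E"
  shows "prob_space \<nu>" "sets \<nu> = sets borel" "AE z in \<nu>. z \<in> E" "AE z in \<nu>. z \<in> cball 0 B"
proof -
  show 1: "prob_space \<nu>" "sets \<nu> = sets borel" using assms by (auto simp: prob_measures_on_def)
  have "UNIV - E \<in> null_sets \<nu>"
    using assms compact_imp_closed[OF E] by (auto simp: prob_measures_on_def null_sets_def)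
  from AE_not_in[OF this] show 2: "AE z in \<nu>. z \<in> E" by auto
  thus "AE z in \<nu>. z \<in> cball 0 B" by eventually_elim (use EB in auto)
qed

lemma integral_converges:
  fixes f :: "complex \<Rightarrow> 'b::euclidean_space"
  assumes f: "continuous_on UNIV f"
  shows "(\<lambda>k. \<integral>z. f z \<partial>\<mu>k k) \<longlonglongrightarrow> (\<integral>z. f z \<partial>\<mu>)"
proof -
  have [measurable]: "f \<in> borel_measurable borel" using f by (rule borel_measurable_continuous_onI)
  have "compact (f ` cball 0 B)" by (intro compact_continuous_image continuous_on_subset[OF f]) auto
  then obtain K where K: "\<And>z. z \<in> cball 0 B \<Longrightarrow> norm (f z) \<le> K"
    by (metis bounded_iff compact_imp_bounded imageI)
  have "(\<lambda>k. \<integral>t. f (Zk k t) \<partial>circ) \<longlonglongrightarrow> (\<integral>t. f (Z t) \<partial>circ)"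
  proof (rule integral_dominated_convergence[where w = "\<lambda>_. K"])
    show "AE t in circ. norm (f (Zk k t)) \<le> K" for k using K Zk_bound by (intro AE_I2) auto
    show "AE t in circ. (\<lambda>k. f (Zk k t)) \<longlonglongrightarrow> f (Z t)"
      using Zk_converges
    proof eventually_elim
      case (elim t)
      show ?case using f elim by (auto intro: continuous_on_tendsto_compose)
    qed
  qed auto
  thus ?thesis by (simp add: \<mu>_def \<mu>k_def integral_distr)
qed

text \<open>The product u (F u - w) with the pole removed. It is \<open>C\<close> at 0 and vanishes
  exactly where \<open>F\<close> takes the value \<open>w\<close>, so circle means of its logarithm
  compute the potential of a level curve at \<open>w\<close>.\<close>

definition "lift w u = of_real C * (1 + u * h u) - u * w"

lemma lift:
  shows lift_0: "lift w 0 = of_real C"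
    and lift_F: "u \<noteq> 0 \<Longrightarrow> lift w u = u * (F u - w)"
    and lift_holo: "lift w holomorphic_on ball 0 1"
  by (auto simp: lift_def[abs_def] F_def field_simps intro!: holomorphic_intros h)

text \<open>On the circle this is a distance bound, which the maximum principle carries inside. It
  makes the kernel rescaled by \<open>rad k\<close> nonnegative.\<close>

lemma lift_le:
  assumes w: "w \<in> cball 0 B" and u: "u \<in> cball 0 (rad k)"
  shows "cmod (lift w u) \<le> rad k * R"
proof (rule maximum_modulus_frontier[of "lift w" "cball 0 (rad k)"])
  have sub: "cball 0 (rad k) \<subseteq> ball 0 1" using rad[of k] by auto
  show "lift w holomorphic_on interior (cball 0 (rad k))" using sub by (intro holomorphic_on_subset[OF lift_holo]) auto
  show "continuous_on (closure (cball 0 (rad k))) (lift w)"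
    using sub by (intro holomorphic_on_imp_continuous_on holomorphic_on_subset[OF lift_holo]) auto
  fix v :: complex assume "v \<in> frontier (cball 0 (rad k))"
  hence v: "cmod v = rad k" using rad[of k] by simp
  have "F v \<in> cball 0 B" using bd[of v] v rad[of k] by (auto simp: F_def)
  hence "cmod (F v - w) \<le> R" using w by (intro R)
  moreover have "lift w v = v * (F v - w)" using v rad[of k] by (intro lift_F) auto
  ultimately show "cmod (lift w v) \<le> rad k * R" using v rad[of k] by (simp add: norm_mult)
qed (use u in auto)

lemma log_kernel_lift: "log_kernel R w (Zk k t) = log_kernel (rad k * R) (lift w (of_real (rad k) * ucis t)) 0"
proof -
  have "lift w (of_real (rad k) * ucis t) = of_real (rad k) * ucis t * (Zk k t - w)"
    using circle_in_ball[of k t] unfolding Zk_def by (intro lift_F) auto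
  thus ?thesis using rad[of k] by (auto simp: log_kernel_def norm_mult norm_minus_commute)
qed

lemma C_le_R: "2 * ln (rad k * R / C) \<ge> 0"
proof -
  have "cmod (lift (Zk k 0) 0) \<le> rad k * R" using rad[of k] Zk_bound by (intro lift_le) auto
  thus ?thesis using C by (simp add: lift_0)
qed

text \<open>For \<open>w\<close> in \<open>E\<close> the lift has no zero in the disc, so the
  potential of the level curve takes the same value at every point of \<open>E\<close>, whatever the
  measure \<nu>.\<close>

lemma mutual_energy_outer:
  assumes \<nu>: "\<nu> \<in> prob_measures_on E"
  shows "mutual_energy R \<nu> (\<mu>k k) = ennreal (2 * ln (rad k * R / C))"
proof -
  note nu = prob_measures_on_AE[OF \<nu>]
  note [measurable_cong] = nu(2)
  interpret prob_space \<nu> by fact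
  let ?r = "rad k"
  have inner: "(\<integral>\<^sup>+ z. log_kernel R w z \<partial>\<mu>k k) = ennreal (2 * ln (?r * R / C))" if w: "w \<in> E" for w
  proof -
    have "(\<integral>\<^sup>+ z. log_kernel R w z \<partial>\<mu>k k) = (\<integral>\<^sup>+ t. log_kernel (?r * R) (lift w (of_real ?r * ucis t)) 0 \<partial>circ)"
      by (simp add: \<mu>k_def nn_integral_distr log_kernel_lift)
    also have "\<dots> = ennreal (2 * ln (?r * R / cmod (lift w 0)))"
    proof (rule log_kernel_mean_eq[where R = 1, OF lift_holo])
      show "lift w u \<noteq> 0" if "u \<in> ball 0 1" for u
      proof (cases "u = 0")
        case False
        hence "F u \<noteq> w" using F_outside[of u] that w outside_no_overlap by blast
        thus ?thesis using lift_F False by auto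
      qed (use C in \<open>auto simp: lift_0\<close>)
      show "cmod (lift w u) \<le> ?r * R" if "cmod u = ?r" for u
        using that w EB by (intro lift_le) auto
      show "0 < ?r * R" using rad[of k] R by simp
    qed (use rad[of k] in auto)
    finally show ?thesis using C by (simp add: lift_0)
  qed
  have "mutual_energy R \<nu> (\<mu>k k) = (\<integral>\<^sup>+ w. ennreal (2 * ln (?r * R / C)) \<partial>\<nu>)"
    unfolding mutual_energy_def using nu(3) by (intro nn_integral_cong_AE, eventually_elim) (rule inner)
  thus ?thesis by (simp add: emeasure_space_1)
qed

text \<open>For a point of the curve itself the zero of the lift lies on the circle, so the mean
  value identity weakens to an inequality, in the direction that the comparison of energies
  needs.\<close>

lemma mutual_energy_self: "mutual_energy R (\<mu>k k) (\<mu>k k) \<le> ennreal (2 * ln (rad k * R / C))"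
proof -
  let ?r = "rad k"
  have inner: "(\<integral>\<^sup>+ t. log_kernel R (Zk k s) (Zk k t) \<partial>circ) \<le> ennreal (2 * ln (?r * R / C))" for s
  proof -
    define v where "v = of_real ?r * ucis s"
    have v: "v \<in> ball 0 1 - {0}" "cmod v = ?r" "F v = Zk k s"
      using circle_in_ball[of k s] rad[of k] by (auto simp: v_def Zk_def norm_mult)
    have sub: "cball 0 ?r \<subseteq> ball 0 1" using rad[of k] by auto
    have "(\<integral>\<^sup>+ t. log_kernel R (Zk k s) (Zk k t) \<partial>circ) = (\<integral>\<^sup>+ t. log_kernel (?r * R) (lift (Zk k s) (of_real ?r * ucis t)) 0 \<partial>circ)"
      by (simp add: log_kernel_lift)
    also have "\<dots> \<le> ennreal (2 * ln (?r * R / cmod (lift (Zk k s) 0)))"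
    proof (rule log_kernel_mean_le)
      show "lift (Zk k s) holomorphic_on ball 0 ?r" using sub by (intro holomorphic_on_subset[OF lift_holo]) auto
      show "continuous_on (cball 0 ?r) (lift (Zk k s))"
        using sub by (intro holomorphic_on_imp_continuous_on holomorphic_on_subset[OF lift_holo])
      show "lift (Zk k s) u \<noteq> 0" if u: "u \<in> ball 0 ?r" for u
      proof (cases "u = 0")
        case False
        have "u \<in> ball 0 1 - {0}" using u False rad[of k] by auto
        hence "F u \<noteq> Zk k s" using F_inj[of u v] v u by auto
        thus ?thesis using lift_F False by auto
      qed (use C in \<open>auto simp: lift_0\<close>)
      show "cmod (lift (Zk k s) u) \<le> ?r * R" if "u \<in> cball 0 ?r" for u
        using that Zk_bound by (intro lift_le) auto
      show "0 < ?r * R" using rad[of k] R by simp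
    qed (use rad[of k] in auto)
    finally show ?thesis using C by (simp add: lift_0)
  qed
  have "mutual_energy R (\<mu>k k) (\<mu>k k) = (\<integral>\<^sup>+ s. \<integral>\<^sup>+ t. log_kernel R (Zk k s) (Zk k t) \<partial>circ \<partial>circ)"
    by (simp add: mutual_energy_def \<mu>k_def nn_integral_distr)
  also have "\<dots> \<le> (\<integral>\<^sup>+ s. ennreal (2 * ln (?r * R / C)) \<partial>circ)" by (intro nn_integral_mono inner)
  finally show ?thesis by simp
qed

lemma lim_value: "(\<lambda>k. 2 * ln (rad k * R / C)) \<longlonglongrightarrow> 2 * ln (R / C)"
proof -
  have "(\<lambda>k. 2 * ln (rad k * R / C)) \<longlonglongrightarrow> 2 * ln (1 * R / C)"
    using R C by (intro tendsto_intros rad_lim) auto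
  thus ?thesis by simp
qed

text \<open>Fatou's lemma in each variable, applied to the lower semicontinuous kernel along the
  almost everywhere convergent curves.\<close>

lemma mutual_energy_\<mu>: "mutual_energy R \<mu> \<mu> \<le> ennreal (2 * ln (R / C))"
proof -
  have "mutual_energy R \<mu> \<mu> = (\<integral>\<^sup>+ s. \<integral>\<^sup>+ t. log_kernel R (Z s) (Z t) \<partial>circ \<partial>circ)"
    by (simp add: mutual_energy_def \<mu>_def nn_integral_distr)
  also have "\<dots> \<le> (\<integral>\<^sup>+ s. liminf (\<lambda>k. \<integral>\<^sup>+ t. log_kernel R (Zk k s) (Zk k t) \<partial>circ) \<partial>circ)"
    using Zk_converges
  proof (intro nn_integral_mono_AE, eventually_elim)
    case (elim s)
    have "(\<integral>\<^sup>+ t. log_kernel R (Z s) (Z t) \<partial>circ) \<le> (\<integral>\<^sup>+ t. liminf (\<lambda>k. log_kernel R (Zk k s) (Zk k t)) \<partial>circ)"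
      using Zk_converges by (intro nn_integral_mono_AE, eventually_elim) (intro log_kernel_lsc elim R)
    also have "\<dots> \<le> liminf (\<lambda>k. \<integral>\<^sup>+ t. log_kernel R (Zk k s) (Zk k t) \<partial>circ)"
      by (intro nn_integral_liminf) measurable
    finally show ?case .
  qed
  also have "\<dots> \<le> liminf (\<lambda>k. \<integral>\<^sup>+ s. \<integral>\<^sup>+ t. log_kernel R (Zk k s) (Zk k t) \<partial>circ \<partial>circ)"
    by (intro nn_integral_liminf) measurable
  also have "(\<lambda>k. \<integral>\<^sup>+ s. \<integral>\<^sup>+ t. log_kernel R (Zk k s) (Zk k t) \<partial>circ \<partial>circ) = (\<lambda>k. mutual_energy R (\<mu>k k) (\<mu>k k))"
    by (simp add: mutual_energy_def \<mu>k_def nn_integral_distr)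
  also have "liminf \<dots> \<le> liminf (\<lambda>k. ennreal (2 * ln (rad k * R / C)))"
    by (intro Liminf_mono always_eventually allI mutual_energy_self)
  also have "\<dots> = ennreal (2 * ln (R / C))"
    by (intro lim_imp_Liminf tendsto_ennrealI lim_value) simp
  finally show ?thesis .
qed

lemma gauss_dist_lsc:
  assumes \<nu>: "prob_space \<nu>" "sets \<nu> = sets borel"
  shows "gauss_dist 1 \<nu> \<mu> \<le> liminf (\<lambda>k. gauss_dist 1 \<nu> (\<mu>k k))"
proof -
  have fin: "finite_measure \<nu>" "finite_measure \<mu>" "finite_measure (\<mu>k k)" for k
    using \<nu> prob_\<mu> by (simp_all add: prob_space.finite_measure)
  note [measurable] = gauss_mean_measurable[OF fin(1) \<nu>(2)] gauss_mean_measurable[OF fin(2) prob_\<mu>(2)] gauss_mean_measurable[OF fin(3) prob_\<mu>(4)]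
  have conv: "(\<lambda>k. gauss_mean 1 (\<mu>k k) p) \<longlonglongrightarrow> gauss_mean 1 \<mu> p" for p
    unfolding gauss_mean_def
    by (intro integral_converges) (auto simp: gauss_feature_def case_prod_beta intro!: continuous_intros)
  have "gauss_dist 1 \<nu> \<mu> = (\<integral>\<^sup>+ p. liminf (\<lambda>k. ennreal ((gauss_mean 1 \<nu> p - gauss_mean 1 (\<mu>k k) p)\<^sup>2)) \<partial>lborel)"
    unfolding gauss_dist_def
    by (intro nn_integral_cong lim_imp_Liminf[symmetric] tendsto_ennrealI tendsto_intros conv) simp
  also have "\<dots> \<le> liminf (\<lambda>k. gauss_dist 1 \<nu> (\<mu>k k))"
    unfolding gauss_dist_def by (intro nn_integral_liminf) measurable
  finally show ?thesis .
qed

text \<open>Against the level curve measure the mutual energy is exactly \<open>x\<close> and the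
  self energy at most \<open>x\<close>, so 2 x + distance <= m + x. Cancelling one \<open>x\<close>
  gives the lower bound and, in the limit, a distance that vanishes at equality.\<close>

lemma energy_lower:
  assumes \<nu>: "\<nu> \<in> prob_measures_on E" and m: "mutual_energy R \<nu> \<nu> = ennreal m" "m \<ge> 0"
  shows "gauss_dist 1 \<nu> \<mu> \<le> ennreal (m - 2 * ln (R / C))" and "2 * ln (R / C) \<le> m"
proof -
  note nu = prob_measures_on_AE[OF \<nu>]
  have \<mu>B: "AE z in \<mu>k k. z \<in> cball 0 B" for k
    unfolding \<mu>k_def using Zk_bound by (subst AE_distr_iff) auto
  have le: "gauss_dist 1 \<nu> (\<mu>k k) \<le> ennreal (m - 2 * ln (rad k * R / C)) \<and> 2 * ln (rad k * R / C) \<le> m" for k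
  proof -
    define x where "x = 2 * ln (rad k * R / C)"
    have x: "x \<ge> 0" unfolding x_def by (rule C_le_R)
    have "2 * mutual_energy R \<nu> (\<mu>k k) + gauss_dist 1 \<nu> (\<mu>k k) \<le> mutual_energy R \<nu> \<nu> + mutual_energy R (\<mu>k k) (\<mu>k k)"
      by (rule mutual_energy_le[OF nu(1,2,4) prob_\<mu>(3,4) \<mu>B R(3,2)])
    also have "\<dots> \<le> ennreal m + ennreal x"
      unfolding m x_def by (intro add_left_mono mutual_energy_self)
    finally have "2 * ennreal x + gauss_dist 1 \<nu> (\<mu>k k) \<le> ennreal m + ennreal x"
      by (simp add: mutual_energy_outer[OF \<nu>] x_def)
    hence "ennreal x + (ennreal x + gauss_dist 1 \<nu> (\<mu>k k)) \<le> ennreal x + ennreal m"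
      by (simp add: mult_2 add_ac)
    hence *: "ennreal x + gauss_dist 1 \<nu> (\<mu>k k) \<le> ennreal m"
      by (subst (asm) ennreal_add_left_cancel_le) auto
    then obtain g where g: "gauss_dist 1 \<nu> (\<mu>k k) = ennreal g" "g \<ge> 0"
      by (cases "gauss_dist 1 \<nu> (\<mu>k k)") (auto simp: top_unique)
    have "x + g \<le> m" using * x g m by (simp flip: ennreal_plus)
    thus ?thesis using g x by (auto simp: x_def intro!: ennreal_leI)
  qed
  have "gauss_dist 1 \<nu> \<mu> \<le> liminf (\<lambda>k. gauss_dist 1 \<nu> (\<mu>k k))" by (rule gauss_dist_lsc[OF nu(1,2)])
  also have "\<dots> \<le> liminf (\<lambda>k. ennreal (m - 2 * ln (rad k * R / C)))"
    using le by (intro Liminf_mono always_eventually allI) blast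
  also have "\<dots> = ennreal (m - 2 * ln (R / C))"
    by (intro lim_imp_Liminf tendsto_ennrealI tendsto_diff tendsto_const lim_value) simp
  finally show "gauss_dist 1 \<nu> \<mu> \<le> ennreal (m - 2 * ln (R / C))" .
  show "2 * ln (R / C) \<le> m" using le by (intro LIMSEQ_le_const2[OF lim_value]) auto
qed

lemma log_energy_\<mu>: "log_energy \<mu> = ereal (- ln C)"
  and log_energy_ge: "\<nu> \<in> prob_measures_on E \<Longrightarrow> ereal (- ln C) \<le> log_energy \<nu>"
  and log_energy_unique: "\<nu> \<in> prob_measures_on E \<Longrightarrow> log_energy \<nu> = ereal (- ln C) \<Longrightarrow> \<nu> = \<mu>"
proof -
  have lnRC: "ln (R / C) = ln R - ln C" using R C by (simp add: ln_div)
  have *: "ereal (- ln C) \<le> log_energy \<nu>" "log_energy \<nu> = ereal (- ln C) \<Longrightarrow> \<nu> = \<mu>"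
    "mutual_energy R \<nu> \<nu> \<le> ennreal (2 * ln (R / C)) \<Longrightarrow> log_energy \<nu> \<le> ereal (- ln C)"
    if \<nu>: "\<nu> \<in> prob_measures_on E" for \<nu>
  proof -
    note nu = prob_measures_on_AE[OF \<nu>]
    note le = log_energy_mutual_energy[OF nu(1,2,4) R(3,1)]
    show "ereal (- ln C) \<le> log_energy \<nu>"
    proof (cases "mutual_energy R \<nu> \<nu>")
      case (real m)
      thus ?thesis using le(2)[of m] energy_lower(2)[OF \<nu> real(2,1)] by (simp add: lnRC)
    qed (use le(1) in auto)
    show "\<nu> = \<mu>" if eq: "log_energy \<nu> = ereal (- ln C)"
    proof (cases "mutual_energy R \<nu> \<nu>")
      case (real m)
      have "m = 2 * ln (R / C)" using le(2)[of m] real eq by (simp add: lnRC)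
      hence "gauss_dist 1 \<nu> \<mu> = 0" using energy_lower(1)[OF \<nu> real(2,1)] by simp
      thus ?thesis by (intro gauss_dist_0_imp_eq nu prob_\<mu>)
    qed (use le(1) eq in auto)
    show "log_energy \<nu> \<le> ereal (- ln C)" if M: "mutual_energy R \<nu> \<nu> \<le> ennreal (2 * ln (R / C))"
    proof (cases "mutual_energy R \<nu> \<nu>")
      case (real m)
      have "0 \<le> 2 * ln (R / C)" using C_le_R by (intro LIMSEQ_le_const[OF lim_value]) auto
      hence "m \<le> 2 * ln (R / C)" using M real by simp
      thus ?thesis using le(2)[of m] real by (simp add: lnRC)
    qed (use M in \<open>auto simp: top_unique\<close>)
  qed
  show "\<nu> \<in> prob_measures_on E \<Longrightarrow> ereal (- ln C) \<le> log_energy \<nu>"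
    "\<nu> \<in> prob_measures_on E \<Longrightarrow> log_energy \<nu> = ereal (- ln C) \<Longrightarrow> \<nu> = \<mu>" using * by auto
  show "log_energy \<mu> = ereal (- ln C)"
    using *(1,3)[OF \<mu>_prob_measure] mutual_energy_\<mu> by (intro antisym) auto
qed

lemma robin_const_eq: "robin_const E = ereal (- ln C)"
  unfolding robin_const_def
  by (intro antisym INF_greatest log_energy_ge INF_lower2[OF \<mu>_prob_measure]) (simp_all add: log_energy_\<mu>)

lemma log_cap_eq: "log_cap E = C"
  using C by (simp add: log_cap_def robin_const_eq)

lemma equilibrium_measure_eq: "equilibrium_measure E = \<mu>"
  unfolding equilibrium_measure_def robin_const_eq
  by (intro the_equality conjI \<mu>_prob_measure log_energy_\<mu>) (auto intro: log_energy_unique)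

end

section \<open>Moments of the equilibrium measure\<close>

lemma holomorphic_has_fps_expansion:
  assumes "f holomorphic_on ball 0 1"
  shows "f has_fps_expansion Abs_fps (\<lambda>n. (deriv ^^ n) f 0 / fact n)"
proof (rule has_fps_expansionI)
  have "\<forall>\<^sub>F u in nhds (0::complex). u \<in> ball 0 1" by (intro eventually_nhds_in_open) auto
  thus "\<forall>\<^sub>F u in nhds 0. (\<lambda>n. fps_nth (Abs_fps (\<lambda>n. (deriv ^^ n) f 0 / fact n)) n * u ^ n) sums f u"
    by eventually_elim (use holomorphic_power_series[OF assms] in auto)
qed

lemma has_fps_expansion_coeff:
  assumes "f has_fps_expansion F" "\<And>u. u \<in> ball 0 1 \<Longrightarrow> f u = g u"
  shows "fps_nth F n = (deriv ^^ n) g (0 :: complex) / fact n"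
proof -
  have "\<forall>\<^sub>F u in nhds (0::complex). f u = g u"
    by (rule eventually_mono[OF eventually_nhds_in_open[of "ball 0 1"]]) (use assms(2) in auto)
  hence "(deriv ^^ n) f 0 = (deriv ^^ n) g 0" by (rule higher_deriv_cong_ev) simp
  thus ?thesis using fps_nth_fps_expansion[OF assms(1)] by simp
qed

text \<open>The area theorem is applied to the odd function \<open>s (u\<^sup>2) / u\<close>, a square root of \<open>k (u\<^sup>2) / u\<^sup>2\<close>.\<close>
lemma sqrt_transform_area:
  assumes k: "k holomorphic_on ball 0 1" "k 0 = 1" "\<And>u. u \<in> ball 0 1 \<Longrightarrow> k u \<noteq> 0"
    and inj: "inj_on (\<lambda>u. k u / u) (ball 0 1 - {0})"
  obtains s where "s holomorphic_on ball 0 1" "s 0 = 1" "\<And>u. u \<in> ball 0 1 \<Longrightarrow> (s u)\<^sup>2 = k u"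
    "\<And>N. (\<Sum>n=1..N. (2 * real n - 1) * (cmod ((deriv ^^ n) s 0 / fact n))\<^sup>2) \<le> 1"
proof -
  obtain l where l: "l holomorphic_on ball 0 1" "\<And>u. u \<in> ball 0 1 \<Longrightarrow> k u = exp (l u)"
    using contractible_imp_holomorphic_log[OF k(1) convex_imp_contractible[OF convex_ball] k(3)] by metis
  define s where "s u = exp ((l u - l 0) / 2)" for u
  have sh: "s holomorphic_on ball 0 1" unfolding s_def by (intro holomorphic_intros l) auto
  have s0: "s 0 = 1" by (simp add: s_def)
  have el0: "exp (l 0) = 1" using l(2)[of 0] k(2) by simp
  have s2: "(s u)\<^sup>2 = k u" if u: "u \<in> ball 0 1" for u
  proof -
    have "(s u)\<^sup>2 = exp (l u - l 0)" by (simp add: s_def power2_eq_square flip: exp_add)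
    thus ?thesis using l(2)[OF u] el0 by (simp add: exp_diff)
  qed
  define a where "a n = (deriv ^^ n) s 0 / fact n" for n
  have a0: "a 0 = 1" by (simp add: a_def s0)
  obtain m where m: "m holomorphic_on ball 0 1" "\<And>u. u \<in> ball 0 1 \<Longrightarrow> s u - 1 = u * m u"
  proof (rule holomorphic_factor_zero)
    show "(\<lambda>u. s u - 1) holomorphic_on ball 0 1" by (intro holomorphic_intros sh)
    show "s 0 - 1 = 0" by (simp add: s0)
  qed (rule that; assumption)
  define f where "f u = u * m (u\<^sup>2)" for u
  have sq: "u\<^sup>2 \<in> ball 0 1" if "u \<in> ball 0 1" for u :: complex
    using that by (simp add: norm_power power_less_one_iff)
  have fh: "f holomorphic_on ball 0 1" unfolding f_def
    by (intro holomorphic_intros holomorphic_on_compose_gen[OF _ m(1), unfolded comp_def]) (use sq in auto)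
  have fS: "1 / u + f u = s (u\<^sup>2) / u" if "u \<in> ball 0 1 - {0}" for u
    using m(2)[OF sq[of u]] that by (simp add: f_def field_simps power2_eq_square)
  have finj: "inj_on (\<lambda>u. 1 / u + f u) (ball 0 1 - {0})"
  proof (rule inj_onI)
    fix u v assume uv: "u \<in> ball 0 1 - {0}" "v \<in> ball 0 1 - {0}" "1 / u + f u = 1 / v + f v"
    hence eq: "s (u\<^sup>2) / u = s (v\<^sup>2) / v" using fS by simp
    hence "(s (u\<^sup>2) / u)\<^sup>2 = (s (v\<^sup>2) / v)\<^sup>2" by simp
    hence "k (u\<^sup>2) / u\<^sup>2 = k (v\<^sup>2) / v\<^sup>2" using s2 sq uv by (simp add: power_divide)
    hence "u\<^sup>2 = v\<^sup>2" using inj_onD[OF inj, of "u\<^sup>2" "v\<^sup>2"] sq uv by auto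
    hence "u = v \<or> u = - v" by (simp add: power2_eq_iff)
    \<comment> \<open>The function s(u^2) / u is odd and never zero, so it separates u from
      -u.\<close>
    moreover have "u \<noteq> - v"
    proof
      assume "u = - v"
      with eq uv have "s (v\<^sup>2) = 0" by (simp add: field_simps)
      thus False by (simp add: s_def)
    qed
    ultimately show "u = v" by simp
  qed
  define d where "d n = (deriv ^^ n) f 0 / fact n" for n
  \<comment> \<open>The coefficient of \<open>f\<close> at index 2 n - 1 is \<open>a n\<close>, so
    the area weight of \<open>a n\<close> is 2 n - 1.\<close>
  have d: "d (2 * j + 1) = a (j + 1)" for j
  proof -
    let ?D = "\<lambda>n. if odd n then a ((n + 1) div 2) else 0"
    have "f has_fps_expansion Abs_fps ?D"
    proof (rule has_fps_expansionI)
      have "\<forall>\<^sub>F u in nhds (0::complex). u \<in> ball 0 1" by (intro eventually_nhds_in_open) auto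
      thus "\<forall>\<^sub>F u in nhds 0. (\<lambda>n. fps_nth (Abs_fps ?D) n * u ^ n) sums f u"
      proof eventually_elim
        case (elim u)
        show ?case
        proof (cases "u = 0")
          case True
          have "(\<lambda>n. fps_nth (Abs_fps ?D) n * 0 ^ n) sums fps_nth (Abs_fps ?D) 0" by (rule powser_sums_zero)
          thus ?thesis using True by (simp add: f_def)
        next
          case False
          have "(\<lambda>n. a n * (u\<^sup>2) ^ n) sums s (u\<^sup>2)"
            using holomorphic_power_series[OF sh, of "u\<^sup>2"] sq[OF elim] by (simp add: a_def)
          hence "(\<lambda>n. a (Suc n) * (u\<^sup>2) ^ Suc n) sums (s (u\<^sup>2) - a 0 * (u\<^sup>2) ^ 0)"
            by (subst sums_Suc_iff) simp
          hence "(\<lambda>n. a (Suc n) * (u\<^sup>2) ^ Suc n / u) sums ((s (u\<^sup>2) - 1) / u)"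
            by (intro sums_divide) (simp add: a0)
          moreover have "(s (u\<^sup>2) - 1) / u = f u" using m(2)[OF sq[OF elim]] False by (simp add: f_def power2_eq_square)
          moreover have "a (Suc n) * (u\<^sup>2) ^ Suc n / u = ?D (2 * n + 1) * u ^ (2 * n + 1)" for n
            using False by (simp add: power_mult power2_eq_square)
          ultimately have "(\<lambda>n. (\<lambda>n. ?D n * u ^ n) (2 * n + 1)) sums f u" by simp
          hence "(\<lambda>n. ?D n * u ^ n) sums f u"
            by (subst (asm) sums_mono_reindex) (auto simp: strict_mono_def elim!: oddE)
          thus ?thesis by simp
        qed
      qed
    qed
    from has_fps_expansion_coeff[OF this, of f "2 * j + 1"] show ?thesis by (simp add: d_def)
  qed
  have "(\<Sum>n=1..N. (2 * real n - 1) * (cmod (a n))\<^sup>2) \<le> 1" for N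
  proof -
    have "(\<Sum>n=1..N. (2 * real n - 1) * (cmod (a n))\<^sup>2) = (\<Sum>n\<in>(\<lambda>n. 2 * n - 1) ` {1..N}. real n * (cmod (d n))\<^sup>2)"
    proof (subst sum.reindex)
      show "inj_on (\<lambda>n. 2 * n - 1) {1..N}" by (auto simp: inj_on_def)
      show "(\<Sum>n=1..N. (2 * real n - 1) * (cmod (a n))\<^sup>2) = sum ((\<lambda>n. real n * (cmod (d n))\<^sup>2) \<circ> (\<lambda>n. 2 * n - 1)) {1..N}"
      proof (intro sum.cong refl)
        fix n assume "n \<in> {1..N}"
        then obtain j where j: "n = j + 1" by (metis atLeastAtMost_iff le_iff_add add.commute)
        show "(2 * real n - 1) * (cmod (a n))\<^sup>2 = ((\<lambda>n. real n * (cmod (d n))\<^sup>2) \<circ> (\<lambda>n. 2 * n - 1)) n"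
          using d[of j] by (simp add: j)
      qed
    qed
    also have "\<dots> \<le> (\<Sum>n=1..2*N. real n * (cmod (d n))\<^sup>2)"
      by (intro sum_mono2) auto
    also have "\<dots> \<le> 1" unfolding d_def by (rule area_theorem[OF fh finj])
    finally show ?thesis .
  qed
  thus ?thesis by (intro that[OF sh s0 s2]) (auto simp: a_def)
qed

text \<open>For an omitted value \<open>w\<close> the function u (1/u + h u - w) is zero-free with
  value 1 at 0, so it has a square root. Squaring the series identifies \<open>a 1\<close>, which
  measures the distance from \<open>h 0\<close> to \<open>w\<close>, and relates \<open>a 2\<close>
  to \<open>deriv h 0\<close>.\<close>

lemma univalent_sqrt:
  assumes h: "h holomorphic_on ball 0 1" and inj: "inj_on (\<lambda>u. 1 / u + h u) (ball 0 1 - {0})"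
    and nz: "\<And>u. u \<in> ball 0 1 - {0} \<Longrightarrow> 1 / u + h u \<noteq> w"
  obtains a where "\<And>u. u \<in> ball 0 1 \<Longrightarrow> \<exists>s. (\<lambda>n. a n * u ^ n) sums s \<and> s\<^sup>2 = 1 + u * (h u - w)"
    "a 0 = 1" "a 1 = (h 0 - w) / 2" "2 * a 2 + (a 1)\<^sup>2 = deriv h 0"
    "\<And>N. (\<Sum>n=1..N. (2 * real n - 1) * (cmod (a n))\<^sup>2) \<le> 1"
proof -
  define k where "k u = 1 + u * (h u - w)" for u
  have kS: "k u / u = 1 / u + h u - w" if "u \<noteq> 0" for u using that by (simp add: k_def field_simps)
  have kh: "k holomorphic_on ball 0 1" unfolding k_def by (intro holomorphic_intros h)
  have knz: "k u \<noteq> 0" if u: "u \<in> ball 0 1" for u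
  proof (cases "u = 0")
    case False
    thus ?thesis using kS[OF False] nz[of u] u by auto
  qed (simp add: k_def)
  have kinj: "inj_on (\<lambda>u. k u / u) (ball 0 1 - {0})"
    using inj by (auto simp: inj_on_def kS)
  obtain s where s: "s holomorphic_on ball 0 1" "s 0 = 1" "\<And>u. u \<in> ball 0 1 \<Longrightarrow> (s u)\<^sup>2 = k u"
    "\<And>N. (\<Sum>n=1..N. (2 * real n - 1) * (cmod ((deriv ^^ n) s 0 / fact n))\<^sup>2) \<le> 1"
    using sqrt_transform_area[OF kh _ knz kinj] by (auto simp: k_def)
  define a where "a n = (deriv ^^ n) s 0 / fact n" for n
  have A: "s has_fps_expansion Abs_fps a" using holomorphic_has_fps_expansion[OF s(1)] by (simp add: a_def[abs_def])
  define H where "H = Abs_fps (\<lambda>n. (deriv ^^ n) h 0 / fact n)"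
  have H: "h has_fps_expansion H" unfolding H_def by (rule holomorphic_has_fps_expansion[OF h])
  have "(\<lambda>u. 1 + u * (h u - w)) has_fps_expansion 1 + fps_X * (H - fps_const w)"
    by (intro fps_expansion_intros H)
  from has_fps_expansion_coeff[OF this, of "\<lambda>u. s u * s u"]
  have K: "fps_nth (1 + fps_X * (H - fps_const w)) n = (deriv ^^ n) (\<lambda>u. s u * s u) 0 / fact n" for n
    using s(3) by (simp add: k_def power2_eq_square)
  have AA: "fps_nth (Abs_fps a * Abs_fps a) n = fps_nth (1 + fps_X * (H - fps_const w)) n" for n
    unfolding K using has_fps_expansion_mult[OF A A] by (rule fps_nth_fps_expansion)
  have a0: "a 0 = 1" by (simp add: a_def s)
  have a1: "a 1 = (h 0 - w) / 2"
    using AA[of 1] a0 by (simp add: fps_mult_nth_1 H_def field_simps)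
  have a2: "2 * a 2 + (a 1)\<^sup>2 = deriv h 0"
    using AA[of 2] a0 by (simp add: fps_mult_nth H_def numeral_2_eq_2 power2_eq_square)
  have sums: "\<exists>s. (\<lambda>n. a n * u ^ n) sums s \<and> s\<^sup>2 = 1 + u * (h u - w)" if "u \<in> ball 0 1" for u
    using holomorphic_power_series[OF s(1), of u] s(3)[of u] that by (intro exI[of _ "s u"]) (simp add: a_def k_def)
  show thesis by (rule that[of a]) (fact sums a0 a1 a2 s(4)[folded a_def])+
qed

section \<open>Numerical inequalities\<close>

lemma ln_le_quadratic:
  fixes x :: real
  assumes "0 \<le> x" "x \<le> 2"
  defines "y \<equiv> (x - 4 / 3) * (3 / 10)"
  shows "ln (2 + x) \<le> ln (10 / 3) + y - 13 / 30 * y\<^sup>2"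
proof -
  \<comment> \<open>Here 2 + x = 10/3 (1 + y). The centre 4/3 lies just above 13/10, the largest
    bound obtained for the mean of \<open>X\<close>.\<close>
  have y: "y > -1" "y \<le> 1 / 5" using assms by (auto simp: y_def)
  \<comment> \<open>The derivative t^3 / (1 + t) has the sign of t, so \<open>f\<close> is smallest
    at 0 and the cubic Taylor polynomial dominates ln (1 + y) for either sign of y.\<close>
  define f where "f t = t - t\<^sup>2 / 2 + t ^ 3 / 3 - ln (1 + t)" for t :: real
  have df: "(f has_real_derivative t ^ 3 / (1 + t)) (at t)" if "t > -1" for t
    unfolding f_def using that
    by (auto intro!: derivative_eq_intros simp: field_simps power2_eq_square power3_eq_cube)
  have "f y \<ge> f 0"
  proof (cases "y \<ge> 0")
    case True
    show ?thesis
    proof (rule DERIV_nonneg_imp_nondecreasing[OF True])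
      fix t :: real assume "0 \<le> t" "t \<le> y"
      thus "\<exists>d. DERIV f t :> d \<and> d \<ge> 0" using df[of t] by (intro exI[of _ "t ^ 3 / (1 + t)"]) auto
    qed
  next
    case False
    show ?thesis
    proof (rule DERIV_nonpos_imp_nonincreasing[of y 0 f])
      show "y \<le> 0" using False by simp
      fix t :: real assume t: "y \<le> t" "t \<le> 0"
      have "t ^ 3 \<le> 0" using t by (simp add: power3_eq_cube mult_nonneg_nonpos)
      thus "\<exists>d. (f has_real_derivative d) (at t) \<and> d \<le> 0"
        using df[of t] t y by (intro exI[of _ "t ^ 3 / (1 + t)"]) (auto simp: divide_nonpos_pos)
    qed
  qed
  hence 1: "ln (1 + y) \<le> y - y\<^sup>2 / 2 + y ^ 3 / 3" by (simp add: f_def)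
  have "y ^ 3 \<le> 1 / 5 * y\<^sup>2"
    unfolding power3_eq_cube power2_eq_square using y by (metis mult.assoc mult_right_mono zero_le_square)
  hence "ln (1 + y) \<le> y - 13 / 30 * y\<^sup>2" using 1 by simp
  moreover have "ln (2 + x) = ln (10 / 3) + ln (1 + y)"
  proof -
    have "2 + x = 10 / 3 * (1 + y)" by (simp add: y_def field_simps)
    moreover have "ln (10 / 3 * (1 + y)) = ln (10 / 3) + ln (1 + y)" using y by (subst ln_mult) auto
    ultimately show ?thesis by (simp only:)
  qed
  ultimately show ?thesis by linarith
qed

text \<open>For the final comparison 3.2617 < 2 + 4 / pi any bound pi < 3.17 is enough. Since sin
  (pi / 6) = 1 / 2, it suffices that the sine exceeds 1 / 2 at 3.156 / 6 = 0.526.\<close>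

lemma pi_less_3156: "pi < 3.156"
proof -
  define x :: real where "x = 0.526"
  define e where "e = inverse (fact 5) * \<bar>x\<bar> ^ 5"
  have "\<bar>sin x - (\<Sum>m<5. sin_coeff m * x ^ m)\<bar> \<le> e"
    unfolding e_def by (rule Maclaurin_sin_bound)
  moreover have "(\<Sum>m<5. sin_coeff m * x ^ m) = x - x ^ 3 / 6"
  proof -
    have "{..<5} = {0, 1, 2, 3, 4 :: nat}" by auto
    thus ?thesis by (simp add: sin_coeff_def fact_numeral)
  qed
  ultimately have "sin x \<ge> x - x ^ 3 / 6 - e" by linarith
  moreover have "e < 0.001" by (simp add: e_def x_def fact_numeral power_divide)
  moreover have "x - x ^ 3 / 6 > 0.501" by (simp add: x_def power_divide)
  ultimately have "sin x > 1 / 2" by simp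
  hence "sin (pi / 6) < sin x" by (simp add: sin_30)
  moreover have "pi / 6 \<le> pi / 2" "- (pi / 2) \<le> pi / 6" "- (pi / 2) \<le> x" "x \<le> pi / 2"
    using pi_ge_two by (auto simp: x_def intro: order_trans[of _ 0])
  ultimately have "pi / 6 < x" using sin_mono_less_eq by blast
  thus ?thesis by (simp add: x_def)
qed

section \<open>Center of mass, moments of the distance to it and the resulting bound\<close>

context exterior_conformal
begin

definition "ctr = of_real C * h 0"

text \<open>On every circle 1/u has mean zero and \<open>h\<close> has mean h 0, so all level curve
  measures share this center, and it passes to the limit.\<close>

lemma ctr_eq: "(\<integral>z. z \<partial>\<mu>) = ctr"
proof -
  have "(\<integral>z. z \<partial>\<mu>k k) = ctr" for k
  proof -
    have r: "0 < rad k" "rad k < 1" using rad by auto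
    have hc: "continuous_on (cball 0 (rad k)) h" "h holomorphic_on ball 0 (rad k)"
      using r by (auto intro!: holomorphic_on_imp_continuous_on holomorphic_on_subset[OF h])
    have hi: "integrable circ (\<lambda>t. h (of_real (rad k) * ucis t))"
      using r by (intro circ_integrable_continuous h_cont_circle) auto
    have ci: "integrable circ (\<lambda>t. cnj (ucis t))" by (intro circ_integrable_continuous continuous_intros)
    have c0: "(\<integral>t. cnj (ucis t) \<partial>circ) = 0" using ucis_orthogonal[of 0 1] by simp
    have "(\<integral>z. z \<partial>\<mu>k k) = (\<integral>t. Zk k t \<partial>circ)" by (simp add: \<mu>k_def integral_distr)
    also have "\<dots> = (\<integral>t. of_real C * (cnj (ucis t) / of_real (rad k) + h (of_real (rad k) * ucis t)) \<partial>circ)"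
    proof (intro Bochner_Integration.integral_cong refl)
      fix t
      have "1 / (of_real (rad k) * ucis t) = cnj (ucis t) / of_real (rad k)"
        using r by (simp add: field_simps)
      thus "Zk k t = of_real C * (cnj (ucis t) / of_real (rad k) + h (of_real (rad k) * ucis t))"
        by (simp add: Zk_def F_def)
    qed
    also have "\<dots> = of_real C * ((\<integral>t. cnj (ucis t) \<partial>circ) / of_real (rad k) + (\<integral>t. h (of_real (rad k) * ucis t) \<partial>circ))"
      using hi ci by simp
    also have "\<dots> = ctr" unfolding fourier_mean[OF hc r(1)] c0 by (simp add: ctr_def)
    finally show ?thesis .
  qed
  thus ?thesis using integral_converges[of "\<lambda>z. z"] LIMSEQ_unique[OF _ tendsto_const] by (auto intro: continuous_intros)
qed

lemma omits: "w \<in> E \<Longrightarrow> u \<in> ball 0 1 - {0} \<Longrightarrow> 1 / u + h u \<noteq> w / of_real C"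
proof
  assume w: "w \<in> E" "u \<in> ball 0 1 - {0}" "1 / u + h u = w / of_real C"
  hence "F u = w" using C by (simp add: F_def)
  thus False using F_outside[OF w(2)] w(1) outside_no_overlap by blast
qed

text \<open>The term n = 1 of the area sum for the square root at the omitted value w / C says |a 1|
  <= 1.\<close>

lemma dist_ctr_le: "w \<in> E \<Longrightarrow> cmod (w - ctr) \<le> 2 * C"
proof -
  assume w: "w \<in> E"
  obtain a where "\<And>u. u \<in> ball 0 1 \<Longrightarrow> \<exists>s. (\<lambda>n. a n * u ^ n) sums s \<and> s\<^sup>2 = 1 + u * (h u - w / of_real C)"
    "a 0 = 1" and a: "a 1 = (h 0 - w / of_real C) / 2" and "2 * a 2 + (a 1)\<^sup>2 = deriv h 0"
    and a': "\<And>N. (\<Sum>n=1..N. (2 * real n - 1) * (cmod (a n))\<^sup>2) \<le> 1"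
    by (rule univalent_sqrt[OF h inj omits[OF w]], assumption) (rule that; assumption)
  have "(cmod (a 1))\<^sup>2 \<le> 1" using a'[of 1] by simp
  hence "cmod (a 1) \<le> 1" using power2_le_imp_le[of "cmod (a 1)" 1] by simp
  hence "cmod (h 0 - w / of_real C) \<le> 2" unfolding a by (simp add: norm_divide)
  hence "C * cmod (h 0 - w / of_real C) \<le> C * 2" using C by (intro mult_left_mono) auto
  also have "C * cmod (h 0 - w / of_real C) = cmod (of_real C * (h 0 - w / of_real C))" using C by (simp add: norm_mult)
  also have "of_real C * (h 0 - w / of_real C) = ctr - w" using C by (simp add: ctr_def right_diff_distrib)
  finally show ?thesis by (simp add: norm_minus_commute mult.commute)
qed

definition "\<tau> = (cmod (deriv h 0))\<^sup>2"

lemma tau: "0 \<le> \<tau>" "\<tau> \<le> 1"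
  using area[of 1] by (auto simp: \<tau>_def c_def)

definition "X z = cmod (z - ctr) / C"

lemma X_cont: "continuous_on UNIV X"
  unfolding X_def using C by (intro continuous_intros) auto

lemma X_Zk: "X (Zk k t) = cmod (1 + of_real (rad k) * ucis t * (h (of_real (rad k) * ucis t) - h 0)) / rad k"
proof -
  define u where "u = of_real (rad k) * ucis t"
  have u: "u \<noteq> 0" "cmod u = rad k" using rad[of k] by (auto simp: u_def norm_mult)
  have "Zk k t - ctr = of_real C * ((1 + u * (h u - h 0)) / u)"
    using u(1) unfolding Zk_def F_def ctr_def u_def[symmetric] by (simp add: field_simps)
  thus ?thesis using C u by (simp add: X_def norm_mult norm_divide u_def[symmetric])
qed

text \<open>On a level curve \<open>X\<close> is |s|^2 divided by \<open>rad k\<close>, where s is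
  the square root at the omitted value h 0, so its mean is a Parseval sum. There \<open>a 1\<close>
  = 0 and |a 2|^2 = \<tau>/4; from n = 3 on the area weights are at least 5. Altogether 1 + \<tau>/4
  + (1 - 3 \<tau>/4)/5.\<close>

lemma first_moment:
  assumes "ctr \<in> E"
  shows "(\<integral>z. X z \<partial>\<mu>) \<le> 6 / 5 + \<tau> / 10"
proof -
  have "ctr / of_real C = h 0" using C by (simp add: ctr_def)
  with omits[OF assms] have om: "\<And>u. u \<in> ball 0 1 - {0} \<Longrightarrow> 1 / u + h u \<noteq> h 0" by simp
  obtain a where a: "\<And>u. u \<in> ball 0 1 \<Longrightarrow> \<exists>s. (\<lambda>n. a n * u ^ n) sums s \<and> s\<^sup>2 = 1 + u * (h u - h 0)"
    "a 0 = 1" "a 1 = (h 0 - h 0) / 2" "2 * a 2 + (a 1)\<^sup>2 = deriv h 0"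
    "\<And>N. (\<Sum>n=1..N. (2 * real n - 1) * (cmod (a n))\<^sup>2) \<le> 1"
    by (rule univalent_sqrt[OF h inj om], assumption) (rule that; assumption)
  define s where "s u = (\<Sum>n. a n * u ^ n)" for u
  have s: "(\<lambda>n. a n * u ^ n) sums s u" "(s u)\<^sup>2 = 1 + u * (h u - h 0)" if "u \<in> ball 0 1" for u
    using a(1)[OF that] by (auto simp: s_def sums_iff)
  have a1: "a 1 = 0" using a(3) by simp
  have a2: "(cmod (a 2))\<^sup>2 = \<tau> / 4"
  proof -
    have "a 2 = deriv h 0 / 2" using a(4) a1 by (simp add: field_simps)
    thus ?thesis by (simp only: \<tau>_def norm_divide power_divide) simp
  qed
  have bound: "(\<integral>z. X z \<partial>\<mu>k k) \<le> (6 / 5 + \<tau> / 10) / rad k" for k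
  proof -
    have r: "0 < rad k" "rad k < 1" using rad by auto
    have "(\<integral>z. X z \<partial>\<mu>k k) = (\<integral>t. X (Zk k t) \<partial>circ)"
      using borel_measurable_continuous_onI[OF X_cont] by (simp add: \<mu>k_def integral_distr)
    also have "\<dots> = (\<integral>t. (cmod (s (of_real (rad k) * ucis t)))\<^sup>2 / rad k \<partial>circ)"
      using circle_in_ball[of k] by (simp add: X_Zk s(2)[symmetric] norm_power)
    also have "\<dots> = (\<integral>t. (cmod (s (of_real (rad k) * ucis t)))\<^sup>2 \<partial>circ) / rad k" by simp
    also have "(\<integral>t. (cmod (s (of_real (rad k) * ucis t)))\<^sup>2 \<partial>circ) \<le> 6 / 5 + \<tau> / 10"
    proof -
      have sm: "(\<lambda>n. (cmod (a n))\<^sup>2 * rad k ^ (2 * n)) sums (\<integral>t. (cmod (s (of_real (rad k) * ucis t)))\<^sup>2 \<partial>circ)"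
        by (rule parseval[OF s(1) r])
      have "(\<Sum>n. (cmod (a n))\<^sup>2 * rad k ^ (2 * n)) \<le> 6 / 5 + \<tau> / 10"
      proof (rule suminf_le_const)
        show "summable (\<lambda>n. (cmod (a n))\<^sup>2 * rad k ^ (2 * n))" using sm by (simp add: sums_iff)
        fix N :: nat
        have sets: "{0..N+3} = insert 0 (insert 1 (insert 2 {3..N+3}))" "{1..N+3} = insert 1 (insert 2 {3..N+3})"
          by auto
        have "(\<Sum>n<N. (cmod (a n))\<^sup>2 * rad k ^ (2 * n)) \<le> (\<Sum>n<N. (cmod (a n))\<^sup>2)"
          using r by (intro sum_mono mult_left_le power_le_one) auto
        also have "\<dots> \<le> (\<Sum>n=0..N+3. (cmod (a n))\<^sup>2)" by (intro sum_mono2) auto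
        also have "\<dots> = (cmod (a 0))\<^sup>2 + (cmod (a 1))\<^sup>2 + (cmod (a 2))\<^sup>2 + (\<Sum>n=3..N+3. (cmod (a n))\<^sup>2)"
          unfolding sets by simp
        also have "\<dots> = 1 + \<tau> / 4 + (\<Sum>n=3..N+3. (cmod (a n))\<^sup>2)" by (simp add: a(2) a1[unfolded One_nat_def] a1 a2)
        also have "(\<Sum>n=3..N+3. (cmod (a n))\<^sup>2) \<le> (1 - 3 * \<tau> / 4) / 5"
        proof -
          have "5 * (\<Sum>n=3..N+3. (cmod (a n))\<^sup>2) \<le> (\<Sum>n=3..N+3. (2 * real n - 1) * (cmod (a n))\<^sup>2)"
            unfolding sum_distrib_left by (intro sum_mono mult_right_mono) auto
          also have "\<dots> = (\<Sum>n=1..N+3. (2 * real n - 1) * (cmod (a n))\<^sup>2) - 3 * (\<tau> / 4)"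
            using a1 a2 unfolding sets by simp
          also have "\<dots> \<le> 1 - 3 * (\<tau> / 4)" using a(5)[of "N + 3"] by simp
          finally show ?thesis by simp
        qed
        finally show "(\<Sum>n<N. (cmod (a n))\<^sup>2 * rad k ^ (2 * n)) \<le> 6 / 5 + \<tau> / 10" by (simp add: field_simps)
      qed
      thus ?thesis using sm by (simp add: sums_iff)
    qed
    finally show ?thesis using r by (simp add: divide_right_mono)
  qed
  have "(\<lambda>k. (6 / 5 + \<tau> / 10) / rad k) \<longlonglongrightarrow> (6 / 5 + \<tau> / 10) / 1"
    by (intro tendsto_intros rad_lim) auto
  from LIMSEQ_le[OF integral_converges[OF X_cont] this] show ?thesis using bound by auto
qed

text \<open>Parseval for 1 + u (h u - h 0) itself, whose coefficients of index 0 and 2 contribute 1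
  and \<tau>.\<close>

lemma second_moment: "1 + \<tau> \<le> (\<integral>z. (X z)\<^sup>2 \<partial>\<mu>)"
proof -
  define q where "q u = 1 + u * (h u - h 0)" for u
  have qh: "q holomorphic_on ball 0 1" unfolding q_def by (intro holomorphic_intros h)
  define b where "b n = (deriv ^^ n) q 0 / fact n" for n
  have bs: "(\<lambda>n. b n * u ^ n) sums q u" if "u \<in> ball 0 1" for u
    using holomorphic_power_series[OF qh, of u] that by (simp add: b_def)
  have bq: "b n = fps_nth (1 + fps_X * (Abs_fps (\<lambda>n. (deriv ^^ n) h 0 / fact n) - fps_const (h 0))) n" for n
  proof -
    have "(\<lambda>u. 1 + u * (h u - h 0)) has_fps_expansion 1 + fps_X * (Abs_fps (\<lambda>n. (deriv ^^ n) h 0 / fact n) - fps_const (h 0))"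
      by (intro fps_expansion_intros holomorphic_has_fps_expansion h)
    from has_fps_expansion_coeff[OF this, of q n] show ?thesis by (simp add: b_def q_def)
  qed
  have b0: "b 0 = 1" and b2: "(cmod (b 2))\<^sup>2 = \<tau>" by (simp_all add: bq \<tau>_def numeral_2_eq_2)
  have bound: "1 + \<tau> * (rad k)\<^sup>2 \<le> (\<integral>z. (X z)\<^sup>2 \<partial>\<mu>k k)" for k
  proof -
    have r: "0 < rad k" "rad k < 1" using rad by auto
    have "(\<integral>z. (X z)\<^sup>2 \<partial>\<mu>k k) = (\<integral>t. (X (Zk k t))\<^sup>2 \<partial>circ)"
      using borel_measurable_continuous_onI[OF X_cont] by (simp add: \<mu>k_def integral_distr)
    also have "\<dots> = (\<integral>t. (cmod (q (of_real (rad k) * ucis t)))\<^sup>2 \<partial>circ) / (rad k)\<^sup>2"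
      by (simp add: X_Zk q_def power_divide)
    finally have eq0: "(\<integral>z. (X z)\<^sup>2 \<partial>\<mu>k k) = (\<integral>t. (cmod (q (of_real (rad k) * ucis t)))\<^sup>2 \<partial>circ) / (rad k)\<^sup>2" .
    have sm: "(\<lambda>n. (cmod (b n))\<^sup>2 * rad k ^ (2 * n)) sums (\<integral>t. (cmod (q (of_real (rad k) * ucis t)))\<^sup>2 \<partial>circ)"
      by (rule parseval[OF bs r])
    hence eq: "(\<integral>z. (X z)\<^sup>2 \<partial>\<mu>k k) = (\<Sum>n. (cmod (b n))\<^sup>2 * rad k ^ (2 * n)) / (rad k)\<^sup>2"
      unfolding eq0 by (simp add: sums_iff)
    have "(\<Sum>n<3. (cmod (b n))\<^sup>2 * rad k ^ (2 * n)) \<le> (\<Sum>n. (cmod (b n))\<^sup>2 * rad k ^ (2 * n))"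
      using sm r by (intro sum_le_suminf) (auto simp: sums_iff)
    moreover have "(\<Sum>n<3. (cmod (b n))\<^sup>2 * rad k ^ (2 * n)) \<ge> 1 + \<tau> * rad k ^ 4"
      using b2 r by (simp add: b0 numeral_eq_Suc)
    ultimately have "(1 + \<tau> * rad k ^ 4) / (rad k)\<^sup>2 \<le> (\<integral>z. (X z)\<^sup>2 \<partial>\<mu>k k)"
      unfolding eq using r by (intro divide_right_mono) auto
    moreover have "1 \<le> 1 / (rad k)\<^sup>2" using r by (simp add: power_le_one)
    moreover have "(1 + \<tau> * rad k ^ 4) / (rad k)\<^sup>2 = 1 / (rad k)\<^sup>2 + \<tau> * (rad k)\<^sup>2"
      using r by (simp add: field_simps power_numeral_reduce)
    ultimately show ?thesis by linarith
  qed
  have "(\<lambda>k. 1 + \<tau> * (rad k)\<^sup>2) \<longlonglongrightarrow> 1 + \<tau> * 1\<^sup>2" by (intro tendsto_intros rad_lim)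
  moreover have "(\<lambda>k. \<integral>z. (X z)\<^sup>2 \<partial>\<mu>k k) \<longlonglongrightarrow> (\<integral>z. (X z)\<^sup>2 \<partial>\<mu>)"
    by (intro integral_converges continuous_intros X_cont)
  ultimately have "1 + \<tau> * 1\<^sup>2 \<le> (\<integral>z. (X z)\<^sup>2 \<partial>\<mu>)" by (rule LIMSEQ_le) (use bound in auto)
  thus ?thesis by simp
qed

lemma \<mu>_integrable:
  fixes f :: "complex \<Rightarrow> real"
  assumes f: "continuous_on UNIV f"
  shows "integrable \<mu> f"
proof -
  interpret prob_space \<mu> by (rule prob_\<mu>)
  note [measurable_cong] = prob_\<mu>(2)
  have [measurable]: "f \<in> borel_measurable borel" using f by (rule borel_measurable_continuous_onI)
  have "compact (f ` cball 0 B)" by (intro compact_continuous_image continuous_on_subset[OF f]) auto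
  then obtain K where K: "\<And>z. z \<in> cball 0 B \<Longrightarrow> norm (f z) \<le> K"
    by (metis bounded_iff compact_imp_bounded imageI)
  show ?thesis
  proof (rule integrable_const_bound)
    show "AE z in \<mu>. norm (f z) \<le> K"
      using prob_measures_on_AE(4)[OF \<mu>_prob_measure] by eventually_elim (rule K)
  qed measurable
qed

lemma M_const_bound:
  assumes ctr: "ctr \<in> E" and ab: "a \<in> E" "b \<in> E" "a \<noteq> b"
  shows "M_const E < 3.2617"
proof -
  interpret prob_space \<mu> by (rule prob_\<mu>)
  have "E \<noteq> {}" using ab by auto
  have bdd: "bdd_above ((\<lambda>t. cmod (z - t)) ` E)" for z
  proof (rule bdd_aboveI2)
    fix t assume "t \<in> E"
    thus "cmod (z - t) \<le> cmod z + B" using EB norm_triangle_ineq4[of z t] by (auto simp: subset_iff)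
  qed
  have d_ge: "cmod (z - t) \<le> d_fun E z" if "t \<in> E" for z t
    unfolding d_fun_def using that by (intro cSUP_upper bdd)
  have d_lip: "d_fun E z \<le> d_fun E w + cmod (z - w)" for z w
    unfolding d_fun_def[of E z]
  proof (rule cSUP_least[OF \<open>E \<noteq> {}\<close>])
    fix t assume "t \<in> E"
    thus "cmod (z - t) \<le> d_fun E w + cmod (z - w)"
      using d_ge[of t w] norm_triangle_ineq[of "z - w" "w - t"] by simp
  qed
  \<comment> \<open>Two distinct points keep the farthest distance positive everywhere, so its
    logarithm is continuous and hence integrable.\<close>
  have d_pos: "d_fun E z > 0" for z
  proof -
    have "cmod (z - a) > 0 \<or> cmod (z - b) > 0" using ab(3) by auto
    thus ?thesis using d_ge[OF ab(1), of z] d_ge[OF ab(2), of z] by linarith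
  qed
  have "1-lipschitz_on UNIV (d_fun E)"
  proof (intro lipschitz_onI)
    fix x y show "dist (d_fun E x) (d_fun E y) \<le> 1 * dist x y"
      using d_lip[of x y] d_lip[of y x] by (simp add: dist_norm norm_minus_commute)
  qed simp
  hence d_cont: "continuous_on UNIV (d_fun E)" by (rule lipschitz_on_continuous_on)
  have lnd: "integrable \<mu> (\<lambda>z. ln (d_fun E z))"
    using d_pos by (intro \<mu>_integrable continuous_intros d_cont) (auto simp: less_imp_neq[symmetric])
  define Y where "Y z = (X z - 4 / 3) * (3 / 10)" for z
  have Yc: "continuous_on UNIV Y" unfolding Y_def by (intro continuous_intros X_cont)
  have iX: "integrable \<mu> X" "integrable \<mu> (\<lambda>z. (X z)\<^sup>2)"
    by (intro \<mu>_integrable continuous_intros X_cont)+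
  \<comment> \<open>\<open>Y\<close> expands \<open>ln (2 + X)\<close> at \<open>4 / 3\<close>; on \<open>X \<le> 2\<close> it is at most \<open>1 / 5\<close>, where the constant
    \<open>13 / 30 = 1 / 2 - 1 / 15\<close> of the quadratic majorant comes from.\<close>
  let ?b = "\<lambda>z. ln C + ln (10 / 3) + Y z - 13 / 30 * (Y z)\<^sup>2"
  have "(\<integral>z. ln (d_fun E z) \<partial>\<mu>) \<le> (\<integral>z. ?b z \<partial>\<mu>)"
  proof (rule integral_mono_AE[OF lnd])
    show "integrable \<mu> ?b" by (intro \<mu>_integrable continuous_intros Yc)
    show "AE z in \<mu>. ln (d_fun E z) \<le> ?b z"
      using prob_measures_on_AE(3)[OF \<mu>_prob_measure]
    proof eventually_elim
      case (elim z)
      have X: "0 \<le> X z" "X z \<le> 2" using dist_ctr_le[OF elim] C by (auto simp: X_def field_simps)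
      have "d_fun E z \<le> C * (2 + X z)"
        unfolding d_fun_def
      proof (rule cSUP_least[OF \<open>E \<noteq> {}\<close>])
        fix t assume t: "t \<in> E"
        have "cmod (z - t) \<le> cmod (z - ctr) + cmod (t - ctr)"
          using norm_triangle_ineq4[of "z - ctr" "t - ctr"] by simp
        thus "cmod (z - t) \<le> C * (2 + X z)" using dist_ctr_le[OF t] C by (simp add: X_def distrib_left)
      qed
      hence "ln (d_fun E z) \<le> ln (C * (2 + X z))" using d_pos[of z] X C by (subst ln_le_cancel_iff) auto
      also have "\<dots> = ln C + ln (2 + X z)" using X C by (simp add: ln_mult)
      also have "ln (2 + X z) \<le> ln (10 / 3) + Y z - 13 / 30 * (Y z)\<^sup>2"
        unfolding Y_def by (rule ln_le_quadratic[OF X])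
      finally show ?case by simp
    qed
  qed
  also have "(\<integral>z. ?b z \<partial>\<mu>) = (\<integral>z. ln C + ln (10 / 3) + (101 / 250 * X z - 39 / 1000 * (X z)\<^sup>2 - 352 / 750) \<partial>\<mu>)"
    by (intro Bochner_Integration.integral_cong refl) (simp add: Y_def power2_eq_square field_simps)
  also have "\<dots> = ln C + ln (10 / 3) + (101 / 250 * (\<integral>z. X z \<partial>\<mu>) - 39 / 1000 * (\<integral>z. (X z)\<^sup>2 \<partial>\<mu>) - 352 / 750)"
    using iX by (simp add: prob_space)
  \<comment> \<open>After inserting the moments, \<tau> has coefficient 101/2500 - 39/1000 = 0.0014.
    The worst case is \<tau> = 1, where the sum is about -0.0221.\<close>
  also have "\<dots> \<le> ln C + ln (10 / 3) - 22 / 1000"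
    using first_moment[OF ctr] second_moment tau by (simp add: field_simps)
  finally have le: "(\<integral>z. ln (d_fun E z) \<partial>\<mu>) \<le> ln C + ln (10 / 3) - 22 / 1000" .
  have "M_const E = exp (\<integral>z. ln (d_fun E z) \<partial>\<mu>) / C"
    by (simp add: M_const_def equilibrium_measure_eq log_cap_eq)
  also have "\<dots> \<le> exp (ln C + ln (10 / 3) - 22 / 1000) / C"
    using le C by (intro divide_right_mono) auto
  also have "\<dots> = 10 / 3 / exp (22 / 1000)" using C by (simp add: exp_add exp_diff)
  also have "\<dots> \<le> 10 / 3 / (1 + 22 / 1000)"
    by (intro divide_left_mono exp_ge_add_one_self mult_pos_pos) auto
  also have "\<dots> < 3.2617" by simp
  finally show ?thesis .
qed

text \<open>A closed half-plane containing \<open>E\<close> contains the mean of a probability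
  measure on \<open>E\<close>, so no line can separate the center from \<open>E\<close>.\<close>

lemma ctr_in_convex:
  assumes "convex E"
  shows "ctr \<in> E"
proof (rule ccontr)
  assume "ctr \<notin> E"
  then obtain v b where vb: "inner v ctr < b" "\<And>x. x \<in> E \<Longrightarrow> inner v x > b"
    using separating_hyperplane_closed_point[OF assms compact_imp_closed[OF E]] by metis
  interpret prob_space \<mu> by (rule prob_\<mu>)
  have "integrable \<mu> (\<lambda>z. z)"
  proof -
    have "integrable \<mu> (\<lambda>z. complex_of_real (Re z) + \<i> * complex_of_real (Im z))"
      by (intro Bochner_Integration.integrable_add integrable_mult_right integrable_of_real \<mu>_integrable continuous_intros)
    thus ?thesis by (simp add: complex_eq[symmetric])
  qed
  hence "(\<integral>z. inner v z \<partial>\<mu>) = inner v ctr" using ctr_eq by simp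
  moreover have "b \<le> (\<integral>z. inner v z \<partial>\<mu>)"
  proof (rule integral_ge_const)
    show "integrable \<mu> (\<lambda>z. inner v z)" by (intro \<mu>_integrable continuous_intros)
    show "AE z in \<mu>. b \<le> inner v z"
      using prob_measures_on_AE(3)[OF \<mu>_prob_measure] by eventually_elim (use vb(2) in \<open>auto intro: less_imp_le\<close>)
  qed
  ultimately show False using vb(1) by simp
qed

end

section \<open>Sets with at most one point, and the conclusion\<close>

lemma log_cap_pos_imp_two_points:
  assumes "log_cap E > 0"
  shows "\<exists>a\<in>E. \<exists>b\<in>E. a \<noteq> b"
proof (rule ccontr)
  assume "\<not> ?thesis"
  then obtain a where a: "E \<subseteq> {a}" by blast
  have "log_energy \<nu> = \<infinity>" if \<nu>: "\<nu> \<in> prob_measures_on E" for \<nu>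
  proof -
    interpret prob_space \<nu> using \<nu> by (simp add: prob_measures_on_def)
    have sets: "sets \<nu> = sets borel" using \<nu> by (simp add: prob_measures_on_def)
    have fin: "finite E" using a finite_subset by blast
    have "UNIV - E \<in> null_sets \<nu>"
      using \<nu> fin by (auto simp: prob_measures_on_def null_sets_def finite_imp_closed)
    from AE_not_in[OF this] have ae: "AE z in \<nu>. z \<in> {a}" using a by (auto elim!: eventually_mono)
    \<comment> \<open>Almost every pair lies on the diagonal, where the kernel is infinite.\<close>
    have "mutual_energy 1 \<nu> \<nu> = (\<integral>\<^sup>+ z. \<integral>\<^sup>+ w. \<infinity> \<partial>\<nu> \<partial>\<nu>)"
      unfolding mutual_energy_def using ae
    proof (intro nn_integral_cong_AE, eventually_elim)
      case (elim z)
      show ?case using ae by (intro nn_integral_cong_AE, eventually_elim) (use elim in \<open>auto simp: log_kernel_def\<close>)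
    qed
    also have "\<dots> = \<infinity>" by (simp add: emeasure_space_1)
    finally show ?thesis
      by (intro log_energy_mutual_energy(1)[OF prob_space_axioms sets ae, of 1]) auto
  qed
  \<comment> \<open>This includes empty \<open>E\<close>: without admissible measures the infimum
    over the empty set is infinite as well.\<close>
  hence "robin_const E = \<infinity>" unfolding robin_const_def
    by (metis (no_types, lifting) INF_eq_const INF_empty image_cong top_ereal_def empty_iff)
  thus False using assms by (simp add: log_cap_def)
qed

theorem theorem2p6:
  fixes E :: "complex set"
  assumes "compact E" and "connected E" and "log_cap E > 0"
  shows "((\<integral>z. z \<partial>(equilibrium_measure E)) \<in> E \<longrightarrow> M_const E < 2 + 4.02 / pi)
       \<and> (convex E \<longrightarrow> M_const E < 2 + 4 / pi)"
proof -
  obtain a b where ab: "a \<in> E" "b \<in> E" "a \<noteq> b" using log_cap_pos_imp_two_points[OF assms(3)] by blast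
  obtain C h B0 where ext: "C > 0" "h holomorphic_on ball 0 1"
    "inj_on (\<lambda>u. 1 / u + h u) (ball 0 1 - {0})"
    "(\<lambda>u. of_real C * (1 / u + h u)) ` (ball 0 1 - {0}) = outside E"
    "\<And>u. 1 / 2 \<le> cmod u \<Longrightarrow> cmod u < 1 \<Longrightarrow> cmod (of_real C * (1 / u + h u)) \<le> B0"
    by (rule exterior_map[OF assms(1,2) ab]) blast
  obtain B1 where B1: "E \<subseteq> cball 0 B1" 
    using bounded_subset_ballD[OF compact_imp_bounded[OF assms(1)], of 0] ball_subset_cball by blast
  \<comment> \<open>A single bound for \<open>E\<close>, for \<open>F\<close> away from its pole,
    and at least 1, so that ln R is nonnegative.\<close>
  interpret exterior_conformal E C "Max {1, B0, B1}" h
  proof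
    show "E \<subseteq> cball 0 (Max {1, B0, B1})" using B1 by (auto simp: subset_iff)
    show "cmod (of_real C * (1 / u + h u)) \<le> Max {1, B0, B1}" if "1 / 2 \<le> cmod u" "cmod u < 1" for u
      using ext(5)[OF that] by simp
  qed (use assms ext in auto)
  have "3.2617 < 2 + 4 / pi" using pi_less_3156 by (simp add: field_simps)
  moreover have "4 / pi \<le> 4.02 / pi" by (intro divide_right_mono) auto
  ultimately have "M_const E < 2 + 4 / pi" "M_const E < 2 + 4.02 / pi" if "ctr \<in> E"
    using M_const_bound[OF that ab] by linarith+
  thus ?thesis using ctr_eq ctr_in_convex by (simp add: equilibrium_measure_eq)
qed

end
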